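(* Let $V$ be a contractible probability space, let $n\ge 1$, and let $X,Y:S(\mathbb{C}^{n})\to SV$ be two collections of $n$ homotopy random variables in $V$. Then $X$ and $Y$ are homotopic (as $L_\infty$ morphisms from $(\mathbb{C}^n,0)$ to $(V,d^\varphi)$) if and only if their joint cumulants are equal, i.e. $K\circ X=K\circ Y$ as maps $S(\mathbb{C}^n)\to S\mathbb{C}$, where $K$ is the total cumulant of $V$.
   Context: All vector spaces are over $\mathbb{C}$. Chain complexes are $\mathbb{Z}$-graded with differential of degree $+1$; $\mathbb{C}$ is regarded as a complex concentrated in degree $0$ with zero differential. Probability space. A (unital commutative homotopy) probability space is a chain complex $(V,d)$ with a chain map $\upsilon:\mathbb{C}\to V$ (the unit, identified with $\upsilon(1)=1\in V$), a graded commutative associative product on $V$ for which $\upsilon(1)$ is the identity (no compatibility between product and $d$ is assumed), and a chain map $e:V\to\mathbb{C}$ (the expectation) with $e\upsilon=\mathrm{id}_{\mathbb{C}}$ (no compatibility between $e$ and the product is assumed). It is contractible if $e$ is a quasi-isomorphism. Coalgebras. For a graded vector space $V$, $SV=\bigoplus_{k\ge1}S^kV$ is the cofree nilpotent graded cocommutative coalgebra on $V$. A coalgebra map $F:SV\to SW$ is determined by its components $F_k:S^kV\to W$ via $F(a_1\odot\cdots\odot a_n)=\sum_{\pi}\pm\bigodot_{B\in\pi}F_{|B|}(a_B)$, the sum being over partitions $\pi$ of the set $\{1,\dots,n\}$, with Koszul signs, where $a_B$ is the symmetric product of the $a_i$, $i\in B$. $L_\infty$ conventions. An $L_\infty$ structure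 on $V$ is a degree $1$ square-zero coderivation of $SV$; an $L_\infty$ morphism is a degree $0$ coalgebra map commuting with the coderivations. A chain complex $(V,d)$ is an $L_\infty$ algebra by extending $d$ to a coderivation of $SV$, and a chain map is viewed as the $L_\infty$ morphism with only that linear component. Cumulant map and transport. For $V$ with a graded commutative associative product, $\varphi:SV\to SV$ is the coalgebra automorphism with components $a_1\odot\cdots\odot a_n\mapsto a_1\cdots a_n$. For a linear map $f:SV\to SW$, put $f^\varphi=\varphi^{-1}f\varphi$ (with $\varphi$ of $V$ on the right and $\varphi^{-1}$ of $W$ on the left). Thus a probability space $V$ has a transported $L_\infty$ structure $d^\varphi$, and its total cumulant is $K=e^\varphi:SV\to S\mathbb{C}$, an $L_\infty$ morphism $(V,d^\varphi)\to(\mathbb{C},0)$. Collections. A collection of $n$ homotopy random variables in $V$ is an $L_\infty$ morphism $X$ from $(\mathbb{C}^n,0)$ to $(V,d^\varphi)$, i.e. a degree $0$ coalgebra map $X:S(\mathbb{C}^n)\to SV$ with $d^\varphi X=0$. Its joint cumulant is $K\circ X$. Homotopy. For an $L_\infty$ algebra $W$, $W\otimes\mathbb{C}[t,dt]$ (polynomial differential forms on the line, $|t|=0$, $|dt|=1$) is the $L_\infty$ algebra with operations extended $\mathbb{C}[t,dt]$-multilinearly from $W$ together with the de Rham differential added to the linear operation. Two $L_\infty$ morphisms $X,Y$ from $U$ to $W$ are homotopic if there is an $L_\infty$ morphism $H$ from $U$ to $W\otimes\mathbb{C}[t,dt]$ with $H(0)=X$ and $H(1)=Y$, where $H(s)$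 denotes evaluation at $t=s$, $dt=0$. *)

theory Defs
  imports
    "HOL-Analysis.Finite_Cartesian_Product"
    "HOL-Computational_Algebra.Polynomial"
    "HOL-Library.Poly_Mapping"
begin

section \<open>Graded complex vector spaces\<close>

class complex_space = ab_group_add +
  fixes scaleC :: "complex \<Rightarrow> 'a \<Rightarrow> 'a" (infixr "*\<^sub>C" 75)
  assumes scaleC_add_right: "c *\<^sub>C (x + y) = c *\<^sub>C x + c *\<^sub>C y"
    and scaleC_add_left: "(a + b) *\<^sub>C x = a *\<^sub>C x + b *\<^sub>C x"
    and scaleC_scaleC: "a *\<^sub>C b *\<^sub>C x = (a * b) *\<^sub>C x"
    and scaleC_one: "1 *\<^sub>C x = x"

global_interpretation complex_space: vector_space "scaleC :: complex \<Rightarrow> 'a::complex_space \<Rightarrow> 'a"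
  by unfold_locales (simp_all add: scaleC_add_right scaleC_add_left scaleC_scaleC scaleC_one)

abbreviation clinear :: "('a::complex_space \<Rightarrow> 'b::complex_space) \<Rightarrow> bool" where
  "clinear \<equiv> Vector_Spaces.linear scaleC scaleC"

text \<open>A type of this class is the total space \<open>\<Oplus>\<^sub>p V\<^sub>p\<close> of a \<open>\<int>\<close>-graded vector space; the direct
  sum decomposition is given by the projections \<^term>\<open>gpart p\<close> onto the summands.\<close>

class graded_space = complex_space +
  fixes gpart :: "int \<Rightarrow> 'a \<Rightarrow> 'a"
  assumes gpart_add: "gpart p (x + y) = gpart p x + gpart p y"
    and gpart_scaleC: "gpart p (c *\<^sub>C x) = c *\<^sub>C gpart p x"
    and gpart_gpart: "gpart p (gpart q x) = (if p = q then gpart q x else 0)"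
    and finite_gpart: "finite {p. gpart p x \<noteq> 0}"
    and sum_gpart: "(\<Sum>p | gpart p x \<noteq> 0. gpart p x) = x"

definition gcomp :: "int \<Rightarrow> 'a::graded_space set" where
  "gcomp p = range (gpart p)"

definition has_degree :: "int \<Rightarrow> ('a::graded_space \<Rightarrow> 'b::graded_space) \<Rightarrow> bool" where
  "has_degree k f \<longleftrightarrow> (\<forall>p. f ` gcomp p \<subseteq> gcomp (p + k))"

definition homogeneous :: "int list \<Rightarrow> 'a::graded_space list \<Rightarrow> bool" where
  "homogeneous ps xs \<longleftrightarrow> list_all2 (\<lambda>p x. x \<in> gcomp p) ps xs"

abbreviation parity_sign :: "int \<Rightarrow> complex" where
  "parity_sign p \<equiv> (-1) powi p"

instantiation complex :: graded_space
begin
definition "scaleC (c::complex) (x::complex) = c * x"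
definition "gpart (p::int) (x::complex) = (if p = 0 then x else 0)"
instance
proof
  fix x :: complex
  have *: "{p. gpart p x \<noteq> 0} = (if x = 0 then {} else {0})"
    by (auto simp: gpart_complex_def)
  show "finite {p. gpart p x \<noteq> 0}" unfolding * by simp
  show "(\<Sum>p | gpart p x \<noteq> 0. gpart p x) = x" unfolding * by (simp add: gpart_complex_def)
qed (auto simp: scaleC_complex_def gpart_complex_def algebra_simps)
end

lemma sum_gpart_superset:
  assumes "finite A" "{p. gpart p (x::'a::graded_space) \<noteq> 0} \<subseteq> A"
  shows "(\<Sum>p\<in>A. gpart p x) = x"
proof -
  have "(\<Sum>p\<in>A. gpart p x) = (\<Sum>p | gpart p x \<noteq> 0. gpart p x)"
    by (rule sum.mono_neutral_right) (use assms in auto)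
  then show ?thesis by (simp add: sum_gpart)
qed

lemma gpart_0 [simp]: "gpart p (0::'a::graded_space) = 0"
  using gpart_add[of p "0::'a" 0] by simp

instantiation vec :: (graded_space, finite) graded_space
begin
definition "scaleC c (x::'a^'b) = (\<chi> i. c *\<^sub>C (x $ i))"
definition "gpart p (x::'a^'b) = (\<chi> i. gpart p (x $ i))"
instance
proof
  fix x :: "'a^'b"
  have eq: "{p. gpart p x \<noteq> 0} = (\<Union>i. {p. gpart p (x $ i) \<noteq> 0})"
    by (auto simp: gpart_vec_def vec_eq_iff)
  show fin: "finite {p. gpart p x \<noteq> 0}"
    unfolding eq by (auto simp: finite_gpart)
  have "(\<Sum>p | gpart p x \<noteq> 0. gpart p (x $ i)) = x $ i" for i
    by (rule sum_gpart_superset[OF fin]) (auto simp: eq)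
  then show "(\<Sum>p | gpart p x \<noteq> 0. gpart p x) = x"
    by (simp add: vec_eq_iff gpart_vec_def)
qed (auto simp: scaleC_vec_def gpart_vec_def vec_eq_iff gpart_gpart gpart_add gpart_scaleC
      scaleC_add_right scaleC_add_left scaleC_scaleC scaleC_one)
end


section \<open>Tensor products\<close>

lemma lookup_map_mult: "Poly_Mapping.lookup (Poly_Mapping.map ((*) c) f) k = (c::complex) * Poly_Mapping.lookup f k"
  by (simp add: map.rep_eq when_def)

lemma map_mult_add:
  "Poly_Mapping.map ((*) c) (f + g) = Poly_Mapping.map ((*) c) f + Poly_Mapping.map ((*) (c::complex)) g"
  by (rule poly_mapping_eqI) (simp add: lookup_add lookup_map_mult algebra_simps)

lemma map_mult_diff:
  "Poly_Mapping.map ((*) c) (f - g) = Poly_Mapping.map ((*) c) f - Poly_Mapping.map ((*) (c::complex)) g"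
  by (rule poly_mapping_eqI) (simp add: lookup_minus lookup_map_mult algebra_simps)

lemma map_mult_add_left:
  "Poly_Mapping.map ((*) (a + b)) f = Poly_Mapping.map ((*) a) f + Poly_Mapping.map ((*) (b::complex)) f"
  by (rule poly_mapping_eqI) (simp add: lookup_add lookup_map_mult algebra_simps)

lemma map_mult_mult:
  "Poly_Mapping.map ((*) a) (Poly_Mapping.map ((*) b) f) = Poly_Mapping.map ((*) (a * b :: complex)) f"
  by (rule poly_mapping_eqI) (simp add: lookup_map_mult)

lemma map_mult_one: "Poly_Mapping.map ((*) (1::complex)) f = f"
  by (rule poly_mapping_eqI) (simp add: lookup_map_mult)

lemma diff_diff_diff_diff: "(a - c) - (b - d) = (a - b) + - (c - (d::'a::ab_group_add))"
  by simp

lemma map_mult_zero: "Poly_Mapping.map ((*) (c::complex)) 0 = 0"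
  by (rule poly_mapping_eqI) (simp add: lookup_map_mult)

lemma map_mult_minus_one: "Poly_Mapping.map ((*) (-1::complex)) f = - f"
  by (rule poly_mapping_eqI) (simp add: lookup_map_mult)

inductive_set tensor_null :: "('a::complex_space \<times> 'b::complex_space \<Rightarrow>\<^sub>0 complex) set" where
  zero: "0 \<in> tensor_null"
| add: "f \<in> tensor_null \<Longrightarrow> g \<in> tensor_null \<Longrightarrow> f + g \<in> tensor_null"
| add_left: "Poly_Mapping.single (x + x', y) c - Poly_Mapping.single (x, y) c
    - Poly_Mapping.single (x', y) c \<in> tensor_null"
| add_right: "Poly_Mapping.single (x, y + y') c - Poly_Mapping.single (x, y) c
    - Poly_Mapping.single (x, y') c \<in> tensor_null"
| scale_left: "Poly_Mapping.single (a *\<^sub>C x, y) c - Poly_Mapping.single (x, y) (c * a) \<in> tensor_null"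
| scale_right: "Poly_Mapping.single (x, a *\<^sub>C y) c - Poly_Mapping.single (x, y) (c * a) \<in> tensor_null"

lemma tensor_null_scale: "f \<in> tensor_null \<Longrightarrow> Poly_Mapping.map ((*) c) f \<in> tensor_null"
  by (induction rule: tensor_null.induct)
    (auto simp: map_mult_zero map_mult_add map_mult_diff mult.assoc[symmetric] intro: tensor_null.intros)

lemma tensor_null_uminus: "f \<in> tensor_null \<Longrightarrow> - f \<in> tensor_null"
  using tensor_null_scale[of f "-1"] by (simp add: map_mult_minus_one)

quotient_type (overloaded) ('a, 'b) tensor =
  "'a::complex_space \<times> 'b::complex_space \<Rightarrow>\<^sub>0 complex" / "\<lambda>f g. f - g \<in> tensor_null"
proof (rule equivpI)
  show "reflp (\<lambda>f g :: 'a \<times> 'b \<Rightarrow>\<^sub>0 complex. f - g \<in> tensor_null)"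
    by (auto simp: reflp_def tensor_null.zero)
  show "symp (\<lambda>f g :: 'a \<times> 'b \<Rightarrow>\<^sub>0 complex. f - g \<in> tensor_null)"
    by (auto simp: symp_def dest: tensor_null_uminus)
  show "transp (\<lambda>f g :: 'a \<times> 'b \<Rightarrow>\<^sub>0 complex. f - g \<in> tensor_null)"
    by (rule transpI) (drule (1) tensor_null.add, simp)
qed

instantiation tensor :: (complex_space, complex_space) complex_space
begin
lift_definition zero_tensor :: "('a, 'b) tensor" is 0 .
lift_definition plus_tensor :: "('a, 'b) tensor \<Rightarrow> ('a, 'b) tensor \<Rightarrow> ('a, 'b) tensor" is "(+)"
  by (subst add_diff_add) (rule tensor_null.add)
lift_definition uminus_tensor :: "('a, 'b) tensor \<Rightarrow> ('a, 'b) tensor" is uminus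
  by (subst minus_diff_minus) (rule tensor_null_uminus)
lift_definition minus_tensor :: "('a, 'b) tensor \<Rightarrow> ('a, 'b) tensor \<Rightarrow> ('a, 'b) tensor" is "(-)"
  by (subst diff_diff_diff_diff) (intro tensor_null.add tensor_null_uminus)
lift_definition scaleC_tensor :: "complex \<Rightarrow> ('a, 'b) tensor \<Rightarrow> ('a, 'b) tensor"
  is "\<lambda>c. Poly_Mapping.map ((*) c)"
  by (subst map_mult_diff[symmetric]) (rule tensor_null_scale)
instance
  by standard
    (transfer; simp add: algebra_simps tensor_null.zero map_mult_add map_mult_add_left
      map_mult_mult map_mult_one)+
end

lift_definition tens :: "'a::complex_space \<Rightarrow> 'b::complex_space \<Rightarrow> ('a, 'b) tensor" (infixr "\<otimes>" 76)
  is "\<lambda>x y. Poly_Mapping.single (x, y) 1" .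

definition tensor_map :: "('a::complex_space \<Rightarrow> 'c::complex_space) \<Rightarrow> ('b::complex_space \<Rightarrow> 'd::complex_space)
    \<Rightarrow> ('a, 'b) tensor \<Rightarrow> ('c, 'd) tensor" where
  "tensor_map f g = (THE T. clinear T \<and> (\<forall>x y. T (x \<otimes> y) = f x \<otimes> g y))"


section \<open>The cofree nilpotent graded cocommutative coalgebra\<close>

text \<open>The type \<open>'a sym\<close> is \<open>SV = \<Oplus>\<^bsub>k\<ge>1\<^esub> S\<^sup>k V\<close>, the vector space spanned by lists
  \<open>a\<^sub>1 \<odot> \<dots> \<odot> a\<^sub>n\<close> modulo multilinearity and graded symmetry. The generator for the empty list is
  killed since there is no summand for \<open>k = 0\<close>.\<close>

inductive_set sym_null :: "('a::graded_space list \<Rightarrow>\<^sub>0 complex) set" where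
  zero: "0 \<in> sym_null"
| add: "f \<in> sym_null \<Longrightarrow> g \<in> sym_null \<Longrightarrow> f + g \<in> sym_null"
| empty: "Poly_Mapping.single [] c \<in> sym_null"
| add_entry: "Poly_Mapping.single (us @ (x + y) # vs) c - Poly_Mapping.single (us @ x # vs) c
    - Poly_Mapping.single (us @ y # vs) c \<in> sym_null"
| scale_entry: "Poly_Mapping.single (us @ (a *\<^sub>C x) # vs) c
    - Poly_Mapping.single (us @ x # vs) (c * a) \<in> sym_null"
| swap: "x \<in> gcomp p \<Longrightarrow> y \<in> gcomp q \<Longrightarrow> Poly_Mapping.single (us @ x # y # vs) c
    - Poly_Mapping.single (us @ y # x # vs) (c * parity_sign (p * q)) \<in> sym_null"

lemma sym_null_scale: "f \<in> sym_null \<Longrightarrow> Poly_Mapping.map ((*) c) f \<in> sym_null"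
  by (induction rule: sym_null.induct)
    (auto simp: map_mult_zero map_mult_add map_mult_diff mult.assoc[symmetric] intro: sym_null.intros)

lemma sym_null_uminus: "f \<in> sym_null \<Longrightarrow> - f \<in> sym_null"
  using sym_null_scale[of f "-1"] by (simp add: map_mult_minus_one)

quotient_type (overloaded) 'a sym = "'a::graded_space list \<Rightarrow>\<^sub>0 complex" / "\<lambda>f g. f - g \<in> sym_null"
proof (rule equivpI)
  show "reflp (\<lambda>f g :: 'a list \<Rightarrow>\<^sub>0 complex. f - g \<in> sym_null)"
    by (auto simp: reflp_def sym_null.zero)
  show "symp (\<lambda>f g :: 'a list \<Rightarrow>\<^sub>0 complex. f - g \<in> sym_null)"
    by (auto simp: symp_def dest: sym_null_uminus)
  show "transp (\<lambda>f g :: 'a list \<Rightarrow>\<^sub>0 complex. f - g \<in> sym_null)"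
    by (rule transpI) (drule (1) sym_null.add, simp)
qed

instantiation sym :: (graded_space) complex_space
begin
lift_definition zero_sym :: "'a sym" is 0 .
lift_definition plus_sym :: "'a sym \<Rightarrow> 'a sym \<Rightarrow> 'a sym" is "(+)"
  by (subst add_diff_add) (rule sym_null.add)
lift_definition uminus_sym :: "'a sym \<Rightarrow> 'a sym" is uminus
  by (subst minus_diff_minus) (rule sym_null_uminus)
lift_definition minus_sym :: "'a sym \<Rightarrow> 'a sym \<Rightarrow> 'a sym" is "(-)"
  by (subst diff_diff_diff_diff) (intro sym_null.add sym_null_uminus)
lift_definition scaleC_sym :: "complex \<Rightarrow> 'a sym \<Rightarrow> 'a sym"
  is "\<lambda>c. Poly_Mapping.map ((*) c)"
  by (subst map_mult_diff[symmetric]) (rule sym_null_scale)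
instance
  by standard
    (transfer; simp add: algebra_simps sym_null.zero map_mult_add map_mult_add_left
      map_mult_mult map_mult_one)+
end

lift_definition sym_prod :: "'a::graded_space list \<Rightarrow> 'a sym" ("\<Odot>") is "\<lambda>xs. Poly_Mapping.single xs 1" .

definition sym_comp :: "int \<Rightarrow> 'a::graded_space sym set" where
  "sym_comp p = complex_space.span {\<Odot> xs |ps xs. homogeneous ps xs \<and> sum_list ps = p}"

definition sym_has_degree :: "int \<Rightarrow> ('a::graded_space sym \<Rightarrow> 'b::graded_space sym) \<Rightarrow> bool" where
  "sym_has_degree k F \<longleftrightarrow> (\<forall>p. F ` sym_comp p \<subseteq> sym_comp (p + k))"

definition sym_proj :: "'a::graded_space sym \<Rightarrow> 'a" where
  "sym_proj = (THE f. clinear f \<and> (\<forall>xs. f (\<Odot> xs) = (if length xs = 1 then hd xs else 0)))"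

text \<open>The Koszul sign of the permutation that moves the entries with index in \<open>B\<close> in front of the
  others, preserving the order inside both groups; \<open>ps\<close> are the degrees of the entries.\<close>

definition unshuffle_sign :: "int list \<Rightarrow> nat set \<Rightarrow> complex" where
  "unshuffle_sign ps B =
    (\<Prod>(i, j) | i < j \<and> j < length ps \<and> i \<notin> B \<and> j \<in> B. parity_sign (ps ! i * ps ! j))"

definition coprod :: "'a::graded_space sym \<Rightarrow> ('a sym, 'a sym) tensor" where
  "coprod = (THE D. clinear D \<and> (\<forall>ps xs. homogeneous ps xs \<longrightarrow>
    D (\<Odot> xs) = (\<Sum>B | B \<noteq> {} \<and> B \<subset> {..<length xs}.
      unshuffle_sign ps B *\<^sub>C (\<Odot> (nths xs B) \<otimes> \<Odot> (nths xs (- B))))))"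

definition coalgebra_map :: "('a::graded_space sym \<Rightarrow> 'b::graded_space sym) \<Rightarrow> bool" where
  "coalgebra_map F \<longleftrightarrow> clinear F \<and> coprod \<circ> F = tensor_map F F \<circ> coprod"

text \<open>\<open>D \<otimes> 1 + 1 \<otimes> D\<close> for \<open>D\<close> of degree \<open>1\<close>; the sign arises from moving \<open>D\<close> past \<open>x\<close>.\<close>

definition leibniz :: "('a::graded_space sym \<Rightarrow> 'a sym) \<Rightarrow> ('a sym, 'a sym) tensor \<Rightarrow> ('a sym, 'a sym) tensor" where
  "leibniz D = (THE T. clinear T \<and>
    (\<forall>p. \<forall>x\<in>sym_comp p. \<forall>y. T (x \<otimes> y) = D x \<otimes> y + parity_sign p *\<^sub>C (x \<otimes> D y)))"

definition coderivation :: "('a::graded_space sym \<Rightarrow> 'a sym) \<Rightarrow> bool" where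
  "coderivation D \<longleftrightarrow> clinear D \<and> sym_has_degree 1 D \<and> coprod \<circ> D = leibniz D \<circ> coprod"

text \<open>By cofreeness, a coalgebra map or coderivation is determined by its components, the
  restrictions of its composite with \<^const>\<open>sym_proj\<close> to the summands \<open>S\<^sup>k V\<close>. A family of
  components is given as a function on lists (multilinear and graded symmetric in the entries).\<close>

definition coalgebra_map_of :: "('a::graded_space list \<Rightarrow> 'b::graded_space) \<Rightarrow> 'a sym \<Rightarrow> 'b sym" where
  "coalgebra_map_of f = (THE F. coalgebra_map F \<and> (\<forall>xs. xs \<noteq> [] \<longrightarrow> sym_proj (F (\<Odot> xs)) = f xs))"

definition coderivation_of :: "('a::graded_space list \<Rightarrow> 'a) \<Rightarrow> 'a sym \<Rightarrow> 'a sym" where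
  "coderivation_of f = (THE D. coderivation D \<and> (\<forall>xs. xs \<noteq> [] \<longrightarrow> sym_proj (D (\<Odot> xs)) = f xs))"

definition linear_part :: "('a \<Rightarrow> 'b::zero) \<Rightarrow> 'a list \<Rightarrow> 'b" where
  "linear_part f xs = (if length xs = 1 then f (hd xs) else 0)"


section \<open>\<open>L\<^sub>\<infinity>\<close> algebras and homotopies\<close>

definition linfty_structure :: "('a::graded_space sym \<Rightarrow> 'a sym) \<Rightarrow> bool" where
  "linfty_structure Q \<longleftrightarrow> coderivation Q \<and> Q \<circ> Q = (\<lambda>_. 0)"

definition linfty_morphism :: "('a::graded_space sym \<Rightarrow> 'a sym) \<Rightarrow> ('b::graded_space sym \<Rightarrow> 'b sym)
    \<Rightarrow> ('a sym \<Rightarrow> 'b sym) \<Rightarrow> bool" where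
  "linfty_morphism Q Q' F \<longleftrightarrow> linfty_structure Q \<and> linfty_structure Q' \<and>
    coalgebra_map F \<and> sym_has_degree 0 F \<and> F \<circ> Q = Q' \<circ> F"

text \<open>\<^term>\<open>Forms f g\<close> is the element \<open>f(t) + g(t) dt\<close> of \<open>V \<otimes> \<complex>[t,dt] = V[t] \<oplus> V[t] dt\<close>;
  in particular \<open>\<complex>[t,dt]\<close> itself is \<open>complex forms\<close>.\<close>

context notes [[typedef_overloaded]]
begin
datatype 'a forms = Forms (fun_part: "'a::zero poly") (dt_part: "'a poly")
end


instantiation forms :: (ab_group_add) ab_group_add
begin
definition "0 = Forms 0 (0 :: 'a poly)"
definition "x + y = Forms (fun_part x + fun_part y) (dt_part x + dt_part (y :: 'a forms))"
definition "x - y = Forms (fun_part x - fun_part y) (dt_part x - dt_part (y :: 'a forms))"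
definition "- x = Forms (- fun_part x) (- dt_part (x :: 'a forms))"
instance
  by standard (auto simp: zero_forms_def plus_forms_def minus_forms_def uminus_forms_def algebra_simps)
end

instantiation forms :: (graded_space) graded_space
begin
definition "c *\<^sub>C x = Forms (map_poly (scaleC c) (fun_part x)) (map_poly (scaleC c) (dt_part (x :: 'a forms)))"
definition "gpart p x = Forms (map_poly (gpart p) (fun_part x)) (map_poly (gpart (p - 1)) (dt_part (x :: 'a forms)))"
lemmas forms_defs = zero_forms_def plus_forms_def minus_forms_def uminus_forms_def
  scaleC_forms_def gpart_forms_def
instance
proof
  fix x :: "'a forms"
  have *: "finite {p. map_poly (gpart p) f \<noteq> 0}" "(\<Sum>p\<in>A. map_poly (gpart p) f) = f"
    if "finite A" "{p. map_poly (gpart p) f \<noteq> 0} \<subseteq> A" for A and f :: "'a poly"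
  proof -
    show "finite {p. map_poly (gpart p) f \<noteq> 0}" using that finite_subset by blast
    have "(\<Sum>p\<in>A. gpart p (coeff f i)) = coeff f i" for i
      by (rule sum_gpart_superset[OF that(1)])
        (use that(2) in \<open>auto simp: poly_eq_iff coeff_map_poly\<close>)
    then show "(\<Sum>p\<in>A. map_poly (gpart p) f) = f"
      by (simp add: poly_eq_iff coeff_sum coeff_map_poly)
  qed
  have fin: "finite {p. map_poly (gpart p) f \<noteq> 0}" for f :: "'a poly"
  proof (rule finite_subset)
    show "{p. map_poly (gpart p) f \<noteq> 0} \<subseteq> (\<Union>i\<le>degree f. {p. gpart p (coeff f i) \<noteq> 0})"
    proof
      fix p assume "p \<in> {p. map_poly (gpart p) f \<noteq> 0}"
      then obtain i where i: "gpart p (coeff f i) \<noteq> 0"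
        by (auto simp: poly_eq_iff coeff_map_poly)
      then have "coeff f i \<noteq> 0" by auto
      then have "i \<le> degree f" by (rule le_degree)
      with i show "p \<in> (\<Union>i\<le>degree f. {p. gpart p (coeff f i) \<noteq> 0})" by blast
    qed
  qed (auto simp: finite_gpart)
  have shift: "{p. map_poly (gpart (p - 1)) f \<noteq> 0} = (\<lambda>p. p + 1) ` {p. map_poly (gpart p) f \<noteq> 0}"
    for f :: "'a poly"
  proof (rule set_eqI)
    show "p \<in> {p. map_poly (gpart (p - 1)) f \<noteq> 0} \<longleftrightarrow> p \<in> (\<lambda>p. p + 1) ` {p. map_poly (gpart p) f \<noteq> 0}" for p
      using image_eqI[of p "\<lambda>p. p + 1" "p - 1" "{p. map_poly (gpart p) f \<noteq> 0}"] by auto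
  qed
  have eq: "{p. gpart p x \<noteq> 0} = {p. map_poly (gpart p) (fun_part x) \<noteq> 0}
      \<union> {p. map_poly (gpart (p - 1)) (dt_part x) \<noteq> 0}"
    by (auto simp: forms_defs)
  show finx: "finite {p. gpart p x \<noteq> 0}" unfolding eq shift using fin by auto
  have sums: "(\<Sum>p\<in>A. Forms (f p) (g p)) = Forms (sum f A) (sum g A)" if "finite A"
    for A :: "int set" and f g :: "int \<Rightarrow> 'a poly"
    using that by (induction A) (auto simp: forms_defs)
  let ?A = "{p. gpart p x \<noteq> 0}"
  have "(\<Sum>p\<in>?A. map_poly (gpart p) (fun_part x)) = fun_part x"
    by (rule *(2)[OF finx]) (auto simp: eq)
  moreover have "(\<Sum>p\<in>?A. map_poly (gpart (p - 1)) (dt_part x))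
      = (\<Sum>p\<in>(\<lambda>p. p - 1) ` ?A. map_poly (gpart p) (dt_part x))"
    by (subst sum.reindex) (auto simp: inj_on_def)
  moreover have "\<dots> = dt_part x"
  proof (rule *(2))
    show "{p. map_poly (gpart p) (dt_part x) \<noteq> 0} \<subseteq> (\<lambda>p. p - 1) ` ?A"
    proof
      fix p assume "p \<in> {p. map_poly (gpart p) (dt_part x) \<noteq> 0}"
      then have "p + 1 \<in> ?A" by (simp add: eq)
      then have "(p + 1) - 1 \<in> (\<lambda>p. p - 1) ` ?A" by (rule imageI)
      then show "p \<in> (\<lambda>p. p - 1) ` ?A" by simp
    qed
  qed (use finx in auto)
  moreover have "(\<Sum>p\<in>?A. gpart p x) = Forms (\<Sum>p\<in>?A. map_poly (gpart p) (fun_part x))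
      (\<Sum>p\<in>?A. map_poly (gpart (p - 1)) (dt_part x))"
    by (subst sums[OF finx, symmetric]) (rule sum.cong[OF refl gpart_forms_def])
  ultimately show "(\<Sum>p\<in>?A. gpart p x) = x"
    by simp
qed (auto simp: forms_defs forms.expand poly_eq_iff coeff_map_poly gpart_add gpart_scaleC gpart_gpart
  scaleC_add_right scaleC_add_left scaleC_scaleC scaleC_one)
end

definition form_tensor :: "'a::graded_space \<Rightarrow> complex forms \<Rightarrow> 'a forms" where
  "form_tensor v \<omega> =
    Forms (map_poly (\<lambda>c. c *\<^sub>C v) (fun_part \<omega>)) (map_poly (\<lambda>c. c *\<^sub>C v) (dt_part \<omega>))"

definition form_mult :: "complex forms \<Rightarrow> complex forms \<Rightarrow> complex forms" where
  "form_mult \<omega> \<eta> = Forms (fun_part \<omega> * fun_part \<eta>)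
    (fun_part \<omega> * dt_part \<eta> + dt_part \<omega> * fun_part \<eta>)"

definition de_rham :: "complex forms \<Rightarrow> complex forms" where
  "de_rham \<omega> = Forms 0 (pderiv (fun_part \<omega>))"

definition list_mult :: "('a \<Rightarrow> 'a \<Rightarrow> 'a) \<Rightarrow> 'a list \<Rightarrow> 'a" where
  "list_mult m xs = foldl m (hd xs) (tl xs)"

text \<open>The \<open>L\<^sub>\<infinity>\<close> structure on \<open>W \<otimes> \<complex>[t,dt]\<close>. The \<open>k\<close>-ary operation is given by
  \<open>\<ell>\<^sub>k(w\<^sub>1 \<otimes> \<omega>\<^sub>1, \<dots>, w\<^sub>k \<otimes> \<omega>\<^sub>k) = \<plusminus> \<ell>\<^sub>k(w\<^sub>1, \<dots>, w\<^sub>k) \<otimes> \<omega>\<^sub>1 \<cdots> \<omega>\<^sub>k\<close>, where the sign arises from moving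
  each \<open>\<omega>\<^sub>i\<close> past \<open>w\<^sub>j\<close> for \<open>j > i\<close>; for \<open>k = 1\<close> one adds \<open>w \<otimes> \<omega> \<mapsto> (-1)\<^bsup>|w|\<^esup> w \<otimes> d\<omega>\<close>.\<close>

definition forms_structure :: "('a::graded_space sym \<Rightarrow> 'a sym) \<Rightarrow> 'a forms sym \<Rightarrow> 'a forms sym" where
  "forms_structure Q = (THE R. coderivation R \<and>
    (\<forall>ps ws qs \<omega>s. ws \<noteq> [] \<and> length \<omega>s = length ws \<and> homogeneous ps ws \<and> homogeneous qs \<omega>s \<longrightarrow>
      sym_proj (R (\<Odot> (map2 form_tensor ws \<omega>s))) =
        (\<Prod>(i, j) | i < j \<and> j < length ws. parity_sign (qs ! i * ps ! j))
          *\<^sub>C form_tensor (sym_proj (Q (\<Odot> ws))) (list_mult form_mult \<omega>s)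
        + (if length ws = 1 then parity_sign (hd ps) *\<^sub>C form_tensor (hd ws) (de_rham (hd \<omega>s)) else 0)))"

text \<open>Evaluation at \<open>t = s\<close>, \<open>dt = 0\<close>.\<close>

definition eval_form :: "complex \<Rightarrow> 'a::graded_space forms \<Rightarrow> 'a" where
  "eval_form s x = (\<Sum>i\<le>degree (fun_part x). s ^ i *\<^sub>C coeff (fun_part x) i)"

definition linfty_homotopic :: "('a::graded_space sym \<Rightarrow> 'a sym) \<Rightarrow> ('b::graded_space sym \<Rightarrow> 'b sym)
    \<Rightarrow> ('a sym \<Rightarrow> 'b sym) \<Rightarrow> ('a sym \<Rightarrow> 'b sym) \<Rightarrow> bool" where
  "linfty_homotopic Q Q' X Y \<longleftrightarrow> (\<exists>H. linfty_morphism Q (forms_structure Q') H \<and>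
    coalgebra_map_of (linear_part (eval_form 0)) \<circ> H = X \<and>
    coalgebra_map_of (linear_part (eval_form 1)) \<circ> H = Y)"


section \<open>Chain complexes\<close>

definition chain_complex :: "('a::graded_space \<Rightarrow> 'a) \<Rightarrow> bool" where
  "chain_complex d \<longleftrightarrow> clinear d \<and> has_degree 1 d \<and> d \<circ> d = (\<lambda>_. 0)"

definition chain_map :: "('a::graded_space \<Rightarrow> 'a) \<Rightarrow> ('b::graded_space \<Rightarrow> 'b) \<Rightarrow> ('a \<Rightarrow> 'b) \<Rightarrow> bool" where
  "chain_map d d' f \<longleftrightarrow> clinear f \<and> has_degree 0 f \<and> f \<circ> d = d' \<circ> f"

definition cocycles :: "('a::graded_space \<Rightarrow> 'a) \<Rightarrow> int \<Rightarrow> 'a set" where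
  "cocycles d p = {x \<in> gcomp p. d x = 0}"

definition cohomologous :: "('a::graded_space \<Rightarrow> 'a) \<Rightarrow> int \<Rightarrow> ('a \<times> 'a) set" where
  "cohomologous d p = {(x, y). x \<in> cocycles d p \<and> y \<in> cocycles d p \<and> x - y \<in> d ` gcomp (p - 1)}"

definition cohomology :: "('a::graded_space \<Rightarrow> 'a) \<Rightarrow> int \<Rightarrow> 'a set set" where
  "cohomology d p = cocycles d p // cohomologous d p"

definition quasi_isomorphism :: "('a::graded_space \<Rightarrow> 'a) \<Rightarrow> ('b::graded_space \<Rightarrow> 'b) \<Rightarrow> ('a \<Rightarrow> 'b) \<Rightarrow> bool" where
  "quasi_isomorphism d d' f \<longleftrightarrow> chain_map d d' f \<and>
    (\<forall>p. bij_betw (\<lambda>c. cohomologous d' p `` (f ` c)) (cohomology d p) (cohomology d' p))"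


section \<open>Homotopy probability spaces\<close>

definition homotopy_probability_space :: "('v::graded_space \<Rightarrow> 'v) \<Rightarrow> ('v \<Rightarrow> 'v \<Rightarrow> 'v) \<Rightarrow>
    (complex \<Rightarrow> 'v) \<Rightarrow> ('v \<Rightarrow> complex) \<Rightarrow> bool" where
  "homotopy_probability_space d m \<upsilon> e \<longleftrightarrow>
    chain_complex d \<and> chain_map (\<lambda>_. 0) d \<upsilon> \<and> chain_map d (\<lambda>_. 0) e \<and> e \<circ> \<upsilon> = id \<and>
    (\<forall>x. clinear (m x)) \<and> (\<forall>y. clinear (\<lambda>x. m x y)) \<and>
    (\<forall>p q. \<forall>x\<in>gcomp p. \<forall>y\<in>gcomp q. m x y \<in> gcomp (p + q) \<and> m x y = parity_sign (p * q) *\<^sub>C m y x) \<and>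
    (\<forall>x y z. m (m x y) z = m x (m y z)) \<and>
    (\<forall>x. m (\<upsilon> 1) x = x \<and> m x (\<upsilon> 1) = x)"

definition contractible_space :: "('v::graded_space \<Rightarrow> 'v) \<Rightarrow> ('v \<Rightarrow> complex) \<Rightarrow> bool" where
  "contractible_space d e \<longleftrightarrow> quasi_isomorphism d (\<lambda>_. 0) e"

definition cumulant_map :: "('v::graded_space \<Rightarrow> 'v \<Rightarrow> 'v) \<Rightarrow> 'v sym \<Rightarrow> 'v sym" where
  "cumulant_map m = coalgebra_map_of (list_mult m)"

definition transport :: "('v::graded_space \<Rightarrow> 'v \<Rightarrow> 'v) \<Rightarrow> ('w::graded_space \<Rightarrow> 'w \<Rightarrow> 'w) \<Rightarrow>
    ('v sym \<Rightarrow> 'w sym) \<Rightarrow> 'v sym \<Rightarrow> 'w sym" where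
  "transport m m' F = inv (cumulant_map m') \<circ> F \<circ> cumulant_map m"

definition transported_structure :: "('v::graded_space \<Rightarrow> 'v) \<Rightarrow> ('v \<Rightarrow> 'v \<Rightarrow> 'v) \<Rightarrow> 'v sym \<Rightarrow> 'v sym" where
  "transported_structure d m = transport m m (coderivation_of (linear_part d))"

definition total_cumulant :: "('v::graded_space \<Rightarrow> 'v \<Rightarrow> 'v) \<Rightarrow> ('v \<Rightarrow> complex) \<Rightarrow> 'v sym \<Rightarrow> complex sym" where
  "total_cumulant m e = transport m (*) (coalgebra_map_of (linear_part e))"

text \<open>\<open>\<complex>\<^sup>n\<close> is \<^typ>\<open>complex ^ 'n\<close>, graded componentwise and hence concentrated in degree \<open>0\<close>.\<close>

definition homotopy_random_variables :: "('v::graded_space \<Rightarrow> 'v) \<Rightarrow> ('v \<Rightarrow> 'v \<Rightarrow> 'v) \<Rightarrow>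
    ((complex ^ 'n) sym \<Rightarrow> 'v sym) \<Rightarrow> bool" where
  "homotopy_random_variables d m X \<longleftrightarrow> linfty_morphism (\<lambda>_. 0) (transported_structure d m) X"

definition joint_cumulant :: "('v::graded_space \<Rightarrow> 'v \<Rightarrow> 'v) \<Rightarrow> ('v \<Rightarrow> complex) \<Rightarrow>
    ((complex ^ 'n) sym \<Rightarrow> 'v sym) \<Rightarrow> (complex ^ 'n) sym \<Rightarrow> complex sym" where
  "joint_cumulant m e X = total_cumulant m e \<circ> X"

end

theory Submission
  imports Defs "HOL-Library.Product_Plus" "HOL-Library.Function_Algebras"
begin

text \<open>
  The cumulant map \<open>\<phi>\<close> is an automorphism of the coalgebra \<open>SV\<close>, so composing with it turns a
  collection \<open>X\<close> into a coalgebra map \<open>\<phi> X : S(\<complex>\<^sup>n) \<rightarrow> SV\<close> that is killed by the coderivation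
  extending the linear map \<open>d\<close>. By cofreeness such a map is the same thing as its components, a
  linear map \<open>f\<close> from \<open>S(\<complex>\<^sup>n)\<close> to the cocycles of degree zero of \<open>(V, d)\<close>
  (\<open>zero_morphism_components\<close>, \<open>zero_morphism_exists\<close>). The total cumulant satisfies \<open>\<phi> K =
  S(e) \<phi>\<close>, hence the joint cumulants of \<open>X\<close> and \<open>Y\<close> agree if and only if \<open>e f = e g\<close> for the
  two families of components (\<open>joint_cumulant_eq_iff\<close>).

  The same description applies to homotopies. Transport along the cumulant map commutes with
  tensoring by \<open>\<Omega> = \<complex>[t,dt]\<close> (\<open>forms_structure_transported\<close>): the \<open>d\<close>-part of the structure on
  \<open>V \<otimes> \<Omega>\<close> is the \<open>\<Omega>\<close>-multilinear extension of the one on \<open>V\<close>, and the de Rham part is linear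
  because the de Rham differential is a derivation of the product and therefore commutes with
  the cumulant map. So a homotopy from \<open>X\<close> to \<open>Y\<close> amounts to a linear map from \<open>S(\<complex>\<^sup>n)\<close> to the
  closed forms of degree zero in \<open>V \<otimes> \<Omega>\<close> with value \<open>f\<close> at \<open>t = 0\<close> and \<open>g\<close> at \<open>t = 1\<close>. If there
  is one, applying \<open>e\<close> gives closed polynomial functions, which are constant, so \<open>e f = e g\<close>
  (\<open>closed_form_end_points\<close>). If conversely \<open>e f = e g\<close>, contractibility provides a linear \<open>h\<close>
  with \<open>d h = g - f\<close>, and \<open>f + (g - f) t - h dt\<close> is such a map (\<open>joining_form_closed\<close>).

  Most of the work goes into the coalgebra \<open>SV\<close>. It is described by operators on \<open>\<complex> \<oplus> SV\<close>:
  linear maps out of this space are obtained from families of operators \<open>L\<^sub>x\<close>, linear in the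
  vector \<open>x\<close>, that commute up to the Koszul sign (\<open>ulift_adjoin\<close>). The coproduct, derivations,
  the cumulant map, the maps \<open>S(f)\<close> and the comparison of \<open>S(V \<otimes> \<Omega>)\<close> with \<open>SV \<otimes> \<Omega>\<close> all arise in
  this way, and their properties follow from commutation relations between operators, without
  sums over partitions. For instance the cumulant map turns multiplication by \<open>x\<close> into the
  operator that adds \<open>x\<close> to a word either as a new letter or as a factor of one of the letters.
  Uniqueness in cofreeness holds since multiplying back the reduced coproduct of a word of
  length \<open>n\<close> gives \<open>2\<^sup>n - 2\<close> times the word (\<open>coprod_injective\<close>). Existence is reduced to the
  cumulant map of the commutative algebra \<open>\<complex> \<oplus> SU\<close> itself (\<open>cofree_lift\<close>).
\<close>

section \<open>Linear algebra over the complex numbers\<close>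

lemma clinear_iff:
  "clinear f \<longleftrightarrow> (\<forall>x y. f (x + y) = f x + f y) \<and> (\<forall>c x. f (c *\<^sub>C x) = c *\<^sub>C f x)"
  unfolding Vector_Spaces.linear_iff
  by (auto intro: complex_space.vector_space_axioms)

lemma clinearI:
  assumes "\<And>x y. f (x + y) = f x + f y" "\<And>c x. f (c *\<^sub>C x) = c *\<^sub>C f x"
  shows "clinear f"
  using assms by (simp add: clinear_iff)

lemma clinear_add: "clinear f \<Longrightarrow> f (x + y) = f x + f y"
  and clinear_scale: "clinear f \<Longrightarrow> f (c *\<^sub>C x) = c *\<^sub>C f x"
  by (auto simp: clinear_iff)

lemma scaleC_minus_left: "(- c) *\<^sub>C (x :: 'a::complex_space) = - (c *\<^sub>C x)"
  and scaleC_diff_right: "c *\<^sub>C (x - y :: 'a::complex_space) = c *\<^sub>C x - c *\<^sub>C y"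
  and scaleC_diff_left: "(a - c) *\<^sub>C (x :: 'a::complex_space) = a *\<^sub>C x - c *\<^sub>C x"
  and scaleC_sum_right: "c *\<^sub>C (\<Sum>i\<in>I. g i :: 'a) = (\<Sum>i\<in>I. c *\<^sub>C g i)"
  by (simp_all add: complex_space.scale_right_diff_distrib complex_space.scale_left_diff_distrib
      complex_space.scale_sum_right)


lemma clinear_0: "clinear f \<Longrightarrow> f 0 = 0"
  using clinear_scale[of f 0 0] by simp

lemma clinear_minus: "clinear f \<Longrightarrow> f (- x) = - f x"
  using clinear_scale[of f "-1" x] by (simp add: scaleC_minus_left)

lemma clinear_diff: "clinear f \<Longrightarrow> f (x - y) = f x - f y"
  using clinear_add[of f x "- y"] by (simp add: clinear_minus)

lemma clinear_sum: "clinear f \<Longrightarrow> f (\<Sum>i\<in>I. g i) = (\<Sum>i\<in>I. f (g i))"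
  by (induction I rule: infinite_finite_induct) (auto simp: clinear_0 clinear_add)

lemmas clinear_simps = clinear_add clinear_scale clinear_0 clinear_minus clinear_diff clinear_sum

named_theorems clinear_intros

lemma clinear_const_0 [clinear_intros]: "clinear (\<lambda>x. 0)"
  and clinear_id [clinear_intros]: "clinear (\<lambda>x. x)"
  and clinear_plus [clinear_intros]: "clinear f \<Longrightarrow> clinear g \<Longrightarrow> clinear (\<lambda>x. f x + g x)"
  and clinear_scaleC [clinear_intros]: "clinear f \<Longrightarrow> clinear (\<lambda>x. c *\<^sub>C f x)"
  and clinear_scaleC_left [clinear_intros]: "clinear h \<Longrightarrow> clinear (\<lambda>x. h x *\<^sub>C v)"
  by (auto intro!: clinearI simp: clinear_simps scaleC_add_right scaleC_add_left scaleC_complex_def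
      algebra_simps)

lemma clinear_minus_fun [clinear_intros]: "clinear f \<Longrightarrow> clinear g \<Longrightarrow> clinear (\<lambda>x. f x - g x)"
  by (auto intro!: clinearI simp: clinear_simps scaleC_diff_right)

lemma clinear_sum_fun [clinear_intros]:
  "(\<And>i. i \<in> I \<Longrightarrow> clinear (f i)) \<Longrightarrow> clinear (\<lambda>x. \<Sum>i\<in>I. f i x)"
  by (auto intro!: clinearI simp: clinear_simps sum.distrib scaleC_sum_right)

lemma clinear_compose: "clinear f \<Longrightarrow> clinear g \<Longrightarrow> clinear (\<lambda>x. f (g x))"
  by (auto intro!: clinearI simp: clinear_simps)

instantiation prod :: (complex_space, complex_space) complex_space
begin
definition "scaleC c (x :: 'a \<times> 'b) = (c *\<^sub>C fst x, c *\<^sub>C snd x)"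
instance
  by standard (auto simp: scaleC_prod_def prod_eq_iff scaleC_add_right scaleC_add_left)
end

text \<open>This serves for families of vectors that are indexed by the degree.\<close>

instantiation "fun" :: (type, complex_space) complex_space
begin
definition "scaleC c (x :: 'a \<Rightarrow> 'b) = (\<lambda>i. c *\<^sub>C x i)"
instance
  by standard (auto simp: scaleC_fun_def fun_eq_iff scaleC_add_right scaleC_add_left)
end

lemma scaleC_Pair [simp]: "c *\<^sub>C (a, b) = (c *\<^sub>C a, c *\<^sub>C b)"
  and fst_scaleC [simp]: "fst (c *\<^sub>C x) = c *\<^sub>C fst x"
  and snd_scaleC [simp]: "snd (c *\<^sub>C x) = c *\<^sub>C snd x"
  by (simp_all add: scaleC_prod_def)

lemma clinear_fst [clinear_intros]: "clinear f \<Longrightarrow> clinear (\<lambda>x. fst (f x))"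
  and clinear_snd [clinear_intros]: "clinear g \<Longrightarrow> clinear (\<lambda>x. snd (g x))"
  and clinear_Pair [clinear_intros]: "clinear h \<Longrightarrow> clinear k \<Longrightarrow> clinear (\<lambda>x. (h x, k x))"
  by (auto intro!: clinearI simp: clinear_simps)

definition cbilinear :: "('a::complex_space \<Rightarrow> 'b::complex_space \<Rightarrow> 'c::complex_space) \<Rightarrow> bool" where
  "cbilinear \<beta> \<longleftrightarrow> (\<forall>x. clinear (\<beta> x)) \<and> (\<forall>y. clinear (\<lambda>x. \<beta> x y))"

lemma cbilinearI: "(\<And>x. clinear (\<beta> x)) \<Longrightarrow> (\<And>y. clinear (\<lambda>x. \<beta> x y)) \<Longrightarrow> cbilinear \<beta>"
  by (simp add: cbilinear_def)

lemma cbilinear_left: "cbilinear \<beta> \<Longrightarrow> clinear (\<lambda>x. \<beta> x y)"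
  and cbilinear_right: "cbilinear \<beta> \<Longrightarrow> clinear (\<beta> x)"
  by (simp_all add: cbilinear_def)

lemmas cbilinear_simps = clinear_simps[OF cbilinear_left] clinear_simps[OF cbilinear_right]

lemma clinear_bil_left: "cbilinear \<beta> \<Longrightarrow> clinear f \<Longrightarrow> clinear (\<lambda>x. \<beta> (f x) y)"
  and clinear_bil_right: "cbilinear \<beta> \<Longrightarrow> clinear g \<Longrightarrow> clinear (\<lambda>x. \<beta> z (g x))"
  by (auto simp: cbilinear_def intro: clinear_compose)

text \<open>The types of tensors and of symmetric words are quotients of free vector spaces; linear maps
  out of them are obtained from linear extensions that kill the relations.\<close>

definition free_lift :: "('k \<Rightarrow> 'b::complex_space) \<Rightarrow> ('k \<Rightarrow>\<^sub>0 complex) \<Rightarrow> 'b" where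
  "free_lift g f = (\<Sum>k\<in>Poly_Mapping.keys f. Poly_Mapping.lookup f k *\<^sub>C g k)"

lemma free_lift_superset:
  assumes "finite K" "Poly_Mapping.keys f \<subseteq> K"
  shows "free_lift g f = (\<Sum>k\<in>K. Poly_Mapping.lookup f k *\<^sub>C g k)"
  unfolding free_lift_def
  by (rule sum.mono_neutral_left) (use assms in \<open>auto simp: in_keys_iff\<close>)

lemma free_lift_single [simp]: "free_lift g (Poly_Mapping.single k c) = c *\<^sub>C g k"
  by (cases "c = 0") (simp_all add: free_lift_def)

lemma free_lift_0 [simp]: "free_lift g 0 = 0"
  by (simp add: free_lift_def)

lemma free_lift_add: "free_lift g (f + f') = free_lift g f + free_lift g f'"
  unfolding free_lift_superset[of "Poly_Mapping.keys f \<union> Poly_Mapping.keys f'" f,simplified]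
    free_lift_superset[of "Poly_Mapping.keys f \<union> Poly_Mapping.keys f'" f',simplified]
    free_lift_superset[OF _ Poly_Mapping.keys_add, simplified]
  by (simp add: lookup_add scaleC_add_left sum.distrib)

lemma free_lift_map: "free_lift g (Poly_Mapping.map ((*) c) f) = c *\<^sub>C free_lift g f"
proof -
  have "Poly_Mapping.keys (Poly_Mapping.map ((*) c) f) \<subseteq> Poly_Mapping.keys f"
    by (auto simp: in_keys_iff lookup_map_mult)
  then show ?thesis
    by (subst free_lift_superset[of "Poly_Mapping.keys f"])
       (auto simp: free_lift_def lookup_map_mult scaleC_sum_right)
qed

lemma free_lift_diff: "free_lift g (f - f') = free_lift g f - free_lift g f'"
  using free_lift_add[of g "f - f'" f'] by simp

section \<open>Graded vector spaces and Koszul signs\<close>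

lemma parity_sign_if: "parity_sign p = (if even p then 1 else -1)"
  by (simp add: power_int_minus_left)

lemma gcomp_iff: "x \<in> gcomp p \<longleftrightarrow> gpart p x = x"
  unfolding gcomp_def by (metis (no_types, lifting) gpart_gpart rangeE rangeI)

lemma gpart_in_gcomp [simp]: "gpart p x \<in> gcomp p"
  by (simp add: gcomp_def)

lemma gpart_homogeneous: "x \<in> gcomp p \<Longrightarrow> gpart q x = (if q = p then x else 0)"
  by (metis gcomp_iff gpart_gpart)

lemma clinear_gpart [clinear_intros]: "clinear f \<Longrightarrow> clinear (\<lambda>x. gpart p (f x))"
  by (auto intro!: clinearI simp: clinear_simps gpart_add gpart_scaleC)

lemma clinear_gpart': "clinear (gpart p)"
  using clinear_gpart[OF clinear_id] .

lemma gcomp_add: "x \<in> gcomp p \<Longrightarrow> y \<in> gcomp p \<Longrightarrow> x + y \<in> gcomp p"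
  and gcomp_scale: "x \<in> gcomp p \<Longrightarrow> c *\<^sub>C x \<in> gcomp p"
  and gcomp_0: "0 \<in> gcomp p"
  by (simp_all add: gcomp_iff gpart_add gpart_scaleC)

lemma gcomp_diff: "x \<in> gcomp p \<Longrightarrow> y \<in> gcomp p \<Longrightarrow> x - y \<in> gcomp p"
  by (simp add: gcomp_iff clinear_diff[OF clinear_gpart'])

lemma graded_induct:
  fixes x :: "'a::graded_space"
  assumes "\<And>p x. x \<in> gcomp p \<Longrightarrow> P x" "\<And>x y. P x \<Longrightarrow> P y \<Longrightarrow> P (x + y)"
  shows "P x"
proof -
  have "P (\<Sum>p\<in>A. gpart p x)" if "finite A" for A
    using that by (induction A) (use assms(1)[OF gcomp_0] in \<open>auto intro: assms(1)[OF gpart_in_gcomp] assms(2)\<close>)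
  from this[OF finite_gpart[of x]] show ?thesis by (simp add: sum_gpart)
qed

lemma graded_eqI:
  fixes x :: "'a::graded_space"
  assumes "clinear f" "clinear g" "\<And>p x. x \<in> gcomp p \<Longrightarrow> f x = g x"
  shows "f x = g x"
  by (induction x rule: graded_induct) (use assms in \<open>auto simp: clinear_add\<close>)

text \<open>Linear extension of a family of linear maps, the \<open>p\<close>-th of which prescribes the values on the
  homogeneous elements of degree \<open>p\<close>. All Koszul signs are introduced in this way, so that
  identities need only be checked on homogeneous elements.\<close>

definition hext :: "(int \<Rightarrow> 'a::graded_space \<Rightarrow> 'b::complex_space) \<Rightarrow> 'a \<Rightarrow> 'b" where
  "hext h x = (\<Sum>p | gpart p x \<noteq> 0. h p (gpart p x))"

lemma hext_superset:
  assumes "\<And>p. clinear (h p)" "finite A" "{p. gpart p x \<noteq> 0} \<subseteq> A"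
  shows "hext h x = (\<Sum>p\<in>A. h p (gpart p x))"
  unfolding hext_def
  by (rule sum.mono_neutral_left) (use assms in \<open>auto simp: clinear_0\<close>)

lemma clinear_hext:
  assumes "\<And>p. clinear (h p)"
  shows "clinear (hext h)"
proof (rule clinearI)
  fix x y :: 'a
  let ?A = "{p. gpart p x \<noteq> 0} \<union> {p. gpart p y \<noteq> 0}"
  have *: "finite ?A" by (simp add: finite_gpart)
  have "hext h (x + y) = (\<Sum>p\<in>?A. h p (gpart p (x + y)))"
    by (rule hext_superset[OF assms *]) (auto simp: gpart_add)
  also have "\<dots> = (\<Sum>p\<in>?A. h p (gpart p x)) + (\<Sum>p\<in>?A. h p (gpart p y))"
    by (simp add: gpart_add clinear_add[OF assms] sum.distrib)
  also have "\<dots> = hext h x + hext h y"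
    by (subst (1 2) hext_superset[OF assms *]) auto
  finally show "hext h (x + y) = hext h x + hext h y" .
next
  fix c x
  have "hext h (c *\<^sub>C x) = (\<Sum>p | gpart p x \<noteq> 0. h p (gpart p (c *\<^sub>C x)))"
    by (rule hext_superset[OF assms finite_gpart]) (auto simp: gpart_scaleC)
  then show "hext h (c *\<^sub>C x) = c *\<^sub>C hext h x"
    by (simp add: hext_def gpart_scaleC clinear_scale[OF assms] scaleC_sum_right)
qed

lemma hext_homogeneous:
  assumes "\<And>p. clinear (h p)" "x \<in> gcomp p"
  shows "hext h x = h p x"
proof -
  have "hext h x = (\<Sum>p\<in>{p}. h p (gpart p x))"
    by (rule hext_superset[OF assms(1)]) (auto simp: gpart_homogeneous[OF assms(2)] split: if_splits)
  then show ?thesis by (simp add: gpart_homogeneous[OF assms(2)])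
qed

text \<open>\<open>twist k\<close> is the sign that arises from moving a symbol of degree \<open>k\<close> past the argument. As an
  operator on the whole space it allows Koszul signs in formulas for inhomogeneous arguments.\<close>

definition twist :: "int \<Rightarrow> 'a::graded_space \<Rightarrow> 'a" where
  "twist k = hext (\<lambda>p x. parity_sign (k * p) *\<^sub>C x)"

lemma clinear_twist': "clinear (twist k)"
  unfolding twist_def by (intro clinear_hext clinear_intros)

lemma clinear_twist [clinear_intros]: "clinear f \<Longrightarrow> clinear (\<lambda>x. twist k (f x))"
  using clinear_compose[OF clinear_twist'] .

lemma twist_homogeneous: "x \<in> gcomp p \<Longrightarrow> twist k x = parity_sign (k * p) *\<^sub>C x"
  unfolding twist_def by (subst hext_homogeneous) (auto intro!: clinear_intros)

lemmas twist_simps = clinear_simps[OF clinear_twist']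

lemma twist_twist: "twist k (twist l x) = twist (k + l) x"
  by (rule graded_eqI[where f = "\<lambda>x. twist k (twist l x)"])
     (auto intro!: clinear_intros simp: twist_homogeneous twist_simps ring_distribs parity_sign_if)

lemma twist_even: "even k \<Longrightarrow> twist k x = x"
  by (rule graded_eqI[where f = "\<lambda>x. twist k x"])
     (auto intro!: clinear_intros simp: twist_homogeneous parity_sign_if)

lemma twist_0 [simp]: "twist 0 x = x"
  by (simp add: twist_even)

lemma twist_self [simp]: "twist k (twist k x) = x"
  by (simp add: twist_twist twist_even)

lemma twist_in_gcomp: "x \<in> gcomp p \<Longrightarrow> twist k x \<in> gcomp p"
  by (simp add: twist_homogeneous gcomp_scale)

lemma degree_gpart:
  assumes f: "clinear f" "has_degree k f"
  shows "gpart p (f x) = f (gpart (p - k) x)"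
proof (rule graded_eqI[where f = "\<lambda>x. gpart p (f x)" and g = "\<lambda>x. f (gpart (p - k) x)"])
  show "gpart p (f x) = f (gpart (p - k) x)" if "x \<in> gcomp q" for q x
  proof -
    have "f x \<in> gcomp (q + k)" using f(2) that by (auto simp: has_degree_def)
    then show ?thesis using that by (auto simp: gpart_homogeneous clinear_0[OF f(1)])
  qed
qed (auto intro!: clinear_intros clinear_compose[OF f(1)] f(1))

lemma has_degreeI:
  assumes "\<And>p x. gpart (p + k) (f x) = f (gpart p x)"
  shows "has_degree k f"
  unfolding has_degree_def using assms by (auto simp: gcomp_iff)

lemma has_degreeD: "has_degree k f \<Longrightarrow> x \<in> gcomp p \<Longrightarrow> f x \<in> gcomp (p + k)"
  by (auto simp: has_degree_def)

lemma twist_map: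
  assumes f: "clinear f" "has_degree k f"
  shows "twist j (f x) = parity_sign (j * k) *\<^sub>C f (twist j x)"
proof (rule graded_eqI[where f = "\<lambda>x. twist j (f x)" and g = "\<lambda>x. parity_sign (j * k) *\<^sub>C f (twist j x)"])
  show "twist j (f x) = parity_sign (j * k) *\<^sub>C f (twist j x)" if "x \<in> gcomp q" for q x
    using has_degreeD[OF f(2) that] that
    by (simp add: twist_homogeneous clinear_scale[OF f(1)]) (auto simp: parity_sign_if)
qed (auto intro!: clinear_intros clinear_compose[OF f(1)] f(1))

lemma twist_map_0: "clinear f \<Longrightarrow> has_degree 0 f \<Longrightarrow> twist j (f x) = f (twist j x)"
  by (simp add: twist_map)

instantiation prod :: (graded_space, graded_space) graded_space
begin
definition "gpart p (x :: 'a \<times> 'b) = (gpart p (fst x), gpart p (snd x))"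
instance
proof
  fix x :: "'a \<times> 'b"
  have eq: "{p. gpart p x \<noteq> 0} = {p. gpart p (fst x) \<noteq> 0} \<union> {p. gpart p (snd x) \<noteq> 0}"
    by (auto simp: gpart_prod_def zero_prod_def)
  show fin: "finite {p. gpart p x \<noteq> 0}" by (simp add: eq finite_gpart)
  have "(\<Sum>p\<in>A. gpart p x) = (\<Sum>p\<in>A. gpart p (fst x), \<Sum>p\<in>A. gpart p (snd x))" for A
    by (simp add: gpart_prod_def prod_eq_iff fst_sum snd_sum)
  moreover have "(\<Sum>p | gpart p x \<noteq> 0. gpart p (fst x)) = fst x"
    by (rule sum_gpart_superset[OF fin]) (auto simp: eq)
  moreover have "(\<Sum>p | gpart p x \<noteq> 0. gpart p (snd x)) = snd x"
    by (rule sum_gpart_superset[OF fin]) (auto simp: eq)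
  ultimately show "(\<Sum>p | gpart p x \<noteq> 0. gpart p x) = x" by simp
qed (auto simp: gpart_prod_def gpart_add gpart_scaleC gpart_gpart zero_prod_def)
end

lemma fst_gpart: "fst (gpart p x) = gpart p (fst x)"
  and snd_gpart: "snd (gpart p x) = gpart p (snd x)"
  by (simp_all add: gpart_prod_def)

lemma fst_twist: "fst (twist k x) = twist k (fst x)"
  and snd_twist: "snd (twist k x) = twist k (snd x)"
  by (rule twist_map_0[symmetric], auto intro!: clinear_intros has_degreeI simp: fst_gpart snd_gpart)+

lemma twist_complex [simp]: "twist k (c :: complex) = c"
proof -
  have "c \<in> gcomp 0" by (simp add: gcomp_iff gpart_complex_def)
  then show ?thesis by (simp add: twist_homogeneous)
qed

section \<open>Universal properties of tensor products and symmetric coalgebras\<close>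

lemma map_mult_single: "Poly_Mapping.map ((*) c) (Poly_Mapping.single k v) = Poly_Mapping.single k (c * v :: complex)"
  by (rule poly_mapping_eqI) (auto simp: lookup_map_mult lookup_single when_def)

definition tensor_lift ::
    "('a::complex_space \<Rightarrow> 'b::complex_space \<Rightarrow> 'c::complex_space) \<Rightarrow> ('a, 'b) tensor \<Rightarrow> 'c" where
  "tensor_lift \<beta> T = free_lift (\<lambda>(x, y). \<beta> x y) (rep_tensor T)"

lemma free_lift_tensor_null:
  assumes "cbilinear \<beta>" "f \<in> tensor_null"
  shows "free_lift (\<lambda>(x, y). \<beta> x y) f = 0"
  using assms(2)
  by (induction rule: tensor_null.induct)
     (simp_all add: free_lift_add free_lift_diff cbilinear_simps[OF assms(1)] scaleC_add_right)

lemma tensor_lift_abs: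
  assumes "cbilinear \<beta>"
  shows "tensor_lift \<beta> (abs_tensor f) = free_lift (\<lambda>(x, y). \<beta> x y) f"
proof -
  have "abs_tensor (rep_tensor (abs_tensor f)) = abs_tensor f"
    by (rule Quotient3_abs_rep[OF Quotient3_tensor])
  then have "rep_tensor (abs_tensor f) - f \<in> tensor_null"
    by (simp add: tensor.abs_eq_iff)
  from free_lift_tensor_null[OF assms this] show ?thesis
    by (simp add: tensor_lift_def free_lift_diff)
qed

lemma clinear_tensor_lift:
  assumes "cbilinear \<beta>"
  shows "clinear (tensor_lift \<beta>)"
proof (rule clinearI)
  show "tensor_lift \<beta> (S + T) = tensor_lift \<beta> S + tensor_lift \<beta> T" for S T
    by (induction S rule: tensor.abs_induct, induction T rule: tensor.abs_induct)
       (simp add: plus_tensor.abs_eq tensor_lift_abs[OF assms] free_lift_add)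
  show "tensor_lift \<beta> (c *\<^sub>C T) = c *\<^sub>C tensor_lift \<beta> T" for c T
    by (induction T rule: tensor.abs_induct)
       (simp add: scaleC_tensor.abs_eq tensor_lift_abs[OF assms] free_lift_map)
qed

lemma tensor_lift_tens:
  assumes "cbilinear \<beta>"
  shows "tensor_lift \<beta> (x \<otimes> y) = \<beta> x y"
  by (simp add: tens.abs_eq tensor_lift_abs[OF assms])

lemma cbilinear_tens: "cbilinear (\<otimes>)"
proof (rule cbilinearI; rule clinearI)
  fix x x' :: 'a and y y' :: 'b and c :: complex
  show "x \<otimes> (y + y') = x \<otimes> y + x \<otimes> y'"
    by transfer (metis diff_diff_eq tensor_null.add_right)
  show "(x + x') \<otimes> y = x \<otimes> y + x' \<otimes> y"
    by transfer (metis diff_diff_eq tensor_null.add_left)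
  show "x \<otimes> (c *\<^sub>C y) = c *\<^sub>C (x \<otimes> y)"
    by transfer (use tensor_null.scale_right[of _ _ _ 1] in \<open>simp add: map_mult_single\<close>)
  show "(c *\<^sub>C x) \<otimes> y = c *\<^sub>C (x \<otimes> y)"
    by transfer (use tensor_null.scale_left[of _ _ _ 1] in \<open>simp add: map_mult_single\<close>)
qed

lemmas tens_simps = cbilinear_simps[OF cbilinear_tens]

lemma clinear_tens_left [clinear_intros]: "clinear f \<Longrightarrow> clinear (\<lambda>x. f x \<otimes> y)"
  and clinear_tens_right [clinear_intros]: "clinear g \<Longrightarrow> clinear (\<lambda>x. z \<otimes> g x)"
  using cbilinear_tens by (auto intro: clinear_bil_left clinear_bil_right)

lemma poly_mapping_induct [case_names single sum]:
  fixes f :: "'k \<Rightarrow>\<^sub>0 'b::monoid_add"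
  assumes single: "\<And>k v. P (Poly_Mapping.single k v)" and sum: "\<And>f g. P f \<Longrightarrow> P g \<Longrightarrow> P (f + g)"
  shows "P f"
proof (induction f rule: update_induct)
  case const
  show ?case using single[of undefined 0] by simp
next
  case (update f k v)
  have "Poly_Mapping.update k v f = f + Poly_Mapping.single k v"
    using update(1) by (intro poly_mapping_eqI)
      (auto simp: lookup_add lookup_update lookup_single when_def in_keys_iff)
  then show ?case using update single by (simp add: sum)
qed

lemma tensor_induct [case_names tens add]:
  assumes tens: "\<And>x y. P (x \<otimes> y)" and add: "\<And>s t. P s \<Longrightarrow> P t \<Longrightarrow> P (s + t)"
  shows "P t"
proof (induction t rule: tensor.abs_induct)
  fix f :: "'a \<times> 'b \<Rightarrow>\<^sub>0 complex"
  show "P (abs_tensor f)"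
  proof (induction f rule: poly_mapping_induct)
    case (single k v)
    obtain x y where k: "k = (x, y)" by fastforce
    have "abs_tensor (Poly_Mapping.single k v) = v *\<^sub>C (x \<otimes> y)"
      by (simp add: k tens.abs_eq scaleC_tensor.abs_eq map_mult_single)
    also have "\<dots> = (v *\<^sub>C x) \<otimes> y" by (simp add: tens_simps)
    finally show ?case by (simp add: tens)
  next
    case (sum f g)
    then show ?case by (simp add: plus_tensor.abs_eq[symmetric] add)
  qed
qed

lemma tensor_eqI:
  assumes "clinear f" "clinear g" "\<And>x y. f (x \<otimes> y) = g (x \<otimes> y)"
  shows "f t = g t"
  by (induction t rule: tensor_induct) (simp_all add: assms clinear_add[OF assms(1)] clinear_add[OF assms(2)])

lemma tensor_map_eq:
  assumes "clinear f" "clinear g"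
  shows "tensor_map f g = tensor_lift (\<lambda>x y. f x \<otimes> g y)"
proof -
  have b: "cbilinear (\<lambda>x y. f x \<otimes> g y)"
    by (intro cbilinearI clinear_tens_left clinear_tens_right assms)
  show ?thesis unfolding tensor_map_def
  proof (rule the_equality)
    show "clinear (tensor_lift (\<lambda>x y. f x \<otimes> g y)) \<and>
        (\<forall>x y. tensor_lift (\<lambda>x y. f x \<otimes> g y) (x \<otimes> y) = f x \<otimes> g y)"
      using b by (simp add: clinear_tensor_lift tensor_lift_tens)
    show "T = tensor_lift (\<lambda>x y. f x \<otimes> g y)" if "clinear T \<and> (\<forall>x y. T (x \<otimes> y) = f x \<otimes> g y)" for T
      by (rule ext, rule tensor_eqI) (use that b in \<open>auto simp: clinear_tensor_lift tensor_lift_tens\<close>)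
  qed
qed

lemma clinear_tensor_map:
  assumes "clinear f" "clinear g"
  shows "clinear (tensor_map f g)"
  unfolding tensor_map_eq[OF assms]
  by (intro clinear_tensor_lift cbilinearI clinear_tens_left clinear_tens_right assms)

lemma tensor_map_tens:
  assumes "clinear f" "clinear g"
  shows "tensor_map f g (x \<otimes> y) = f x \<otimes> g y"
  unfolding tensor_map_eq[OF assms]
  by (intro tensor_lift_tens cbilinearI clinear_tens_left clinear_tens_right assms)

lemma tensor_map_compose:
  assumes "clinear f" "clinear g" "clinear f'" "clinear g'"
  shows "tensor_map f g (tensor_map f' g' t) = tensor_map (\<lambda>x. f (f' x)) (\<lambda>y. g (g' y)) t"
  by (rule tensor_eqI[where f = "\<lambda>t. tensor_map f g (tensor_map f' g' t)"])
     (simp_all add: assms clinear_tensor_map clinear_compose tensor_map_tens)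

lemma tensor_map_id: "tensor_map (\<lambda>x. x) (\<lambda>y. y) t = t"
  by (rule tensor_eqI) (simp_all add: clinear_tensor_map tensor_map_tens clinear_id)

text \<open>The relations that define \<open>SV\<close>, as conditions on a function of lists.\<close>

definition graded_symmetric :: "('a::graded_space list \<Rightarrow> 'b::complex_space) \<Rightarrow> bool" where
  "graded_symmetric g \<longleftrightarrow> g [] = 0 \<and>
    (\<forall>us vs x y. g (us @ (x + y) # vs) = g (us @ x # vs) + g (us @ y # vs)) \<and>
    (\<forall>us vs c x. g (us @ (c *\<^sub>C x) # vs) = c *\<^sub>C g (us @ x # vs)) \<and>
    (\<forall>us vs p q. \<forall>x\<in>gcomp p. \<forall>y\<in>gcomp q.
      g (us @ x # y # vs) = parity_sign (p * q) *\<^sub>C g (us @ y # x # vs))"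

definition sym_lift :: "('a::graded_space list \<Rightarrow> 'b::complex_space) \<Rightarrow> 'a sym \<Rightarrow> 'b" where
  "sym_lift g y = free_lift g (rep_sym y)"

lemma
  assumes "graded_symmetric g"
  shows graded_symmetric_Nil: "g [] = 0"
    and graded_symmetric_add: "g (us @ (x + y) # vs) = g (us @ x # vs) + g (us @ y # vs)"
    and graded_symmetric_scale: "g (us @ (c *\<^sub>C x) # vs) = c *\<^sub>C g (us @ x # vs)"
    and graded_symmetric_swap: "x \<in> gcomp p \<Longrightarrow> y \<in> gcomp q \<Longrightarrow>
      g (us @ x # y # vs) = parity_sign (p * q) *\<^sub>C g (us @ y # x # vs)"
  using assms unfolding graded_symmetric_def by blast+

lemma free_lift_sym_null:
  assumes "graded_symmetric g" "f \<in> sym_null"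
  shows "free_lift g f = 0"
  using assms(2)
proof (induction rule: sym_null.induct)
  case (swap x p y q us vs c)
  from graded_symmetric_swap[OF assms(1) this, of us vs] show ?case by (simp add: free_lift_diff)
qed (simp_all add: graded_symmetric_Nil[OF assms(1)] graded_symmetric_add[OF assms(1)]
  graded_symmetric_scale[OF assms(1)] free_lift_add free_lift_diff scaleC_add_right)

lemma sym_lift_abs:
  assumes "graded_symmetric g"
  shows "sym_lift g (abs_sym f) = free_lift g f"
proof -
  have "abs_sym (rep_sym (abs_sym f)) = abs_sym f"
    by (rule Quotient3_abs_rep[OF Quotient3_sym])
  then have "rep_sym (abs_sym f) - f \<in> sym_null"
    by (simp add: sym.abs_eq_iff)
  from free_lift_sym_null[OF assms this] show ?thesis
    by (simp add: sym_lift_def free_lift_diff)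
qed

lemma clinear_sym_lift:
  assumes "graded_symmetric g"
  shows "clinear (sym_lift g)"
proof (rule clinearI)
  show "sym_lift g (S + T) = sym_lift g S + sym_lift g T" for S T
    by (induction S rule: sym.abs_induct, induction T rule: sym.abs_induct)
       (simp add: plus_sym.abs_eq sym_lift_abs[OF assms] free_lift_add)
  show "sym_lift g (c *\<^sub>C T) = c *\<^sub>C sym_lift g T" for c T
    by (induction T rule: sym.abs_induct)
       (simp add: scaleC_sym.abs_eq sym_lift_abs[OF assms] free_lift_map)
qed

lemma sym_lift_prod:
  assumes "graded_symmetric g"
  shows "sym_lift g (\<Odot> xs) = g xs"
  by (simp add: sym_prod.abs_eq sym_lift_abs[OF assms])

lemma sym_prod_Nil [simp]: "\<Odot> [] = 0"
  by transfer (simp add: sym_null.empty)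

lemma sym_prod_add: "\<Odot> (us @ (x + y) # vs) = \<Odot> (us @ x # vs) + \<Odot> (us @ y # vs)"
  by transfer (metis diff_diff_eq sym_null.add_entry)

lemma sym_prod_scale: "\<Odot> (us @ (c *\<^sub>C x) # vs) = c *\<^sub>C \<Odot> (us @ x # vs)"
  by transfer (use sym_null.scale_entry[of _ _ _ _ 1] in \<open>simp add: map_mult_single\<close>)

lemma sym_prod_swap:
  assumes "x \<in> gcomp p" "y \<in> gcomp q"
  shows "\<Odot> (us @ x # y # vs) = parity_sign (p * q) *\<^sub>C \<Odot> (us @ y # x # vs)"
  using sym_null.swap[OF assms, of us vs 1]
  by (simp add: sym_prod.abs_eq scaleC_sym.abs_eq sym.abs_eq_iff map_mult_single)

lemma graded_symmetricI:
  assumes "g [] = 0"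
    and "\<And>us vs x y. g (us @ (x + y) # vs) = g (us @ x # vs) + g (us @ y # vs)"
    and "\<And>us vs c x. g (us @ (c *\<^sub>C x) # vs) = c *\<^sub>C g (us @ x # vs)"
    and "\<And>us vs p q x y. x \<in> gcomp p \<Longrightarrow> y \<in> gcomp q \<Longrightarrow>
      g (us @ x # y # vs) = parity_sign (p * q) *\<^sub>C g (us @ y # x # vs)"
  shows "graded_symmetric g"
  using assms unfolding graded_symmetric_def by blast

text \<open>The relations between words preserve the length, so words may be rescaled by any function of
  their length.\<close>

lemma graded_symmetric_weight: "graded_symmetric (\<lambda>xs. c (length xs) *\<^sub>C \<Odot> xs)"
proof (rule graded_symmetricI)
  fix us vs :: "'a list" and p q and x y :: 'a assume "x \<in> gcomp p" "y \<in> gcomp q"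
  then show "c (length (us @ x # y # vs)) *\<^sub>C \<Odot> (us @ x # y # vs) =
      parity_sign (p * q) *\<^sub>C (c (length (us @ y # x # vs)) *\<^sub>C \<Odot> (us @ y # x # vs))"
    by (subst sym_prod_swap) (auto simp: mult.commute)
qed (simp_all add: sym_prod_add sym_prod_scale scaleC_add_right mult.commute)

lemma sym_induct [case_names prod add scale]:
  fixes y :: "'a::graded_space sym"
  assumes prod: "\<And>xs. P (\<Odot> xs)" and add: "\<And>s t. P s \<Longrightarrow> P t \<Longrightarrow> P (s + t)"
    and scale: "\<And>c s. P s \<Longrightarrow> P (c *\<^sub>C s)"
  shows "P y"
proof (induction y rule: sym.abs_induct)
  fix f :: "'a list \<Rightarrow>\<^sub>0 complex"
  have single: "P (abs_sym (Poly_Mapping.single k v))" for k v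
  proof -
    have "abs_sym (Poly_Mapping.single k v) = v *\<^sub>C \<Odot> k"
      by (simp add: sym_prod.abs_eq scaleC_sym.abs_eq map_mult_single)
    then show ?thesis by (simp add: prod scale)
  qed
  show "P (abs_sym f)"
    by (induction f rule: poly_mapping_induct)
       (simp_all add: single plus_sym.abs_eq[symmetric] add)
qed

section \<open>The unital symmetric algebra\<close>

text \<open>In \<open>\<complex> \<oplus> SV\<close> every word arises from \<open>1\<close> by multiplications \<open>x \<odot> _\<close> by vectors, which makes
  induction available without a separate base case for each letter; moreover multiplication by
  a vector is a coderivation there, but not on \<open>SV\<close>.\<close>

type_synonym 'a unital_sym = "complex \<times> 'a sym"

definition unit_sym :: "'a::graded_space unital_sym" ("\<one>") where
  "\<one> = (1, 0)"

definition sym_cons :: "'a::graded_space \<Rightarrow> 'a sym \<Rightarrow> 'a sym" where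
  "sym_cons x = sym_lift (\<lambda>xs. if xs = [] then 0 else \<Odot> (x # xs))"

definition adjoin :: "'a::graded_space \<Rightarrow> 'a unital_sym \<Rightarrow> 'a unital_sym" (infixr "\<odot>" 77) where
  "x \<odot> y = (0, fst y *\<^sub>C \<Odot> [x] + sym_cons x (snd y))"

lemma graded_symmetric_cons: "graded_symmetric (\<lambda>xs. if xs = [] then 0 else \<Odot> (x # xs))"
proof (rule graded_symmetricI)
  fix us vs :: "'a list" and p q and y z :: 'a assume "y \<in> gcomp p" "z \<in> gcomp q"
  from sym_prod_swap[OF this, of "x # us" vs]
  show "(if us @ y # z # vs = [] then 0 else \<Odot> (x # us @ y # z # vs)) =
      parity_sign (p * q) *\<^sub>C (if us @ z # y # vs = [] then 0 else \<Odot> (x # us @ z # y # vs))"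
    by simp
qed (use sym_prod_add[of "x # _"] sym_prod_scale[of "x # _"] in auto)

lemma sym_cons_prod: "xs \<noteq> [] \<Longrightarrow> sym_cons x (\<Odot> xs) = \<Odot> (x # xs)"
  unfolding sym_cons_def by (simp add: sym_lift_prod[OF graded_symmetric_cons])

lemma clinear_sym_cons: "clinear (sym_cons x)"
  unfolding sym_cons_def by (rule clinear_sym_lift[OF graded_symmetric_cons])

lemma clinear_sym_cons_left: "clinear (\<lambda>x. sym_cons x y)"
proof (induction y rule: sym_induct)
  case (prod xs)
  show ?case
    using sym_prod_add[of "[]" _ _ xs] sym_prod_scale[of "[]" _ _ xs]
    by (cases "xs = []") (auto intro!: clinearI simp: sym_cons_prod clinear_0[OF clinear_sym_cons])
qed (auto simp: clinear_simps[OF clinear_sym_cons] intro: clinear_intros)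

lemma clinear_sym_prod_1: "clinear (\<lambda>x. \<Odot> [x])"
  using sym_prod_add[of "[]" _ _ "[]"] sym_prod_scale[of "[]" _ _ "[]"] by (intro clinearI) simp_all

lemma cbilinear_adjoin: "cbilinear (\<odot>)"
  by (intro cbilinearI clinearI)
    (simp_all add: adjoin_def prod_eq_iff clinear_simps[OF clinear_sym_cons]
      clinear_simps[OF clinear_sym_cons_left] clinear_simps[OF clinear_sym_prod_1]
      scaleC_add_left scaleC_add_right scaleC_complex_def algebra_simps)

lemmas adjoin_simps = cbilinear_simps[OF cbilinear_adjoin]

lemma clinear_adjoin_left [clinear_intros]: "clinear f \<Longrightarrow> clinear (\<lambda>x. f x \<odot> y)"
  and clinear_adjoin_right [clinear_intros]: "clinear g \<Longrightarrow> clinear (\<lambda>x. v \<odot> g x)"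
  using cbilinear_adjoin by (auto intro: clinear_bil_left clinear_bil_right)

lemma fst_adjoin [simp]: "fst (x \<odot> y) = 0"
  by (simp add: adjoin_def)

lemma fst_unit_sym [simp]: "fst \<one> = 1" and snd_unit_sym [simp]: "snd \<one> = 0"
  by (simp_all add: unit_sym_def)

definition adjoin_list :: "'a::graded_space list \<Rightarrow> 'a unital_sym" where
  "adjoin_list xs = foldr (\<odot>) xs \<one>"

lemma adjoin_list_simps [simp]: "adjoin_list [] = \<one>" "adjoin_list (x # xs) = x \<odot> adjoin_list xs"
  by (simp_all add: adjoin_list_def)

lemma adjoin_list_eq: "adjoin_list xs = (if xs = [] then 1 else 0, \<Odot> xs)"
proof (induction xs)
  case (Cons x xs)
  then show ?case
    by (cases "xs = []") (simp_all add: adjoin_def sym_cons_prod clinear_0[OF clinear_sym_cons] unit_sym_def)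
qed (simp add: unit_sym_def)

lemma unital_sym_decompose: "y = fst y *\<^sub>C \<one> + (0, snd y)"
  by (simp add: unit_sym_def prod_eq_iff scaleC_complex_def)

lemma unital_sym_induct_list:
  assumes "\<And>xs. P (adjoin_list xs)" "\<And>y z. P y \<Longrightarrow> P z \<Longrightarrow> P (y + z)" "\<And>c y. P y \<Longrightarrow> P (c *\<^sub>C y)"
  shows "P y"
proof -
  have 0: "P (0, 0)" using assms(3)[OF assms(1)[of "[]"], of 0] by (simp add: zero_prod_def)
  have "P (0, z)" for z
  proof (induction z rule: sym_induct)
    case (prod xs)
    show ?case using assms(1)[of xs] 0 by (cases "xs = []") (simp_all add: adjoin_list_eq)
  next
    case (add s t)
    then show ?case using assms(2)[of "(0, s)" "(0, t)"] by simp
  next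
    case (scale c s)
    then show ?case using assms(3)[of "(0, s)" c] by (simp add: scaleC_complex_def)
  qed
  then show ?thesis
    by (subst unital_sym_decompose) (use assms(1)[of "[]"] in \<open>auto intro: assms(2,3)\<close>)
qed

lemma adjoin_list_homogeneous_induct:
  assumes unit: "P \<one>" and adjoin: "\<And>p x y. x \<in> gcomp p \<Longrightarrow> P y \<Longrightarrow> P (x \<odot> y)"
    and add: "\<And>y z. P y \<Longrightarrow> P z \<Longrightarrow> P (y + z)"
  shows "P (adjoin_list xs)"
proof (induction xs)
  case (Cons x xs)
  have "P (x \<odot> y)" if "P y" for x y
    by (induction x rule: graded_induct) (use that in \<open>auto intro: adjoin add simp: adjoin_simps\<close>)
  then show ?case using Cons by simp
qed (simp add: unit)

text \<open>The vectors that are multiplied may be taken homogeneous, so that all signs are explicit in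
  the induction step.\<close>

lemma unital_sym_induct [case_names unit adjoin add scale]:
  assumes "P \<one>" "\<And>p x y. x \<in> gcomp p \<Longrightarrow> P y \<Longrightarrow> P (x \<odot> y)"
    "\<And>y z. P y \<Longrightarrow> P z \<Longrightarrow> P (y + z)" "\<And>c y. P y \<Longrightarrow> P (c *\<^sub>C y)"
  shows "P y"
  by (rule unital_sym_induct_list) (use adjoin_list_homogeneous_induct[of P] assms in blast)+

lemma unital_sym_eqI:
  assumes "clinear f" "clinear g" "f \<one> = g \<one>"
    and "\<And>p x y. x \<in> gcomp p \<Longrightarrow> f y = g y \<Longrightarrow> f (x \<odot> y) = g (x \<odot> y)"
  shows "f y = g y"
  by (induction y rule: unital_sym_induct)
     (use assms in \<open>auto simp: clinear_add[OF assms(1)] clinear_add[OF assms(2)]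
       clinear_scale[OF assms(1)] clinear_scale[OF assms(2)]\<close>)

text \<open>The relation \<open>x \<odot> y = \<plusminus> y \<odot> x\<close>, for an action of vectors on an arbitrary space.\<close>

definition gcommuting :: "('a::graded_space \<Rightarrow> 'm::complex_space \<Rightarrow> 'm) \<Rightarrow> bool" where
  "gcommuting L \<longleftrightarrow> cbilinear L \<and>
    (\<forall>p q. \<forall>x\<in>gcomp p. \<forall>y\<in>gcomp q. \<forall>z. L x (L y z) = parity_sign (p * q) *\<^sub>C L y (L x z))"

lemma gcommutingI:
  assumes "cbilinear L"
    "\<And>p q x y z. x \<in> gcomp p \<Longrightarrow> y \<in> gcomp q \<Longrightarrow> L x (L y z) = parity_sign (p * q) *\<^sub>C L y (L x z)"
  shows "gcommuting L"
  unfolding gcommuting_def using assms by blast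

lemma gcommutingD:
  assumes "gcommuting L" "x \<in> gcomp p" "y \<in> gcomp q"
  shows "L x (L y z) = parity_sign (p * q) *\<^sub>C L y (L x z)"
  using assms unfolding gcommuting_def by blast

text \<open>The universal property of \<open>\<complex> \<oplus> SV\<close>: an action of vectors by operators that commute up to the
  Koszul sign extends uniquely to the algebra; applying it to \<open>z\<close> gives the linear map below.\<close>

definition ulift :: "('a::graded_space \<Rightarrow> 'm::complex_space \<Rightarrow> 'm) \<Rightarrow> 'm \<Rightarrow> 'a unital_sym \<Rightarrow> 'm" where
  "ulift L z y = fst y *\<^sub>C z + sym_lift (\<lambda>xs. if xs = [] then 0 else foldr L xs z) (snd y)"

context
  fixes L :: "'a::graded_space \<Rightarrow> 'm::complex_space \<Rightarrow> 'm"
  assumes L: "gcommuting L"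
begin

lemma cbil_L: "cbilinear L"
  using L by (simp add: gcommuting_def)

lemma foldr_add: "foldr L us (y + z) = foldr L us y + foldr L us z"
  by (induction us) (simp_all add: cbilinear_simps[OF cbil_L])

lemma foldr_scale: "foldr L us (c *\<^sub>C y) = c *\<^sub>C foldr L us y"
  by (induction us) (simp_all add: cbilinear_simps[OF cbil_L])

lemma graded_symmetric_foldr: "graded_symmetric (\<lambda>xs. if xs = [] then 0 else foldr L xs z)"
proof (rule graded_symmetricI)
  fix us vs :: "'a list" and p q and x y :: 'a assume "x \<in> gcomp p" "y \<in> gcomp q"
  from gcommutingD[OF L this, of "foldr L vs z"]
  show "(if us @ x # y # vs = [] then 0 else foldr L (us @ x # y # vs) z) =
       parity_sign (p * q) *\<^sub>C (if us @ y # x # vs = [] then 0 else foldr L (us @ y # x # vs) z)"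
    by (simp add: foldr_scale)
qed (simp_all add: cbilinear_simps[OF cbil_L] foldr_add foldr_scale)

lemma clinear_ulift: "clinear (ulift L z)"
  by (rule clinearI)
    (simp_all add: ulift_def clinear_simps[OF clinear_sym_lift[OF graded_symmetric_foldr]]
      scaleC_add_left scaleC_add_right scaleC_complex_def algebra_simps)

lemma ulift_unit: "ulift L z \<one> = z"
  by (simp add: ulift_def clinear_simps[OF clinear_sym_lift[OF graded_symmetric_foldr]])

lemma ulift_adjoin_list: "ulift L z (adjoin_list xs) = foldr L xs z"
  by (cases "xs = []")
     (simp_all add: ulift_unit ulift_def adjoin_list_eq sym_lift_prod[OF graded_symmetric_foldr]
       clinear_0[OF clinear_sym_lift[OF graded_symmetric_foldr]] del: adjoin_list_simps(2))

lemma ulift_adjoin: "ulift L z (x \<odot> y) = L x (ulift L z y)"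
proof (induction y rule: unital_sym_induct_list)
  case (1 xs)
  show ?case using ulift_adjoin_list[of z "x # xs"] by (simp add: ulift_adjoin_list)
qed (simp_all add: adjoin_simps clinear_simps[OF clinear_ulift] cbilinear_simps[OF cbil_L])

end

lemma gcommuting_adjoin: "gcommuting (\<odot>)"
proof (rule gcommutingI[OF cbilinear_adjoin])
  fix p q and x y :: 'a and z :: "'a unital_sym"
  assume "x \<in> gcomp p" "y \<in> gcomp q"
  then show "x \<odot> y \<odot> z = parity_sign (p * q) *\<^sub>C (y \<odot> x \<odot> z)"
  proof (induction z rule: unital_sym_induct_list)
    case (1 xs)
    then have "adjoin_list (x # y # xs) = parity_sign (p * q) *\<^sub>C adjoin_list (y # x # xs)"
      unfolding adjoin_list_eq using sym_prod_swap[of x p y q "[]" xs] by (simp add: scaleC_complex_def)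
    then show ?case by simp
  qed (simp_all add: adjoin_simps scaleC_add_right mult.commute)
qed

lemmas adjoin_commute = gcommutingD[OF gcommuting_adjoin]

section \<open>The grading of the symmetric coalgebra\<close>

lemma cbilinear_hext:
  assumes "\<And>p. cbilinear (\<beta> p)"
  shows "cbilinear (\<lambda>x z. hext (\<lambda>p x. \<beta> p x z) x)"
proof (rule cbilinearI)
  show "clinear (\<lambda>x. hext (\<lambda>p x. \<beta> p x z) x)" for z
    using clinear_hext[of "\<lambda>p x. \<beta> p x z"] cbilinear_left[OF assms] by simp
  show "clinear (\<lambda>z. hext (\<lambda>p x. \<beta> p x z) x)" for x
    unfolding hext_def by (intro clinear_sum_fun cbilinear_right[OF assms])
qed

lemma clinear_funI:
  assumes "\<And>i. clinear (\<lambda>x. f x i)"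
  shows "clinear f"
  by (rule clinearI) (simp_all add: fun_eq_iff scaleC_fun_def clinear_add[OF assms] clinear_scale[OF assms])

lemma clinear_apply [clinear_intros]: "clinear (\<lambda>h. h i)"
  by (rule clinearI) (auto simp: scaleC_fun_def)

text \<open>An element of \<open>\<complex> \<oplus> SV\<close> is represented by the family of its homogeneous parts; multiplication
  by \<open>x\<close> of degree \<open>q\<close> shifts the family by \<open>q\<close>. The universal property then yields all parts
  at once.\<close>

definition weight_action ::
    "'a::graded_space \<Rightarrow> (int \<Rightarrow> 'a unital_sym) \<Rightarrow> int \<Rightarrow> 'a unital_sym" where
  "weight_action x h r = hext (\<lambda>q x. x \<odot> h (r - q)) x"

definition upart :: "int \<Rightarrow> 'a::graded_space unital_sym \<Rightarrow> 'a unital_sym" where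
  "upart r y = ulift weight_action (\<lambda>r. if r = 0 then \<one> else 0) y r"

lemma weight_action_homogeneous: "x \<in> gcomp p \<Longrightarrow> weight_action x h r = x \<odot> h (r - p)"
  unfolding weight_action_def by (rule hext_homogeneous) (auto intro: clinear_intros)

lemma cbilinear_weight_action: "cbilinear weight_action"
proof -
  have *: "cbilinear (\<lambda>x h. hext (\<lambda>q x. x \<odot> h (r - q)) x)" for r :: int
    by (intro cbilinear_hext cbilinearI clinear_intros)
  show ?thesis
    by (intro cbilinearI clinear_funI)
       (simp_all add: weight_action_def cbilinear_left[OF *] cbilinear_right[OF *])
qed

lemma gcommuting_weight_action: "gcommuting weight_action"
  by (rule gcommutingI[OF cbilinear_weight_action])
     (auto simp: fun_eq_iff weight_action_homogeneous scaleC_fun_def algebra_simps intro: adjoin_commute)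

lemma clinear_upart: "clinear (upart r)"
  unfolding upart_def
  by (rule clinear_compose[OF clinear_apply clinear_ulift[OF gcommuting_weight_action]])

lemmas upart_simps = clinear_simps[OF clinear_upart]

lemma upart_unit: "upart r \<one> = (if r = 0 then \<one> else 0)"
  by (simp add: upart_def ulift_unit[OF gcommuting_weight_action])

lemma upart_adjoin: "x \<in> gcomp p \<Longrightarrow> upart r (x \<odot> y) = x \<odot> upart (r - p) y"
  by (simp add: upart_def ulift_adjoin[OF gcommuting_weight_action] weight_action_homogeneous)

lemma upart_upart: "upart r (upart s y) = (if r = s then upart s y else 0)"
proof (induction y arbitrary: r s rule: unital_sym_induct)
  case (adjoin p x y)
  then show ?case by (auto simp: upart_adjoin adjoin_simps)
qed (auto simp: upart_simps upart_unit)

lemma upart_decompose: "\<exists>A. finite A \<and> (\<forall>r. r \<notin> A \<longrightarrow> upart r y = 0) \<and> (\<Sum>r\<in>A. upart r y) = y"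
proof (induction y rule: unital_sym_induct)
  case unit
  show ?case by (rule exI[of _ "{0}"]) (auto simp: upart_unit)
next
  case (adjoin p x y)
  then obtain A where A: "finite A" "\<And>r. r \<notin> A \<Longrightarrow> upart r y = 0" "(\<Sum>r\<in>A. upart r y) = y"
    by blast
  have "upart r (x \<odot> y) = 0" if "r \<notin> (\<lambda>s. s + p) ` A" for r
  proof -
    have "r - p \<notin> A" using that image_eqI[of r "\<lambda>s. s + p" "r - p" A] by auto
    from A(2)[OF this] show ?thesis by (simp add: upart_adjoin[OF adjoin(1)] adjoin_simps)
  qed
  moreover have "(\<Sum>r\<in>(\<lambda>s. s + p) ` A. upart r (x \<odot> y)) = x \<odot> (\<Sum>r\<in>A. upart r y)"
    by (subst sum.reindex) (auto simp: inj_on_def upart_adjoin[OF adjoin(1)] adjoin_simps)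
  ultimately show ?case using A by (intro exI[of _ "(\<lambda>s. s + p) ` A"]) auto
next
  case (add y z)
  then obtain A B where A: "finite A" "\<And>r. r \<notin> A \<Longrightarrow> upart r y = 0" "(\<Sum>r\<in>A. upart r y) = y"
    and B: "finite B" "\<And>r. r \<notin> B \<Longrightarrow> upart r z = 0" "(\<Sum>r\<in>B. upart r z) = z"
    by blast
  have "(\<Sum>r\<in>A \<union> B. upart r y) = (\<Sum>r\<in>A. upart r y)" "(\<Sum>r\<in>A \<union> B. upart r z) = (\<Sum>r\<in>B. upart r z)"
    by (rule sum.mono_neutral_right; use A B in auto)+
  then show ?case using A B by (intro exI[of _ "A \<union> B"]) (auto simp: upart_simps sum.distrib)
next
  case (scale c y)
  then obtain A where A: "finite A" "\<And>r. r \<notin> A \<Longrightarrow> upart r y = 0" "(\<Sum>r\<in>A. upart r y) = y"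
    by blast
  then show ?case by (intro exI[of _ A]) (auto simp: upart_simps scaleC_sum_right[symmetric])
qed

lemma fst_upart: "fst (upart r y) = gpart r (fst y)"
proof (induction y rule: unital_sym_induct)
  case (adjoin p x y)
  then show ?case by (simp add: upart_adjoin)
qed (auto simp: upart_unit upart_simps gpart_complex_def scaleC_complex_def)

instantiation sym :: (graded_space) graded_space
begin
definition gpart_sym :: "int \<Rightarrow> 'a sym \<Rightarrow> 'a sym" where "gpart_sym r y = snd (upart r (0, y))"

lemma upart_eq: "upart r (0, y) = (0, gpart r y)"
  by (simp add: gpart_sym_def prod_eq_iff fst_upart)

instance
proof
  fix x y :: "'a sym" and p q c
  show "gpart p (x + y) = gpart p x + gpart p y"
    using upart_simps(1)[of p "(0, x)" "(0, y)"] by (simp add: upart_eq)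
  show "gpart p (c *\<^sub>C x) = c *\<^sub>C gpart p x"
    using upart_simps(2)[of p c "(0, x)"] by (simp add: upart_eq)
  show "gpart p (gpart q x) = (if p = q then gpart q x else 0)"
    using upart_upart[of p q "(0, x)"] by (simp add: upart_eq zero_prod_def split: if_splits)
  obtain A where A: "finite A" "\<And>r. r \<notin> A \<Longrightarrow> upart r (0, x) = 0" "(\<Sum>r\<in>A. upart r (0, x)) = (0, x)"
    using upart_decompose[of "(0, x)"] by blast
  have sub: "{p. gpart p x \<noteq> 0} \<subseteq> A"
    using A(2) by (force simp: upart_eq zero_prod_def)
  then show "finite {p. gpart p x \<noteq> 0}" using A(1) finite_subset by blast
  have "(\<Sum>p | gpart p x \<noteq> 0. gpart p x) = (\<Sum>p\<in>A. gpart p x)"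
    by (rule sum.mono_neutral_left) (use sub A(1) in auto)
  also have "\<dots> = snd (\<Sum>r\<in>A. upart r (0, x))" by (simp add: snd_sum upart_eq)
  finally show "(\<Sum>p | gpart p x \<noteq> 0. gpart p x) = x" by (simp add: A(3))
qed
end

lemma gpart_unital_sym: "gpart r y = upart r (y :: 'a::graded_space unital_sym)"
proof -
  have "upart r y = fst y *\<^sub>C upart r \<one> + upart r (0, snd y)"
    by (subst unital_sym_decompose) (simp only: upart_simps)
  then show ?thesis
    by (auto simp: upart_unit upart_eq prod_eq_iff gpart_prod_def gpart_complex_def scaleC_complex_def)
qed

lemma gpart_adjoin: "x \<in> gcomp p \<Longrightarrow> gpart r (x \<odot> y) = x \<odot> gpart (r - p) y"
  by (simp add: gpart_unital_sym upart_adjoin)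

lemma has_degree_adjoin: "x \<in> gcomp p \<Longrightarrow> has_degree p ((\<odot>) x)"
  by (rule has_degreeI) (simp add: gpart_adjoin)

lemma twist_adjoin: "x \<in> gcomp p \<Longrightarrow> twist k (x \<odot> y) = parity_sign (k * p) *\<^sub>C (x \<odot> twist k y)"
  using twist_map[OF cbilinear_right[OF cbilinear_adjoin] has_degree_adjoin] .

lemma unit_sym_gcomp: "\<one> \<in> gcomp 0"
  by (simp add: gcomp_iff gpart_unital_sym upart_unit)

lemma twist_unit_sym [simp]: "twist k \<one> = \<one>"
  by (simp add: twist_homogeneous[OF unit_sym_gcomp])

lemma homogeneous_Cons: "homogeneous ps (x # xs) \<longleftrightarrow> (\<exists>p qs. ps = p # qs \<and> x \<in> gcomp p \<and> homogeneous qs xs)"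
  by (auto simp: homogeneous_def list_all2_Cons2)

lemma homogeneous_Nil [simp]: "homogeneous ps [] \<longleftrightarrow> ps = []"
  by (simp add: homogeneous_def)

lemma homogeneous_length: "homogeneous ps xs \<Longrightarrow> length ps = length xs"
  by (simp add: homogeneous_def list_all2_lengthD)

lemma adjoin_list_gcomp: "homogeneous ps xs \<Longrightarrow> adjoin_list xs \<in> gcomp (sum_list ps)"
proof (induction xs arbitrary: ps)
  case Nil
  then show ?case by (simp add: unit_sym_gcomp)
next
  case (Cons x xs)
  then obtain p qs where *: "ps = p # qs" "x \<in> gcomp p" "homogeneous qs xs"
    by (auto simp: homogeneous_Cons)
  then show ?case
    using has_degreeD[OF has_degree_adjoin[OF *(2)] Cons.IH[OF *(3)]] by (simp add: add.commute)
qed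

lemma sym_prod_gcomp: "homogeneous ps xs \<Longrightarrow> \<Odot> xs \<in> gcomp (sum_list ps)"
  using adjoin_list_gcomp[of ps xs] by (auto simp: adjoin_list_eq gcomp_iff gpart_prod_def)

text \<open>Words are multilinear, so the letters may be restricted to any additive set of generators.
  This is used for homogeneous vectors and for forms \<open>v \<otimes> \<omega>\<close>.\<close>

lemma sym_prod_generators_induct:
  assumes generate: "\<And>Q x. (\<And>x. G x \<Longrightarrow> Q x) \<Longrightarrow> (\<And>x y. Q x \<Longrightarrow> Q y \<Longrightarrow> Q (x + y)) \<Longrightarrow> Q x"
    and prod: "\<And>ys. list_all G ys \<Longrightarrow> length ys = length xs \<Longrightarrow> P (\<Odot> ys)"
    and add: "\<And>s t. P s \<Longrightarrow> P t \<Longrightarrow> P (s + t)"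
  shows "P (\<Odot> xs)"
proof -
  have "P (\<Odot> (us @ vs))" if "list_all G us" "length (us @ vs) = length xs" for us vs
    using that
  proof (induction vs arbitrary: us)
    case Nil
    then show ?case using prod by simp
  next
    case (Cons v vs)
    show ?case
    proof (rule generate[of "\<lambda>v. P (\<Odot> (us @ v # vs))" v])
      show "P (\<Odot> (us @ x # vs))" if "G x" for x
        using Cons.IH[of "us @ [x]"] Cons.prems that by simp
    qed (simp add: sym_prod_add add)
  qed
  from this[of "[]" xs] show ?thesis by simp
qed

lemma sym_prod_homogeneous_induct:
  assumes homogeneous: "\<And>ps ys. homogeneous ps ys \<Longrightarrow> length ys = length xs \<Longrightarrow> P (\<Odot> ys)"
    and add: "\<And>s t. P s \<Longrightarrow> P t \<Longrightarrow> P (s + t)"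
  shows "P (\<Odot> xs)"
proof (rule sym_prod_generators_induct[of "\<lambda>x. \<exists>p. x \<in> gcomp p"])
  show "Q x" if "\<And>x. \<exists>p. x \<in> gcomp p \<Longrightarrow> Q x" "\<And>x y. Q x \<Longrightarrow> Q y \<Longrightarrow> Q (x + y)" for Q and x :: 'a
    by (rule graded_induct) (use that in blast)+
  show "P (\<Odot> ys)" if ys: "list_all (\<lambda>x. \<exists>p. x \<in> gcomp p) ys" "length ys = length xs" for ys
  proof -
    have "\<exists>ps. homogeneous ps ys"
      using ys(1) by (induction ys) (auto simp: homogeneous_Cons)
    then show ?thesis using homogeneous ys(2) by blast
  qed
qed (rule add)

lemma sym_homogeneous_induct [case_names prod add scale]:
  assumes "\<And>ps xs. homogeneous ps xs \<Longrightarrow> P (\<Odot> xs)" "\<And>s t. P s \<Longrightarrow> P t \<Longrightarrow> P (s + t)"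
    "\<And>c s. P s \<Longrightarrow> P (c *\<^sub>C s)"
  shows "P y"
  by (induction y rule: sym_induct) (use assms in \<open>auto intro: sym_prod_homogeneous_induct[of _ P]\<close>)

lemma sym_comp_eq_gcomp: "sym_comp p = (gcomp p :: 'a::graded_space sym set)"
proof
  show "sym_comp p \<subseteq> (gcomp p :: 'a sym set)"
  proof
    fix y :: "'a sym" assume "y \<in> sym_comp p"
    then show "y \<in> gcomp p" unfolding sym_comp_def
      by (induction rule: complex_space.span_induct_alt)
         (auto intro: gcomp_0 gcomp_add gcomp_scale sym_prod_gcomp)
  qed
  have "gpart p y \<in> sym_comp p" for y :: "'a sym"
  proof (induction y rule: sym_homogeneous_induct)
    case (prod ps xs)
    then show ?case unfolding sym_comp_def
      by (auto simp: gpart_homogeneous[OF sym_prod_gcomp] complex_space.span_zero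
        intro!: complex_space.span_base)
  qed (auto simp: sym_comp_def gpart_add gpart_scaleC intro: complex_space.span_add complex_space.span_scale)
  then show "gcomp p \<subseteq> (sym_comp p :: 'a sym set)" by (auto simp: gcomp_def)
qed

lemma sym_has_degree_iff: "sym_has_degree k F \<longleftrightarrow> has_degree k F"
  by (simp add: sym_has_degree_def has_degree_def sym_comp_eq_gcomp)

section \<open>The coproduct\<close>

text \<open>On \<open>\<complex> \<oplus> SV\<close> the coproduct is the algebra map with \<open>x \<mapsto> x \<otimes> 1 + 1 \<otimes> x\<close>. By the universal
  property it suffices to know how the element \<open>x \<otimes> 1 + 1 \<otimes> x\<close> acts on tensors.\<close>

lemma cbilinear_tensor_lift:
  assumes "\<And>x. cbilinear (\<beta> x)" "\<And>a b. clinear (\<lambda>x. \<beta> x a b)"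
  shows "cbilinear (\<lambda>x. tensor_lift (\<beta> x))"
proof (rule cbilinearI)
  show "clinear (tensor_lift (\<beta> x))" for x by (rule clinear_tensor_lift[OF assms(1)])
  show "clinear (\<lambda>x. tensor_lift (\<beta> x) t)" for t
    by (induction t rule: tensor_induct)
       (auto simp: tensor_lift_tens[OF assms(1)] clinear_add[OF clinear_tensor_lift[OF assms(1)]]
         intro: assms(2) clinear_plus)
qed

definition primitive_action :: "'a::graded_space \<Rightarrow> ('a unital_sym, 'a unital_sym) tensor
    \<Rightarrow> ('a unital_sym, 'a unital_sym) tensor" where
  "primitive_action x t = tensor_lift (\<lambda>a b. (x \<odot> a) \<otimes> b) t
    + hext (\<lambda>p x. tensor_lift (\<lambda>a b. twist p a \<otimes> (x \<odot> b)) t) x"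

lemma cbilinear_primitive_action: "cbilinear primitive_action"
proof -
  have 1: "cbilinear (\<lambda>x t. tensor_lift (\<lambda>a b. (x \<odot> a) \<otimes> b) t)"
    by (intro cbilinear_tensor_lift cbilinearI clinear_intros)
  have 2: "cbilinear (\<lambda>x t. hext (\<lambda>p x. tensor_lift (\<lambda>a b. twist p a \<otimes> (x \<odot> b)) t) x)"
    by (intro cbilinear_hext cbilinear_tensor_lift cbilinearI clinear_intros)
  show ?thesis unfolding primitive_action_def
    by (intro cbilinearI clinear_plus cbilinear_left[OF 1] cbilinear_left[OF 2]
        cbilinear_right[OF 1] cbilinear_right[OF 2])
qed

lemma primitive_action_tens:
  assumes "x \<in> gcomp p"
  shows "primitive_action x (a \<otimes> b) = (x \<odot> a) \<otimes> b + twist p a \<otimes> (x \<odot> b)"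
proof -
  have 1: "cbilinear (\<lambda>a b. twist p a \<otimes> (x \<odot> b))" for p and x :: 'a
    by (intro cbilinearI clinear_intros)
  have 2: "cbilinear (\<lambda>x. tensor_lift (\<lambda>a b. twist p a \<otimes> (x \<odot> b)))" for p
    by (intro cbilinear_tensor_lift cbilinearI clinear_intros)
  have 3: "cbilinear (\<lambda>a b. (x \<odot> a) \<otimes> b)" by (intro cbilinearI clinear_intros)
  show ?thesis unfolding primitive_action_def
    by (subst hext_homogeneous[OF cbilinear_left[OF 2] assms])
       (simp add: tensor_lift_tens[OF 1] tensor_lift_tens[OF 3])
qed

lemma gcommuting_primitive_action: "gcommuting primitive_action"
proof (rule gcommutingI[OF cbilinear_primitive_action])
  fix p q and x y :: 'a and t
  assume x: "x \<in> gcomp p" and y: "y \<in> gcomp q"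
  note L = cbilinear_right[OF cbilinear_primitive_action]
  show "primitive_action x (primitive_action y t) = parity_sign (p * q) *\<^sub>C primitive_action y (primitive_action x t)"
  proof (rule tensor_eqI[where t = t])
    fix a b
    have "primitive_action x (primitive_action y (a \<otimes> b)) =
        (x \<odot> y \<odot> a) \<otimes> b + twist p (y \<odot> a) \<otimes> (x \<odot> b)
        + (x \<odot> twist q a) \<otimes> (y \<odot> b) + twist p (twist q a) \<otimes> (x \<odot> y \<odot> b)"
      by (simp add: primitive_action_tens[OF x] primitive_action_tens[OF y] clinear_add[OF L])
    moreover have "primitive_action y (primitive_action x (a \<otimes> b)) =
        (y \<odot> x \<odot> a) \<otimes> b + twist q (x \<odot> a) \<otimes> (y \<odot> b)
        + (y \<odot> twist p a) \<otimes> (x \<odot> b) + twist q (twist p a) \<otimes> (y \<odot> x \<odot> b)"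
      by (simp add: primitive_action_tens[OF x] primitive_action_tens[OF y] clinear_add[OF L])
    ultimately show "primitive_action x (primitive_action y (a \<otimes> b)) =
        parity_sign (p * q) *\<^sub>C primitive_action y (primitive_action x (a \<otimes> b))"
      using adjoin_commute[OF x y, of a] adjoin_commute[OF x y, of b]
      by (simp add: twist_adjoin[OF x] twist_adjoin[OF y] twist_twist tens_simps scaleC_add_right
          mult.commute add.commute)
  qed (auto intro: clinear_compose[OF L L] clinear_scaleC)
qed

definition ucoprod :: "'a::graded_space unital_sym \<Rightarrow> ('a unital_sym, 'a unital_sym) tensor" where
  "ucoprod = ulift primitive_action (\<one> \<otimes> \<one>)"

lemma clinear_ucoprod: "clinear ucoprod"
  and ucoprod_unit: "ucoprod \<one> = \<one> \<otimes> \<one>"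
  and ucoprod_adjoin: "ucoprod (x \<odot> y) = primitive_action x (ucoprod y)"
  unfolding ucoprod_def
  by (simp_all add: clinear_ulift ulift_unit ulift_adjoin gcommuting_primitive_action)

lemma prod_pairs_Suc:
  fixes h :: "nat \<Rightarrow> nat \<Rightarrow> 'a::comm_monoid_mult"
  shows "(\<Prod>(i, j) | i < j \<and> j < Suc n. h i j) =
    (\<Prod>j<n. h 0 (Suc j)) * (\<Prod>(i, j) | i < j \<and> j < n. h (Suc i) (Suc j))"
proof -
  let ?f = "\<lambda>(i, j). (Suc i, Suc j)" and ?R = "{(i, j). i < j \<and> j < n}" and ?g = "\<lambda>j. (0 :: nat, Suc j)"
  have "{(i, j). i < j \<and> j < Suc n} = ?g ` {..<n} \<union> ?f ` ?R" (is "?L = _")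
  proof (intro equalityI subsetI)
    fix z assume z: "z \<in> ?L"
    then obtain j where j: "snd z = Suc j" "j < n" by (cases z; cases "snd z") auto
    show "z \<in> ?g ` {..<n} \<union> ?f ` ?R"
    proof (cases "fst z")
      case 0
      then show ?thesis using j by (cases z) auto
    next
      case (Suc i)
      then have "z = ?f (i, j)" "(i, j) \<in> ?R" using z j by (cases z; auto)+
      then show ?thesis by blast
    qed
  qed auto
  moreover have "inj_on ?f ?R" "inj_on ?g {..<n}" by (auto simp: inj_on_def)
  moreover have "finite ?R" by (auto intro: finite_subset[of _ "{..<n} \<times> {..<n}"])
  moreover have "?g ` {..<n} \<inter> ?f ` ?R = {}" by auto
  ultimately have "(\<Prod>(i, j)\<in>?L. h i j) =
      prod ((\<lambda>(i, j). h i j) \<circ> ?g) {..<n} * prod ((\<lambda>(i, j). h i j) \<circ> ?f) ?R"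
    by (simp only: prod.union_disjoint finite_imageI finite_lessThan prod.reindex)
  also have "prod ((\<lambda>(i, j). h i j) \<circ> ?f) ?R = (\<Prod>(i, j)\<in>?R. h (Suc i) (Suc j))"
    by (rule prod.cong) auto
  finally show ?thesis by (simp add: o_def)
qed

lemma unshuffle_sign_eq:
  "unshuffle_sign ps B =
    (\<Prod>(i, j) | i < j \<and> j < length ps. if i \<notin> B \<and> j \<in> B then parity_sign (ps ! i * ps ! j) else 1)"
  unfolding unshuffle_sign_def
  by (rule prod.mono_neutral_cong_left)
    (auto intro: finite_subset[of _ "{..<length ps} \<times> {..<length ps}"] split: if_splits)

text \<open>A new first letter that is sent to the left factor passes no other letter. If it is sent to
  the right factor, every letter of \<open>B\<close> moves past it.\<close>

lemma unshuffle_sign_Cons_in: "unshuffle_sign (p # ps) (insert 0 (Suc ` B)) = unshuffle_sign ps B"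
  unfolding unshuffle_sign_eq length_Cons prod_pairs_Suc by (simp add: inj_image_mem_iff cong: if_cong)

lemma unshuffle_sign_Cons_out:
  "unshuffle_sign (p # ps) (Suc ` B) =
    (\<Prod>j<length ps. if j \<in> B then parity_sign (p * ps ! j) else 1) * unshuffle_sign ps B"
  unfolding unshuffle_sign_eq length_Cons prod_pairs_Suc by (simp add: inj_image_mem_iff image_iff cong: if_cong)

lemma twist_adjoin_list_nths:
  assumes "homogeneous ps xs"
  shows "twist k (adjoin_list (nths xs B)) =
    (\<Prod>j<length ps. if j \<in> B then parity_sign (k * ps ! j) else 1) *\<^sub>C adjoin_list (nths xs B)"
  using assms
proof (induction xs arbitrary: ps B)
  case (Cons x xs)
  then obtain p qs where *: "ps = p # qs" "x \<in> gcomp p" "homogeneous qs xs"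
    by (auto simp: homogeneous_Cons)
  show ?case
    using Cons.IH[OF *(3), of "{j. Suc j \<in> B}"]
    by (simp add: *(1) nths_Cons twist_adjoin[OF *(2)] adjoin_simps prod.lessThan_Suc_shift
      del: prod.lessThan_Suc cong: if_cong)
qed simp

lemma sum_Pow_lessThan_Suc:
  "(\<Sum>B\<in>Pow {..<Suc n}. f B) = (\<Sum>B\<in>Pow {..<n}. f (insert 0 (Suc ` B))) + (\<Sum>B\<in>Pow {..<n}. f (Suc ` B))"
proof -
  have Pow: "Pow (Suc ` {..<n}) = image Suc ` Pow {..<n}"
    by (simp add: image_Pow_surj)
  have inj: "inj_on (image Suc) (Pow {..<n})" "inj_on (insert 0) (Pow (Suc ` {..<n}))"
    by (auto simp: inj_on_def inj_image_eq_iff)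
  have disj: "Pow (Suc ` {..<n}) \<inter> insert 0 ` Pow (Suc ` {..<n}) = {}" by auto
  have "(\<Sum>B\<in>Pow {..<Suc n}. f B) = (\<Sum>B\<in>Pow (Suc ` {..<n}). f B) + (\<Sum>B\<in>insert 0 ` Pow (Suc ` {..<n}). f B)"
    unfolding lessThan_Suc_eq_insert_0 Pow_insert by (rule sum.union_disjoint) (use disj in auto)
  also have "(\<Sum>B\<in>insert 0 ` Pow (Suc ` {..<n}). f B) = (\<Sum>B\<in>Pow {..<n}. f (insert 0 (Suc ` B)))"
    unfolding sum.reindex[OF inj(2)] unfolding Pow by (simp add: sum.reindex[OF inj(1)])
  also have "(\<Sum>B\<in>Pow (Suc ` {..<n}). f B) = (\<Sum>B\<in>Pow {..<n}. f (Suc ` B))"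
    unfolding Pow by (simp add: sum.reindex[OF inj(1)])
  finally show ?thesis by (simp add: add.commute)
qed

text \<open>Expanding the product of the \<open>x \<otimes> 1 + 1 \<otimes> x\<close>: the set \<open>B\<close> consists of the positions whose
  letter goes to the left factor.\<close>

lemma ucoprod_adjoin_list:
  assumes "homogeneous ps xs"
  shows "ucoprod (adjoin_list xs) = (\<Sum>B\<in>Pow {..<length xs}.
    unshuffle_sign ps B *\<^sub>C (adjoin_list (nths xs B) \<otimes> adjoin_list (nths xs (- B))))"
  using assms
proof (induction xs arbitrary: ps)
  case Nil
  then show ?case by (simp add: ucoprod_unit unshuffle_sign_def)
next
  case (Cons x xs)
  then obtain p qs where *: "ps = p # qs" "x \<in> gcomp p" "homogeneous qs xs"
    by (auto simp: homogeneous_Cons)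
  note L = cbilinear_right[OF cbilinear_primitive_action]
  have set: "{j. Suc j \<in> Suc ` B} = B" "{j. Suc j \<notin> Suc ` B} = - B" for B by auto
  have nths_in: "nths (x # xs) (insert 0 (Suc ` B)) = x # nths xs B"
      "nths (x # xs) (- insert 0 (Suc ` B)) = nths xs (- B)"
    and nths_out: "nths (x # xs) (Suc ` B) = nths xs B" "nths (x # xs) (- (Suc ` B)) = x # nths xs (- B)"
    for B by (simp_all add: nths_Cons set)
  have "primitive_action x (adjoin_list (nths xs B) \<otimes> adjoin_list (nths xs (- B)))
      = (x \<odot> adjoin_list (nths xs B)) \<otimes> adjoin_list (nths xs (- B))
      + (\<Prod>j<length qs. if j \<in> B then parity_sign (p * qs ! j) else 1) *\<^sub>C
        (adjoin_list (nths xs B) \<otimes> (x \<odot> adjoin_list (nths xs (- B))))" for B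
    by (simp add: primitive_action_tens[OF *(2)] twist_adjoin_list_nths[OF *(3)] tens_simps)
  then show ?case
    by (simp add: ucoprod_adjoin Cons.IH[OF *(3)] clinear_simps[OF L] sum_Pow_lessThan_Suc nths_in nths_out
      *(1) unshuffle_sign_Cons_in unshuffle_sign_Cons_out scaleC_add_right sum.distrib mult.commute
      flip: lessThan_Suc)
qed

lemma clinear_incl: "clinear (\<lambda>y. (0 :: complex, y))"
  by (intro clinear_intros)

lemma clinear_snd': "clinear snd"
  by (intro clinear_snd clinear_id)

lemma reduced_ucoprod_homogeneous:
  assumes h: "homogeneous ps xs"
  shows "tensor_map snd snd (ucoprod (0, \<Odot> xs)) = (\<Sum>B | B \<noteq> {} \<and> B \<subset> {..<length xs}.
    unshuffle_sign ps B *\<^sub>C (\<Odot> (nths xs B) \<otimes> \<Odot> (nths xs (- B))))"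
proof (cases "xs = []")
  case True
  then show ?thesis
    by (simp add: clinear_0[OF clinear_ucoprod] clinear_0[OF clinear_tensor_map] clinear_snd'
        flip: zero_prod_def)
next
  case False
  have nths_full: "nths xs {length xs..} = []"
    by (auto simp: nths_def filter_empty_conv set_zip)
  have snd: "snd (adjoin_list zs) = \<Odot> zs" for zs :: "'a list" by (simp add: adjoin_list_eq)
  have "(0, \<Odot> xs) = adjoin_list xs" using False by (simp add: adjoin_list_eq)
  then have "tensor_map snd snd (ucoprod (0, \<Odot> xs)) =
      (\<Sum>B\<in>Pow {..<length xs}. unshuffle_sign ps B *\<^sub>C (\<Odot> (nths xs B) \<otimes> \<Odot> (nths xs (- B))))"
    by (simp add: ucoprod_adjoin_list[OF h] clinear_simps[OF clinear_tensor_map] clinear_snd'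
        tensor_map_tens snd)
  also have "\<dots> = (\<Sum>B | B \<noteq> {} \<and> B \<subset> {..<length xs}.
      unshuffle_sign ps B *\<^sub>C (\<Odot> (nths xs B) \<otimes> \<Odot> (nths xs (- B))))"
    by (rule sum.mono_neutral_right) (auto simp: psubset_eq tens_simps nths_full)
  finally show ?thesis .
qed

text \<open>The terms of the unital coproduct with a factor \<open>1\<close> are those for \<open>B\<close> empty or full;
  projecting to \<open>SV\<close> removes them.\<close>

lemma coprod_eq:
  fixes y :: "'a::graded_space sym"
  shows "coprod y = tensor_map snd snd (ucoprod (0, y))"
proof -
  let ?D = "\<lambda>y :: 'a sym. tensor_map snd snd (ucoprod (0, y))"
  have lin: "clinear ?D"
    by (intro clinear_compose[OF clinear_tensor_map] clinear_snd' clinear_compose[OF clinear_ucoprod] clinear_incl)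
  have "coprod = ?D" unfolding coprod_def
  proof (rule the_equality)
    fix D' :: "'a sym \<Rightarrow> ('a sym, 'a sym) tensor"
    assume D': "clinear D' \<and> (\<forall>ps xs. homogeneous ps xs \<longrightarrow> D' (\<Odot> xs) =
      (\<Sum>B | B \<noteq> {} \<and> B \<subset> {..<length xs}. unshuffle_sign ps B *\<^sub>C (\<Odot> (nths xs B) \<otimes> \<Odot> (nths xs (- B)))))"
    show "D' = ?D"
    proof
      show "D' y = ?D y" for y
      proof (induction y rule: sym_homogeneous_induct)
        case (prod ps xs)
        then show ?case using reduced_ucoprod_homogeneous[OF prod] D' by auto
      qed (use D' in \<open>auto simp: clinear_simps clinear_simps[OF lin]\<close>)
    qed
  qed (use lin reduced_ucoprod_homogeneous in auto)
  from fun_cong[OF this] show ?thesis .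
qed

lemma coprod_homogeneous:
  assumes "homogeneous ps xs"
  shows "coprod (\<Odot> xs) = (\<Sum>B | B \<noteq> {} \<and> B \<subset> {..<length xs}.
      unshuffle_sign ps B *\<^sub>C (\<Odot> (nths xs B) \<otimes> \<Odot> (nths xs (- B))))"
  unfolding coprod_eq by (rule reduced_ucoprod_homogeneous[OF assms])

lemma clinear_coprod: "clinear coprod"
  unfolding coprod_eq
  by (intro clinear_compose[OF clinear_tensor_map] clinear_snd' clinear_compose[OF clinear_ucoprod] clinear_incl)

section \<open>The product of the symmetric algebra\<close>

definition umul :: "'a::graded_space unital_sym \<Rightarrow> 'a unital_sym \<Rightarrow> 'a unital_sym" where
  "umul a b = ulift (\<odot>) b a"

lemma umul_unit [simp]: "umul \<one> b = b"
  and umul_adjoin: "umul (x \<odot> a) b = x \<odot> umul a b"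
  by (simp_all add: umul_def ulift_unit ulift_adjoin gcommuting_adjoin)

lemma clinear_umul_left: "clinear (\<lambda>a. umul a b)"
  unfolding umul_def by (rule clinear_ulift[OF gcommuting_adjoin])

lemma cbilinear_umul: "cbilinear umul"
proof (rule cbilinearI)
  show "clinear (umul a)" for a :: "'a unital_sym"
    by (induction a rule: unital_sym_induct)
       (auto simp: umul_adjoin clinear_simps[OF clinear_umul_left] intro: clinear_intros)
qed (rule clinear_umul_left)

lemmas umul_simps = cbilinear_simps[OF cbilinear_umul]

lemma umul_assoc: "umul (umul a b) c = umul a (umul b c)"
  by (induction a rule: unital_sym_induct) (simp_all add: umul_adjoin umul_simps)

text \<open>The form of graded commutativity that is suited to induction over the left factor.\<close>

lemma umul_adjoin_right: "x \<in> gcomp p \<Longrightarrow> umul a (x \<odot> b) = x \<odot> umul (twist p a) b"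
proof (induction a rule: unital_sym_induct)
  case (adjoin q v a)
  then have "umul (v \<odot> a) (x \<odot> b) = v \<odot> x \<odot> umul (twist p a) b" by (simp add: umul_adjoin)
  also have "\<dots> = parity_sign (q * p) *\<^sub>C (x \<odot> v \<odot> umul (twist p a) b)"
    by (rule adjoin_commute) (use adjoin in auto)
  finally show ?case
    by (simp add: twist_adjoin[OF adjoin(1)] umul_simps umul_adjoin adjoin_simps mult.commute)
qed (simp_all add: umul_simps twist_simps adjoin_simps)

lemma umul_unit_right [simp]: "umul a \<one> = a"
  by (induction a rule: unital_sym_induct) (simp_all add: umul_adjoin umul_simps)

lemma umul_degree: "a \<in> gcomp p \<Longrightarrow> has_degree p (umul a)"
proof -
  \<comment> \<open>The induction over words runs through inhomogeneous elements, hence the projection \<open>gpart p a\<close>.\<close>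
  have "gpart r (umul (gpart p a) b) = umul (gpart p a) (gpart (r - p) b)" for p r and a b :: "'a unital_sym"
  proof (induction a arbitrary: p r rule: unital_sym_induct)
    case unit
    then show ?case by (auto simp: gpart_homogeneous[OF unit_sym_gcomp] umul_simps)
  next
    case (adjoin q x a)
    then show ?case by (simp add: gpart_adjoin umul_adjoin algebra_simps)
  qed (simp_all add: gpart_add gpart_scaleC umul_simps)
  then show "a \<in> gcomp p \<Longrightarrow> has_degree p (umul a)"
    by (intro has_degreeI) (metis add_diff_cancel_right' gcomp_iff)
qed

lemma umul_commute:
  assumes "a \<in> gcomp p" "b \<in> gcomp q"
  shows "umul a b = parity_sign (p * q) *\<^sub>C umul b a"
proof -
  have "umul (gpart p a) b = umul b (twist q (gpart p a))" if b: "b \<in> gcomp q" for p q and a b :: "'a unital_sym"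
    using b
  proof (induction a arbitrary: p q b rule: unital_sym_induct)
    case unit
    then show ?case by (auto simp: gpart_homogeneous[OF unit_sym_gcomp] umul_simps twist_simps)
  next
    case (adjoin r x a)
    then have "umul (gpart p (x \<odot> a)) b = x \<odot> umul b (twist q (gpart (p - r) a))"
      by (simp add: gpart_adjoin umul_adjoin)
    also have "\<dots> = umul (twist r b) (x \<odot> twist q (gpart (p - r) a))"
      by (simp add: umul_adjoin_right[OF adjoin(1)])
    also have "\<dots> = umul b (twist q (gpart p (x \<odot> a)))"
      by (simp add: gpart_adjoin[OF adjoin(1)] twist_adjoin[OF adjoin(1)] twist_homogeneous[OF adjoin(3)] umul_simps mult.commute)
    finally show ?case .
  qed (simp_all add: gpart_add gpart_scaleC umul_simps twist_simps)
  from this[OF assms(2), of p a] show ?thesis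
    using assms by (simp add: gpart_homogeneous twist_homogeneous umul_simps mult.commute)
qed

section \<open>Uniqueness of maps with given components\<close>

lemma scaleC_2: "2 *\<^sub>C x = x + (x :: 'a::complex_space)"
  using scaleC_add_left[of 1 1 x] by simp

text \<open>Each letter is sent to the left or to the right factor, and multiplying back restores the
  word.\<close>

lemma tensor_lift_umul: "tensor_lift umul (ucoprod (adjoin_list xs)) = 2 ^ length xs *\<^sub>C adjoin_list xs"
proof -
  note lin = clinear_tensor_lift[OF cbilinear_umul]
  have "tensor_lift umul (primitive_action x t) = 2 *\<^sub>C (x \<odot> tensor_lift umul t)"
    if "x \<in> gcomp p" for p x and t :: "('a unital_sym, 'a unital_sym) tensor"
    by (induction t rule: tensor_induct)
       (simp_all add: primitive_action_tens[OF that] clinear_simps[OF lin] tensor_lift_tens[OF cbilinear_umul]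
         umul_adjoin umul_adjoin_right[OF that] cbilinear_simps[OF cbilinear_primitive_action] adjoin_simps
         scaleC_add_right scaleC_2)
  then have "tensor_lift umul (primitive_action x t) = 2 *\<^sub>C (x \<odot> tensor_lift umul t)"
    for x and t :: "('a unital_sym, 'a unital_sym) tensor"
    by (induction x rule: graded_induct)
       (simp_all add: cbilinear_simps[OF cbilinear_primitive_action] clinear_simps[OF lin] adjoin_simps scaleC_add_right)
  then show ?thesis
    by (induction xs) (simp_all add: ucoprod_unit ucoprod_adjoin tensor_lift_tens[OF cbilinear_umul] adjoin_simps)
qed

lemma counit_left: "tensor_lift (\<lambda>a b. fst a *\<^sub>C b) (ucoprod y) = y"
  and counit_right: "tensor_lift (\<lambda>a b. fst b *\<^sub>C a) (ucoprod y) = y"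
proof -
  have b1: "cbilinear (\<lambda>(a :: 'a unital_sym) (b :: 'a unital_sym). fst a *\<^sub>C b)"
    and b2: "cbilinear (\<lambda>(a :: 'a unital_sym) (b :: 'a unital_sym). fst b *\<^sub>C a)"
    by (intro cbilinearI clinear_intros)+
  note lin = clinear_tensor_lift[OF b1] clinear_tensor_lift[OF b2]
  have 1: "tensor_lift (\<lambda>a b. fst a *\<^sub>C b) (primitive_action x t) = x \<odot> tensor_lift (\<lambda>a b. fst a *\<^sub>C b) t"
    and 2: "tensor_lift (\<lambda>a b. fst b *\<^sub>C a) (primitive_action x t) = x \<odot> tensor_lift (\<lambda>a b. fst b *\<^sub>C a) t"
    if "x \<in> gcomp p" for p x and t :: "('a unital_sym, 'a unital_sym) tensor"
    by (induction t rule: tensor_induct)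
       (simp_all add: primitive_action_tens[OF that] clinear_simps[OF lin(1)] clinear_simps[OF lin(2)]
         tensor_lift_tens[OF b1] tensor_lift_tens[OF b2] fst_twist
         cbilinear_simps[OF cbilinear_primitive_action] adjoin_simps)
  show "tensor_lift (\<lambda>a b. fst a *\<^sub>C b) (ucoprod y) = y"
    by (rule unital_sym_eqI[where f = "\<lambda>y. tensor_lift (\<lambda>a b. fst a *\<^sub>C b) (ucoprod y)"])
       (auto intro: clinear_compose[OF lin(1) clinear_ucoprod] clinear_id
         simp: ucoprod_unit ucoprod_adjoin tensor_lift_tens[OF b1] 1)
  show "tensor_lift (\<lambda>a b. fst b *\<^sub>C a) (ucoprod y) = y"
    by (rule unital_sym_eqI[where f = "\<lambda>y. tensor_lift (\<lambda>a b. fst b *\<^sub>C a) (ucoprod y)"])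
       (auto intro: clinear_compose[OF lin(2) clinear_ucoprod] clinear_id
         simp: ucoprod_unit ucoprod_adjoin tensor_lift_tens[OF b2] 2)
qed

text \<open>Splitting both tensor factors along \<open>\<complex> \<oplus> SV\<close> expresses the coproduct of \<open>SV\<close> by the unital
  one; the counit laws identify the terms with a factor \<open>1\<close>.\<close>

lemma incl_coprod:
  "tensor_map (\<lambda>y. (0, y)) (\<lambda>y. (0, y)) (coprod y) = ucoprod (0, y) - \<one> \<otimes> (0, y) - (0, y) \<otimes> \<one>"
proof -
  let ?i = "\<lambda>y :: 'a sym. (0 :: complex, y)"
  let ?c1 = "tensor_lift (\<lambda>(a :: 'a unital_sym) (b :: 'a unital_sym). fst a *\<^sub>C b)"
  let ?c2 = "tensor_lift (\<lambda>(a :: 'a unital_sym) (b :: 'a unital_sym). fst b *\<^sub>C a)"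
  have b1: "cbilinear (\<lambda>(a :: 'a unital_sym) (b :: 'a unital_sym). fst a *\<^sub>C b)"
    and b2: "cbilinear (\<lambda>(a :: 'a unital_sym) (b :: 'a unital_sym). fst b *\<^sub>C a)"
    by (intro cbilinearI clinear_intros)+
  have l: "clinear (\<lambda>a :: 'a unital_sym. ?i (snd a))"
    by (intro clinear_intros)
  have "tensor_map (\<lambda>a. ?i (snd a)) (\<lambda>a. ?i (snd a)) t =
      t - \<one> \<otimes> ?c1 t - ?c2 t \<otimes> \<one> + fst (?c1 t) *\<^sub>C (\<one> \<otimes> \<one>)" for t
  proof (rule tensor_eqI[where t = t and f = "tensor_map (\<lambda>a. ?i (snd a)) (\<lambda>a. ?i (snd a))"])
    fix a b :: "'a unital_sym"
    have i: "?i (snd a) = a - fst a *\<^sub>C \<one>" for a :: "'a unital_sym"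
      by (simp add: prod_eq_iff scaleC_complex_def)
    show "tensor_map (\<lambda>a. ?i (snd a)) (\<lambda>a. ?i (snd a)) (a \<otimes> b) =
      a \<otimes> b - \<one> \<otimes> ?c1 (a \<otimes> b) - ?c2 (a \<otimes> b) \<otimes> \<one> + fst (?c1 (a \<otimes> b)) *\<^sub>C (\<one> \<otimes> \<one>)"
      by (subst tensor_map_tens[OF l l])
         (simp add: i tensor_lift_tens[OF b1] tensor_lift_tens[OF b2] tens_simps scaleC_diff_right
           scaleC_complex_def algebra_simps)
  qed (intro clinear_intros clinear_tensor_map clinear_tensor_lift b1 b2 l)+
  from this[of "ucoprod (0, y)"] show ?thesis
    unfolding coprod_eq counit_left counit_right
    by (simp add: tensor_map_compose clinear_incl clinear_snd')
qed

lemma graded_symmetric_proj: "graded_symmetric (\<lambda>xs. if length xs = 1 then hd xs else 0)"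
  by (rule graded_symmetricI) (auto simp: append_eq_Cons_conv)

lemma sym_proj_eq: "sym_proj = sym_lift (\<lambda>xs. if length xs = 1 then hd xs else 0)"
  unfolding sym_proj_def
proof (rule the_equality)
  show "clinear (sym_lift (\<lambda>xs :: 'a list. if length xs = 1 then hd xs else 0)) \<and>
    (\<forall>xs. sym_lift (\<lambda>xs :: 'a list. if length xs = 1 then hd xs else 0) (\<Odot> xs) = (if length xs = 1 then hd xs else 0))"
    by (intro conjI allI clinear_sym_lift sym_lift_prod graded_symmetric_proj)
  show "f = sym_lift (\<lambda>xs :: 'a list. if length xs = 1 then hd xs else 0)"
    if f: "clinear f \<and> (\<forall>xs. f (\<Odot> xs) = (if length xs = 1 then hd xs else 0))" for f
  proof
    show "f y = sym_lift (\<lambda>xs :: 'a list. if length xs = 1 then hd xs else 0) y" for y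
      by (induction y rule: sym_induct)
         (use f in \<open>auto simp: clinear_simps clinear_simps[OF clinear_sym_lift[OF graded_symmetric_proj]]
           sym_lift_prod[OF graded_symmetric_proj] simp del: One_nat_def\<close>)
  qed
qed

lemma clinear_sym_proj: "clinear sym_proj"
  unfolding sym_proj_eq by (rule clinear_sym_lift[OF graded_symmetric_proj])

lemma sym_proj_prod: "sym_proj (\<Odot> xs) = (if length xs = 1 then hd xs else 0)"
  unfolding sym_proj_eq by (rule sym_lift_prod[OF graded_symmetric_proj])

text \<open>Multiplying back after the coproduct is \<open>2\<^sup>n - 2\<close> on words of length \<open>n\<close>, which is invertible
  for \<open>n \<ge> 2\<close>. Thus the coproduct is injective up to the words of length one.\<close>

lemma coprod_injective:
  assumes "coprod y = 0"
  shows "y = \<Odot> [sym_proj y]"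
proof -
  \<comment> \<open>The rescaling by \<open>c\<close> inverts \<open>2\<^sup>n - 2\<close>; words of length one have to be killed, where this factor vanishes.\<close>
  define c :: "nat \<Rightarrow> complex" where "c n = (if n \<ge> 2 then 1 / (2 ^ n - 2) else 0)" for n
  let ?M = "\<lambda>y :: 'a sym. sym_lift (\<lambda>xs. c (length xs) *\<^sub>C \<Odot> xs)
    (snd (tensor_lift umul (tensor_map (\<lambda>y. (0, y)) (\<lambda>y. (0, y)) (coprod y))))"
  note lift = clinear_sym_lift[OF graded_symmetric_weight]
  have cop: "clinear (coprod :: 'a sym \<Rightarrow> _)"
    unfolding coprod_eq
    by (intro clinear_compose[OF clinear_tensor_map] clinear_snd' clinear_compose[OF clinear_ucoprod] clinear_incl)
  have lin: "clinear ?M"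
    by (intro clinear_compose[OF lift] clinear_snd clinear_compose[OF clinear_tensor_lift[OF cbilinear_umul]]
        clinear_compose[OF clinear_tensor_map] clinear_incl cop)
  have pow: "(2 :: complex) ^ n \<noteq> 2" if "n \<ge> 2" for n
  proof -
    have "(2 :: nat) ^ 2 \<le> 2 ^ n" using that by (intro power_increasing) auto
    then have "(2 :: nat) ^ n \<noteq> 2" by simp
    then have "of_nat (2 ^ n) \<noteq> (of_nat 2 :: complex)" unfolding of_nat_eq_iff .
    then show ?thesis by simp
  qed
  have "y = \<Odot> [sym_proj y] + ?M y" for y
  proof (induction y rule: sym_induct)
    case (prod xs)
    show ?case
    proof (cases "xs = []")
      case True
      then show ?thesis using clinear_0[OF lin]
        by (simp add: clinear_0[OF clinear_sym_proj] clinear_0[OF clinear_sym_prod_1])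
    next
      case False
      then have xs: "(0, \<Odot> xs) = adjoin_list xs" by (simp add: adjoin_list_eq)
      have "snd (tensor_lift umul (tensor_map (\<lambda>y. (0, y)) (\<lambda>y. (0, y)) (coprod (\<Odot> xs)))) = (2 ^ length xs - 2) *\<^sub>C \<Odot> xs"
        unfolding incl_coprod xs
        by (simp add: clinear_simps[OF clinear_tensor_lift[OF cbilinear_umul]] tensor_lift_umul
            tensor_lift_tens[OF cbilinear_umul])
           (simp add: adjoin_list_eq scaleC_diff_left scaleC_2)
      then have M: "?M (\<Odot> xs) = ((2 ^ length xs - 2) * c (length xs)) *\<^sub>C \<Odot> xs"
        by (simp add: clinear_scale[OF lift] sym_lift_prod[OF graded_symmetric_weight])
      show ?thesis
      proof (cases "length xs = 1")
        case True
        then show ?thesis unfolding M by (cases xs) (auto simp: sym_proj_prod)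
      next
        case False
        then have "length xs \<ge> 2" using \<open>xs \<noteq> []\<close> by (cases xs; cases "tl xs") auto
        then have "(2 ^ length xs - 2) * c (length xs) = 1" using pow by (simp add: c_def)
        then show ?thesis unfolding M using False by (simp add: sym_proj_prod clinear_0[OF clinear_sym_prod_1])
      qed
    qed
  next
    case (add s t)
    then show ?case
      by (simp only: clinear_add[OF lin] clinear_add[OF clinear_sym_proj] clinear_add[OF clinear_sym_prod_1])
         (metis (no_types, lifting) add.assoc add.left_commute)
  next
    case (scale a s)
    then show ?case
      by (simp only: clinear_scale[OF lin] clinear_scale[OF clinear_sym_proj] clinear_scale[OF clinear_sym_prod_1])
         (metis (no_types, lifting) scaleC_add_right)
  qed
  from this[of y] have "y = \<Odot> [sym_proj y] + ?M y" .
  also have "?M y = 0"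
    unfolding assms by (simp add: clinear_0[OF lift] clinear_0[OF clinear_tensor_map] clinear_incl
      clinear_0[OF clinear_tensor_lift[OF cbilinear_umul]])
  finally show ?thesis by (simp only: add_0_right)
qed

lemma length_nths_less:
  assumes "B \<noteq> {}" "B \<subset> {..<length xs}"
  shows "length (nths xs B) < length xs" "length (nths xs (- B)) < length xs"
proof -
  obtain i j where "i \<in> B" "i < length xs" "j \<notin> B" "j < length xs" using assms by blast
  then have "{i. i < length xs \<and> i \<in> B} \<subset> {..<length xs}" "{i. i < length xs \<and> i \<in> - B} \<subset> {..<length xs}"
    by auto
  from psubset_card_mono[OF finite_lessThan this(1)] psubset_card_mono[OF finite_lessThan this(2)]
  show "length (nths xs B) < length xs" "length (nths xs (- B)) < length xs"
    by (simp_all add: length_nths)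
qed

text \<open>The coproduct of a word involves only shorter words. If the coproduct of a map is determined
  by the values of the map on these, the components determine the map by induction on the
  length.\<close>

lemma sym_cofree_eqI:
  fixes F G :: "'a::graded_space sym \<Rightarrow> 'b::graded_space sym"
  assumes F: "clinear F" and G: "clinear G" and proj: "\<And>y. sym_proj (F y) = sym_proj (G y)"
    and step: "\<And>ps xs. homogeneous ps xs \<Longrightarrow> (\<And>ys. length ys < length xs \<Longrightarrow> F (\<Odot> ys) = G (\<Odot> ys)) \<Longrightarrow>
      coprod (F (\<Odot> xs)) = coprod (G (\<Odot> xs))"
  shows "F = G"
proof
  have prod: "F (\<Odot> xs) = G (\<Odot> xs)" for xs
  proof (induction "length xs" arbitrary: xs rule: less_induct)
    case less
    show ?case
    proof (rule sym_prod_homogeneous_induct[of xs "\<lambda>y. F y = G y"])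
      fix ps and ys :: "'a list" assume ys: "homogeneous ps ys" "length ys = length xs"
      then have "coprod (F (\<Odot> ys)) = coprod (G (\<Odot> ys))"
        by (intro step) (auto intro: less)
      then have "coprod (F (\<Odot> ys) - G (\<Odot> ys)) = 0" by (simp add: clinear_diff[OF clinear_coprod])
      from coprod_injective[OF this] show "F (\<Odot> ys) = G (\<Odot> ys)"
        by (simp add: clinear_diff[OF clinear_sym_proj] proj clinear_0[OF clinear_sym_prod_1])
    qed (simp add: clinear_add[OF F] clinear_add[OF G])
  qed
  show "F y = G y" for y
    by (induction y rule: sym_induct) (simp_all add: prod clinear_simps[OF F] clinear_simps[OF G])
qed

lemma clinear_coalgebra_map: "coalgebra_map F \<Longrightarrow> clinear F"
  by (simp add: coalgebra_map_def)

theorem coalgebra_map_unique: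
  fixes F G :: "'a::graded_space sym \<Rightarrow> 'b::graded_space sym"
  assumes "coalgebra_map F" "coalgebra_map G" "\<And>y. sym_proj (F y) = sym_proj (G y)"
  shows "F = G"
proof (rule sym_cofree_eqI)
  have F: "coprod (F y) = tensor_map F F (coprod y)" and G: "coprod (G y) = tensor_map G G (coprod y)" for y
    using assms by (auto simp: coalgebra_map_def fun_eq_iff)
  have lin: "clinear F" "clinear G" using assms by (simp_all add: coalgebra_map_def)
  note tm = clinear_tensor_map[OF lin(1) lin(1)] clinear_tensor_map[OF lin(2) lin(2)]
  fix ps and xs :: "'a list" assume h: "homogeneous ps xs" "\<And>ys. length ys < length xs \<Longrightarrow> F (\<Odot> ys) = G (\<Odot> ys)"
  show "coprod (F (\<Odot> xs)) = coprod (G (\<Odot> xs))"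
    unfolding F G coprod_homogeneous[OF h(1)] clinear_sum[OF tm(1)] clinear_sum[OF tm(2)]
    by (rule sum.cong) (auto simp: clinear_scale[OF tm(1)] clinear_scale[OF tm(2)]
      tensor_map_tens lin h(2) length_nths_less)
qed (use assms in \<open>auto simp: coalgebra_map_def\<close>)

lemma clinear_of_tens: "clinear T \<Longrightarrow> clinear (\<lambda>x. T (x \<otimes> y))"
  by (rule clinear_compose) (auto intro: clinear_intros)

lemma cbilinear_leibniz: "clinear D \<Longrightarrow> cbilinear (\<lambda>x y. D x \<otimes> y + twist 1 x \<otimes> D y)"
  by (intro cbilinearI clinear_intros)

lemma leibniz_eq:
  assumes "clinear D"
  shows "leibniz D = tensor_lift (\<lambda>x y. D x \<otimes> y + twist 1 x \<otimes> D y)"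
  unfolding leibniz_def
proof (rule the_equality)
  note b = cbilinear_leibniz[OF assms]
  show *: "clinear (tensor_lift (\<lambda>x y. D x \<otimes> y + twist 1 x \<otimes> D y)) \<and> (\<forall>p. \<forall>x\<in>sym_comp p. \<forall>y.
      tensor_lift (\<lambda>x y. D x \<otimes> y + twist 1 x \<otimes> D y) (x \<otimes> y) = D x \<otimes> y + parity_sign p *\<^sub>C (x \<otimes> D y))"
    by (simp add: clinear_tensor_lift[OF b] tensor_lift_tens[OF b] sym_comp_eq_gcomp twist_homogeneous tens_simps)
  fix T assume T: "clinear T \<and>
    (\<forall>p. \<forall>x\<in>sym_comp p. \<forall>y. T (x \<otimes> y) = D x \<otimes> y + parity_sign p *\<^sub>C (x \<otimes> D y))"
  show "T = tensor_lift (\<lambda>x y. D x \<otimes> y + twist 1 x \<otimes> D y)"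
  proof (rule ext, rule tensor_eqI[where f = T])
    show "T (x \<otimes> y) = tensor_lift (\<lambda>x y. D x \<otimes> y + twist 1 x \<otimes> D y) (x \<otimes> y)" for x y
    proof (rule graded_eqI[where x = x and f = "\<lambda>x. T (x \<otimes> y)"])
      show "T (x \<otimes> y) = tensor_lift (\<lambda>x y. D x \<otimes> y + twist 1 x \<otimes> D y) (x \<otimes> y)" if "x \<in> gcomp p" for p x
        using T * that by (simp add: sym_comp_eq_gcomp)
    qed (use T * in \<open>auto intro: clinear_of_tens\<close>)
  qed (use T * in auto)
qed

lemma clinear_leibniz: "clinear D \<Longrightarrow> clinear (leibniz D)"
  by (simp add: leibniz_eq clinear_tensor_lift cbilinear_leibniz)

lemma leibniz_tens: "clinear D \<Longrightarrow> leibniz D (x \<otimes> y) = D x \<otimes> y + twist 1 x \<otimes> D y"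
  by (simp add: leibniz_eq tensor_lift_tens cbilinear_leibniz)

theorem coderivation_unique:
  fixes D E :: "'a::graded_space sym \<Rightarrow> 'a sym"
  assumes "coderivation D" "coderivation E" "\<And>y. sym_proj (D y) = sym_proj (E y)"
  shows "D = E"
proof (rule sym_cofree_eqI)
  have D: "coprod (D y) = leibniz D (coprod y)" and E: "coprod (E y) = leibniz E (coprod y)" for y
    using assms by (auto simp: coderivation_def fun_eq_iff)
  have lin: "clinear D" "clinear E" using assms by (simp_all add: coderivation_def)
  fix ps and xs :: "'a list" assume h: "homogeneous ps xs" "\<And>ys. length ys < length xs \<Longrightarrow> D (\<Odot> ys) = E (\<Odot> ys)"
  show "coprod (D (\<Odot> xs)) = coprod (E (\<Odot> xs))"
    unfolding D E coprod_homogeneous[OF h(1)] clinear_sum[OF clinear_leibniz[OF lin(1)]]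
      clinear_sum[OF clinear_leibniz[OF lin(2)]]
    by (rule sum.cong) (auto simp: clinear_scale[OF clinear_leibniz[OF lin(1)]]
      clinear_scale[OF clinear_leibniz[OF lin(2)]] leibniz_tens lin h(2) length_nths_less)
qed (use assms in \<open>auto simp: coderivation_def\<close>)

lemma coalgebra_map_of_eqI:
  assumes "coalgebra_map F" "\<And>xs. xs \<noteq> [] \<Longrightarrow> sym_proj (F (\<Odot> xs)) = f xs"
  shows "coalgebra_map_of f = F"
  unfolding coalgebra_map_of_def
proof (rule the_equality)
  fix G assume G: "coalgebra_map G \<and> (\<forall>xs. xs \<noteq> [] \<longrightarrow> sym_proj (G (\<Odot> xs)) = f xs)"
  have lin: "clinear F" "clinear G" using assms(1) G by (simp_all add: coalgebra_map_def)
  show "G = F"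
  proof (rule coalgebra_map_unique)
    show "sym_proj (G y) = sym_proj (F y)" for y
    proof (induction y rule: sym_induct)
      case (prod xs)
      then show ?case using assms(2) G by (cases "xs = []") (auto simp: clinear_0 lin)
    qed (simp_all add: clinear_simps[OF lin(1)] clinear_simps[OF lin(2)] clinear_simps[OF clinear_sym_proj])
  qed (use assms G in auto)
qed (use assms in auto)

lemma coderivation_of_eqI:
  assumes "coderivation D" "\<And>xs. xs \<noteq> [] \<Longrightarrow> sym_proj (D (\<Odot> xs)) = f xs"
  shows "coderivation_of f = D"
  unfolding coderivation_of_def
proof (rule the_equality)
  fix E assume E: "coderivation E \<and> (\<forall>xs. xs \<noteq> [] \<longrightarrow> sym_proj (E (\<Odot> xs)) = f xs)"
  have lin: "clinear D" "clinear E" using assms(1) E by (simp_all add: coderivation_def)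
  show "E = D"
  proof (rule coderivation_unique)
    show "sym_proj (E y) = sym_proj (D y)" for y
    proof (induction y rule: sym_induct)
      case (prod xs)
      then show ?case using assms(2) E by (cases "xs = []") (auto simp: clinear_0 lin)
    qed (simp_all add: clinear_simps[OF lin(1)] clinear_simps[OF lin(2)] clinear_simps[OF clinear_sym_proj])
  qed (use assms E in auto)
qed (use assms in auto)

section \<open>Derivations of the symmetric algebra\<close>

text \<open>\<open>uder k \<delta> w\<close> is the operator of degree \<open>k\<close> on \<open>\<complex> \<oplus> SV\<close> that is multiplication by \<open>w\<close> plus the
  derivation extending \<open>\<delta>\<close>. The Leibniz rule refers to the word itself and not only to its
  image; therefore the universal property is applied to pairs of a word and its image.\<close>

definition derivation_action :: "int \<Rightarrow> ('a \<Rightarrow> 'a) \<Rightarrow> 'a::graded_space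
    \<Rightarrow> 'a unital_sym \<times> 'a unital_sym \<Rightarrow> 'a unital_sym \<times> 'a unital_sym" where
  "derivation_action k \<delta> v z = (v \<odot> fst z, \<delta> v \<odot> fst z + twist k v \<odot> snd z)"

definition uder :: "int \<Rightarrow> ('a \<Rightarrow> 'a) \<Rightarrow> 'a \<Rightarrow> 'a::graded_space unital_sym \<Rightarrow> 'a unital_sym" where
  "uder k \<delta> w y = snd (ulift (derivation_action k \<delta>) (\<one>, w \<odot> \<one>) y)"

definition graded_map :: "int \<Rightarrow> ('a::graded_space \<Rightarrow> 'b::graded_space) \<Rightarrow> bool" where
  "graded_map k \<delta> \<longleftrightarrow> clinear \<delta> \<and> has_degree k \<delta>"

lemma graded_map_linear: "graded_map k \<delta> \<Longrightarrow> clinear \<delta>"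
  and graded_map_gcomp: "graded_map k \<delta> \<Longrightarrow> x \<in> gcomp p \<Longrightarrow> \<delta> x \<in> gcomp (p + k)"
  and graded_map_twist: "graded_map k \<delta> \<Longrightarrow> twist j (\<delta> x) = parity_sign (j * k) *\<^sub>C \<delta> (twist j x)"
  by (simp_all add: graded_map_def has_degreeD twist_map)

lemma graded_mapI: "clinear \<delta> \<Longrightarrow> (\<And>p x. x \<in> gcomp p \<Longrightarrow> \<delta> x \<in> gcomp (p + k)) \<Longrightarrow> graded_map k \<delta>"
  by (auto simp: graded_map_def has_degree_def)

lemma graded_map_gpart: "graded_map k \<delta> \<Longrightarrow> gpart p (\<delta> x) = \<delta> (gpart (p - k) x)"
  by (simp add: graded_map_def degree_gpart)

lemma graded_map_gpartI:
  "clinear \<delta> \<Longrightarrow> (\<And>p x. gpart (p + k) (\<delta> x) = \<delta> (gpart p x)) \<Longrightarrow> graded_map k \<delta>"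
  by (simp add: graded_map_def has_degreeI)

lemma graded_map_zero: "graded_map k (\<lambda>_. 0)"
  by (intro graded_mapI clinear_intros gcomp_0)

context
  fixes k :: int and \<delta> :: "'a::graded_space \<Rightarrow> 'a"
  assumes \<delta>: "graded_map k \<delta>"
begin

lemma gcommuting_derivation_action: "gcommuting (derivation_action k \<delta>)"
proof (rule gcommutingI)
  show "cbilinear (derivation_action k \<delta>)"
    unfolding derivation_action_def
    by (intro cbilinearI clinear_intros clinear_compose[OF _ graded_map_linear[OF \<delta>], of "\<lambda>x. x \<odot> _"])
  fix p q and x y :: 'a and z :: "'a unital_sym \<times> 'a unital_sym"
  assume x: "x \<in> gcomp p" and y: "y \<in> gcomp q"
  note dx = graded_map_gcomp[OF \<delta> x] and dy = graded_map_gcomp[OF \<delta> y]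
  show "derivation_action k \<delta> x (derivation_action k \<delta> y z) =
      parity_sign (p * q) *\<^sub>C derivation_action k \<delta> y (derivation_action k \<delta> x z)"
    using adjoin_commute[OF x y, of "fst z"] adjoin_commute[OF x y, of "snd z"]
      adjoin_commute[OF dx y, of "fst z"] adjoin_commute[OF x dy, of "fst z"]
    by (simp add: derivation_action_def twist_homogeneous[OF x] twist_homogeneous[OF y]
        adjoin_simps scaleC_add_right)
       (auto simp: parity_sign_if scaleC_minus_left)
qed

lemma clinear_uder: "clinear (uder k \<delta> w)"
  unfolding uder_def
  by (rule clinear_snd[OF clinear_ulift[OF gcommuting_derivation_action]])

lemma uder_unit: "uder k \<delta> w \<one> = w \<odot> \<one>"
  by (simp add: uder_def ulift_unit[OF gcommuting_derivation_action])

lemma uder_adjoin: "uder k \<delta> w (v \<odot> y) = \<delta> v \<odot> y + twist k v \<odot> uder k \<delta> w y"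
proof -
  have "fst (ulift (derivation_action k \<delta>) (\<one>, w \<odot> \<one>) y) = y" for y
    by (rule unital_sym_eqI[where f = "\<lambda>y. fst (ulift (derivation_action k \<delta>) (\<one>, w \<odot> \<one>) y)"])
       (auto intro: clinear_fst[OF clinear_ulift[OF gcommuting_derivation_action]] clinear_id
         simp: ulift_unit[OF gcommuting_derivation_action] ulift_adjoin[OF gcommuting_derivation_action]
           derivation_action_def)
  then show ?thesis
    by (simp add: uder_def ulift_adjoin[OF gcommuting_derivation_action] derivation_action_def)
qed

lemmas uder_simps = clinear_simps[OF clinear_uder]

lemma fst_uder: "fst (uder k \<delta> w y) = 0"
  by (induction y rule: unital_sym_induct) (simp_all add: uder_unit uder_adjoin uder_simps)

lemma graded_map_uder:
  assumes w: "w \<in> gcomp k"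
  shows "graded_map k (uder k \<delta> w)"
proof (rule graded_map_gpartI[OF clinear_uder])
  show "gpart (p + k) (uder k \<delta> w y) = uder k \<delta> w (gpart p y)" for p y
  proof (induction y arbitrary: p rule: unital_sym_induct)
    case unit
    then show ?case
      by (auto simp: uder_unit gpart_adjoin[OF w] gpart_homogeneous[OF unit_sym_gcomp] adjoin_simps uder_simps)
  next
    case (adjoin q v y)
    have "gpart (p + k) (\<delta> v \<odot> y) = \<delta> v \<odot> gpart (p - q) y"
      using gpart_adjoin[OF graded_map_gcomp[OF \<delta> adjoin(1)]] by simp
    moreover have "gpart (p + k) (twist k v \<odot> uder k \<delta> w y) = twist k v \<odot> uder k \<delta> w (gpart (p - q) y)"
      using gpart_adjoin[OF twist_in_gcomp[OF adjoin(1)], of "p + k"] adjoin(2)[of "p - q"]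
      by (simp add: algebra_simps)
    ultimately show ?case
      by (simp add: uder_adjoin gpart_add gpart_adjoin[OF adjoin(1)])
  qed (simp_all add: uder_simps gpart_add gpart_scaleC)
qed

end

text \<open>The projection to \<open>V\<close>, which extracts the components of a map.\<close>

definition uproj :: "'b::graded_space unital_sym \<Rightarrow> 'b" where
  "uproj y = sym_proj (snd y)"

lemma clinear_uproj: "clinear uproj"
  unfolding uproj_def by (intro clinear_compose[OF clinear_sym_proj] clinear_snd')

lemmas uproj_simps = clinear_simps[OF clinear_uproj]

lemma uproj_adjoin_list: "uproj (adjoin_list xs) = (if length xs = 1 then hd xs else 0)"
  by (simp add: uproj_def adjoin_list_eq sym_proj_prod)

lemma uproj_unit [simp]: "uproj \<one> = 0"
  using uproj_adjoin_list[of "[]"] by simp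

lemma uproj_adjoin [simp]: "uproj (x \<odot> y) = fst y *\<^sub>C x"
proof (induction y rule: unital_sym_induct_list)
  case (1 xs)
  show ?case using uproj_adjoin_list[of "x # xs"] by (cases xs) simp_all
qed (simp_all add: uproj_simps adjoin_simps scaleC_add_left scaleC_complex_def)

lemma uproj_uder:
  assumes "graded_map k \<delta>"
  shows "uproj (uder k \<delta> w y) = \<delta> (uproj y) + fst y *\<^sub>C w"
proof -
  note lin = clinear_simps[OF graded_map_linear[OF assms]]
  show ?thesis
    by (induction y rule: unital_sym_induct)
      (simp_all add: uder_unit[OF assms] uder_adjoin[OF assms] uder_simps[OF assms] uproj_simps fst_uder[OF assms] lin
        scaleC_add_left scaleC_add_right scaleC_complex_def)
qed

lemma uder_add:
  assumes "graded_map k \<delta>" "graded_map k \<delta>'"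
  shows "uder k (\<lambda>x. \<delta> x + \<delta>' x) (w + w') y = uder k \<delta> w y + uder k \<delta>' w' y"
proof -
  have g: "graded_map k (\<lambda>x. \<delta> x + \<delta>' x)"
    using assms by (auto intro!: graded_mapI clinear_intros gcomp_add dest: graded_map_linear graded_map_gcomp)
  show ?thesis
    by (induction y rule: unital_sym_induct)
      (simp_all add: uder_unit[OF g] uder_unit[OF assms(1)] uder_unit[OF assms(2)]
        uder_adjoin[OF g] uder_adjoin[OF assms(1)] uder_adjoin[OF assms(2)]
        uder_simps[OF g] uder_simps[OF assms(1)] uder_simps[OF assms(2)] adjoin_simps scaleC_add_right)
qed

text \<open>For \<open>\<delta> = 0\<close> the recursion moves \<open>w\<close> past one letter after another, so multiplication by \<open>w\<close>
  is a special case.\<close>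

lemma uder_zero_derivation:
  assumes w: "w \<in> gcomp k"
  shows "uder k (\<lambda>_. 0) w y = w \<odot> y"
proof (rule unital_sym_eqI[where f = "uder k (\<lambda>_. 0) w"])
  show "uder k (\<lambda>_. 0) w (x \<odot> y) = w \<odot> x \<odot> y"
    if "x \<in> gcomp p" "uder k (\<lambda>_. 0) w y = w \<odot> y" for p x y
    using that adjoin_commute[OF w that(1), of y]
    by (simp add: uder_adjoin[OF graded_map_zero] adjoin_simps twist_homogeneous)
qed (auto intro: clinear_uder[OF graded_map_zero] clinear_intros simp: uder_unit[OF graded_map_zero])

text \<open>The graded commutator of two operators of this kind is again of this kind. This single
  computation gives the commutation of the operators that define the cumulant map, the
  compatibility of derivations with it, and the vanishing of the square of an extended
  differential.\<close>

lemma uder_bracket: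
  assumes \<delta>: "graded_map k \<delta>" and \<delta>': "graded_map l \<delta>'" and \<delta>'': "graded_map (k + l) \<delta>''"
    and w: "w \<in> gcomp k" and w': "w' \<in> gcomp l"
    and bracket: "\<And>v. \<delta> (\<delta>' v) = \<delta>'' v + parity_sign (k * l) *\<^sub>C \<delta>' (\<delta> v)"
    and bracket_w: "\<delta> w' = w'' + parity_sign (k * l) *\<^sub>C \<delta>' w"
  shows "uder k \<delta> w (uder l \<delta>' w' y) = uder (k + l) \<delta>'' w'' y + parity_sign (k * l) *\<^sub>C uder l \<delta>' w' (uder k \<delta> w y)"
proof -
  note lin = clinear_simps[OF graded_map_linear[OF \<delta>]] clinear_simps[OF graded_map_linear[OF \<delta>']]
  note simps = uder_unit[OF \<delta>] uder_unit[OF \<delta>'] uder_unit[OF \<delta>''] uder_adjoin[OF \<delta>] uder_adjoin[OF \<delta>']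
    uder_adjoin[OF \<delta>''] uder_simps[OF \<delta>] uder_simps[OF \<delta>'] uder_simps[OF \<delta>'']
  show ?thesis
  proof (induction y rule: unital_sym_induct)
    case unit
    show ?case
      using adjoin_commute[OF w w', of \<one>]
      by (simp add: simps bracket_w adjoin_simps twist_homogeneous[OF w] twist_homogeneous[OF w'] scaleC_add_right)
         (auto simp: parity_sign_if scaleC_minus_left)
  next
    case (adjoin p v y)
    show ?case
      by (simp add: simps bracket adjoin(2) adjoin_simps twist_homogeneous[OF adjoin(1)]
            twist_homogeneous[OF graded_map_gcomp[OF \<delta> adjoin(1)]]
            twist_homogeneous[OF graded_map_gcomp[OF \<delta>' adjoin(1)]] lin scaleC_add_right)
         (auto simp: parity_sign_if scaleC_minus_left)
  next
    case (add y z)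
    then show ?case by (simp add: simps scaleC_add_right)
  next
    case (scale c y)
    then show ?case by (simp add: simps scaleC_add_right mult.commute)
  qed
qed

definition uleibniz :: "int \<Rightarrow> ('a::graded_space unital_sym \<Rightarrow> 'a unital_sym)
    \<Rightarrow> ('a unital_sym, 'a unital_sym) tensor \<Rightarrow> ('a unital_sym, 'a unital_sym) tensor" where
  "uleibniz k D = tensor_lift (\<lambda>a b. D a \<otimes> b + twist k a \<otimes> D b)"

lemma cbilinear_uleibniz: "clinear D \<Longrightarrow> cbilinear (\<lambda>a b. D a \<otimes> b + twist k a \<otimes> D b)"
  by (intro cbilinearI clinear_intros)

lemma clinear_uleibniz: "clinear D \<Longrightarrow> clinear (uleibniz k D)"
  and uleibniz_tens: "clinear D \<Longrightarrow> uleibniz k D (a \<otimes> b) = D a \<otimes> b + twist k a \<otimes> D b"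
  by (simp_all add: uleibniz_def clinear_tensor_lift tensor_lift_tens cbilinear_uleibniz)

text \<open>Multiplication by a vector and derivations are coderivations. Both sides satisfy the same
  recursion under multiplication by vectors, by the commutator of the Leibniz operator with
  \<open>primitive_action\<close>.\<close>

lemma ucoprod_uder:
  assumes \<delta>: "graded_map k \<delta>" and w: "w \<in> gcomp k"
  shows "ucoprod (uder k \<delta> w y) = uleibniz k (uder k \<delta> w) (ucoprod y)"
proof (rule unital_sym_eqI[where f = "\<lambda>y. ucoprod (uder k \<delta> w y)"])
  let ?D = "uder k \<delta> w"
  note D = clinear_uder[OF \<delta>] and gD = graded_map_uder[OF \<delta> w]
  show "ucoprod (?D \<one>) = uleibniz k ?D (ucoprod \<one>)"
    by (simp add: uder_unit[OF \<delta>] ucoprod_adjoin ucoprod_unit uleibniz_tens[OF D] primitive_action_tens[OF w])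
  fix p and v :: 'a and y
  assume v: "v \<in> gcomp p" and IH: "ucoprod (?D y) = uleibniz k ?D (ucoprod y)"
  have "uleibniz k ?D (primitive_action v t) =
      primitive_action (\<delta> v) t + primitive_action (twist k v) (uleibniz k ?D t)" for t
  proof (rule tensor_eqI[where t = t and f = "\<lambda>t. uleibniz k ?D (primitive_action v t)"])
    fix a b
    show "uleibniz k ?D (primitive_action v (a \<otimes> b)) =
      primitive_action (\<delta> v) (a \<otimes> b) + primitive_action (twist k v) (uleibniz k ?D (a \<otimes> b))"
      by (simp add: primitive_action_tens[OF v] primitive_action_tens[OF graded_map_gcomp[OF \<delta> v]]
          clinear_simps[OF clinear_uleibniz[OF D]] uleibniz_tens[OF D] uder_adjoin[OF \<delta>]
          twist_homogeneous[OF v] cbilinear_simps[OF cbilinear_primitive_action] tens_simps adjoin_simps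
          twist_adjoin[OF v] graded_map_twist[OF gD] twist_twist scaleC_add_right)
         (auto simp: parity_sign_if scaleC_minus_left add.commute)
  qed (intro clinear_plus clinear_compose[OF cbilinear_right[OF cbilinear_primitive_action]] 
      clinear_compose[OF clinear_uleibniz[OF D]] cbilinear_right[OF cbilinear_primitive_action] clinear_uleibniz[OF D])+
  then show "ucoprod (?D (v \<odot> y)) = uleibniz k ?D (ucoprod (v \<odot> y))"
    by (simp add: uder_adjoin[OF \<delta>] ucoprod_adjoin clinear_simps[OF clinear_ucoprod] IH)
qed (intro clinear_compose[OF clinear_ucoprod] clinear_uder[OF \<delta>] clinear_compose[OF clinear_uleibniz]
    clinear_ucoprod)+

section \<open>From the unital to the reduced coalgebra\<close>

text \<open>Passing from a map of \<open>\<complex> \<oplus> SV\<close> that respects the splitting to its restriction to \<open>SV\<close>.\<close>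

definition reduce :: "('a::graded_space unital_sym \<Rightarrow> 'b::graded_space unital_sym) \<Rightarrow> 'a sym \<Rightarrow> 'b sym" where
  "reduce F y = snd (F (0, y))"

lemma clinear_reduce: "clinear F \<Longrightarrow> clinear (reduce F)"
  unfolding reduce_def by (intro clinear_snd clinear_compose[OF _ clinear_incl])

lemma reduce_eq: "fst (F (0, y)) = 0 \<Longrightarrow> F (0, y) = (0, reduce F y)"
  by (simp add: reduce_def prod_eq_iff)

lemma snd_eq_reduce:
  assumes "clinear F" "snd (F \<one>) = 0"
  shows "snd (F a) = reduce F (snd a)"
proof -
  have "F a = fst a *\<^sub>C F \<one> + F (0, snd a)"
    by (subst unital_sym_decompose) (simp only: clinear_simps[OF assms(1)])
  then show ?thesis by (simp add: assms(2) reduce_def)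
qed

lemma sym_proj_reduce: "sym_proj (reduce F y) = uproj (F (0, y))"
  by (simp add: reduce_def uproj_def)

lemma graded_map_reduce:
  assumes "graded_map k F"
  shows "graded_map k (reduce F)"
proof (rule graded_map_gpartI)
  fix p y
  have "gpart (p + k) (F (0, y)) = F (0, gpart p y)"
    using graded_map_gpart[OF assms, of "p + k" "(0, y)"] by (simp add: gpart_prod_def)
  then show "gpart (p + k) (reduce F y) = reduce F (gpart p y)"
    by (simp add: reduce_def flip: snd_gpart)
qed (use assms in \<open>auto intro: clinear_reduce dest: graded_map_linear\<close>)

definition unital_coalgebra_map :: "('a::graded_space unital_sym \<Rightarrow> 'b::graded_space unital_sym) \<Rightarrow> bool" where
  "unital_coalgebra_map F \<longleftrightarrow> graded_map 0 F \<and> F \<one> = \<one> \<and> (\<forall>y. fst (F y) = fst y) \<and>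
    (\<forall>y. ucoprod (F y) = tensor_map F F (ucoprod y))"

lemma coalgebra_map_reduce:
  assumes "unital_coalgebra_map F"
  shows "coalgebra_map (reduce F)" "sym_has_degree 0 (reduce F)"
proof -
  have lin: "clinear F" using assms by (auto simp: unital_coalgebra_map_def dest: graded_map_linear)
  note lin' = clinear_reduce[OF lin]
  have snd: "snd (F a) = reduce F (snd a)" for a
    using assms by (intro snd_eq_reduce lin) (simp add: unital_coalgebra_map_def)
  have "coprod (reduce F y) = tensor_map (reduce F) (reduce F) (coprod y)" for y
  proof -
    have "(0, reduce F y) = F (0, y)" using assms by (simp add: unital_coalgebra_map_def reduce_eq)
    then have "coprod (reduce F y) = tensor_map snd snd (tensor_map F F (ucoprod (0, y)))"
      using assms by (simp add: coprod_eq unital_coalgebra_map_def)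
    also have "\<dots> = tensor_map (reduce F) (reduce F) (coprod y)"
      by (simp add: tensor_map_compose clinear_snd' lin lin' coprod_eq snd)
    finally show ?thesis .
  qed
  then show "coalgebra_map (reduce F)" by (simp add: coalgebra_map_def lin' fun_eq_iff)
  show "sym_has_degree 0 (reduce F)"
    using assms graded_map_reduce[of 0 F]
    by (simp add: unital_coalgebra_map_def sym_has_degree_iff) (simp add: graded_map_def)
qed

lemma coderivation_reduce_uder:
  assumes \<delta>: "graded_map 1 \<delta>"
  shows "coderivation (reduce (uder 1 \<delta> 0))"
proof -
  let ?D = "uder 1 \<delta> 0"
  note D = clinear_uder[OF \<delta>] and R = clinear_reduce[OF clinear_uder[OF \<delta>]]
  have snd: "snd (?D a) = reduce ?D (snd a)" for a
    by (rule snd_eq_reduce[OF D]) (simp add: uder_unit[OF \<delta>] adjoin_simps)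
  have "tensor_map snd snd (uleibniz 1 ?D t) = leibniz (reduce ?D) (tensor_map snd snd t)" for t
    by (rule tensor_eqI[where t = t and f = "\<lambda>t. tensor_map snd snd (uleibniz 1 ?D t)"])
       (auto intro!: clinear_compose[OF clinear_tensor_map] clinear_compose[OF clinear_leibniz] clinear_tensor_map
         clinear_uleibniz D R clinear_snd' simp: tensor_map_tens clinear_snd' uleibniz_tens[OF D]
         leibniz_tens[OF R] clinear_simps[OF clinear_tensor_map] snd snd_twist)
  moreover have "(0, reduce ?D y) = ?D (0, y)" for y
    by (simp add: reduce_eq fst_uder[OF \<delta>])
  ultimately have "coprod (reduce ?D y) = leibniz (reduce ?D) (coprod y)" for y
    by (simp add: coprod_eq ucoprod_uder[OF \<delta> gcomp_0])
  then show ?thesis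
    using graded_map_reduce[OF graded_map_uder[OF \<delta> gcomp_0]] R
    by (simp add: coderivation_def sym_has_degree_iff fun_eq_iff graded_map_def)
qed

text \<open>A linear map that turns multiplication by vectors into operators \<open>uder\<close> is a coalgebra map,
  since both kinds of operators are coderivations.\<close>

lemma unital_coalgebra_mapI:
  fixes F :: "'a::graded_space unital_sym \<Rightarrow> 'b::graded_space unital_sym"
  assumes lin: "clinear F" and F_unit: "F \<one> = \<one>"
    and \<delta>: "\<And>p x. x \<in> gcomp p \<Longrightarrow> graded_map p (\<delta> p x)" and w: "\<And>p x. x \<in> gcomp p \<Longrightarrow> w p x \<in> gcomp p"
    and F: "\<And>p x y. x \<in> gcomp p \<Longrightarrow> F (x \<odot> y) = uder p (\<delta> p x) (w p x) (F y)"
  shows "unital_coalgebra_map F"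
  unfolding unital_coalgebra_map_def
proof (intro conjI allI)
  show gF: "graded_map 0 F"
  proof (rule graded_map_gpartI[OF lin])
    fix p y
    have "gpart p (F y) = F (gpart p y)"
    proof (induction y arbitrary: p rule: unital_sym_induct)
      case unit
      show ?case by (auto simp: F_unit gpart_homogeneous[OF unit_sym_gcomp] clinear_0[OF lin])
    next
      case (adjoin q x y)
      then show ?case
        using graded_map_gpart[OF graded_map_uder[OF \<delta>[OF adjoin(1)] w[OF adjoin(1)]], of p]
        by (simp add: F gpart_adjoin)
    qed (simp_all add: clinear_simps[OF lin] gpart_add gpart_scaleC)
    then show "gpart (p + 0) (F y) = F (gpart p y)" by simp
  qed
  show "fst (F y) = fst y" for y
  proof (induction y rule: unital_sym_induct)
    case (adjoin p x y)
    then show ?case using fst_uder[OF \<delta>] by (simp add: F)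
  qed (simp_all add: clinear_simps[OF lin] F_unit)
  show "ucoprod (F y) = tensor_map F F (ucoprod y)" for y
  proof (rule unital_sym_eqI[where f = "\<lambda>y. ucoprod (F y)"])
    show "ucoprod (F \<one>) = tensor_map F F (ucoprod \<one>)"
      by (simp add: F_unit ucoprod_unit tensor_map_tens lin)
    fix p and x :: 'a and y assume x: "x \<in> gcomp p" and IH: "ucoprod (F y) = tensor_map F F (ucoprod y)"
    let ?D = "uder p (\<delta> p x) (w p x)"
    note D = clinear_uder[OF \<delta>[OF x]]
    have "tensor_map F F (primitive_action x t) = uleibniz p ?D (tensor_map F F t)" for t
      by (rule tensor_eqI[where t = t and f = "\<lambda>t. tensor_map F F (primitive_action x t)"])
         (auto intro!: clinear_compose[OF clinear_tensor_map] clinear_compose[OF clinear_uleibniz] clinear_tensor_map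
           lin D cbilinear_right[OF cbilinear_primitive_action]
           simp: primitive_action_tens[OF x] clinear_simps[OF clinear_tensor_map] lin tensor_map_tens
             uleibniz_tens[OF D] F[OF x] graded_map_twist[OF gF])
    then show "ucoprod (F (x \<odot> y)) = tensor_map F F (ucoprod (x \<odot> y))"
      by (simp add: F[OF x] ucoprod_uder[OF \<delta>[OF x] w[OF x]] IH ucoprod_adjoin)
  qed (intro clinear_compose[OF clinear_ucoprod] clinear_compose[OF clinear_tensor_map] lin clinear_ucoprod)+
qed (rule F_unit)

section \<open>Functoriality\<close>

definition ufunct :: "('a::graded_space \<Rightarrow> 'b::graded_space) \<Rightarrow> 'a unital_sym \<Rightarrow> 'b unital_sym" where
  "ufunct f = ulift (\<lambda>x y. f x \<odot> y) \<one>"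

context
  fixes f :: "'a::graded_space \<Rightarrow> 'b::graded_space"
  assumes f: "graded_map 0 f"
begin

lemma gcommuting_ufunct: "gcommuting (\<lambda>x y. f x \<odot> y)"
proof (rule gcommutingI)
  show "cbilinear (\<lambda>x y. f x \<odot> y)"
    by (intro cbilinearI clinear_intros graded_map_linear[OF f])
  show "f x \<odot> f y \<odot> z = parity_sign (p * q) *\<^sub>C (f y \<odot> f x \<odot> z)"
    if "x \<in> gcomp p" "y \<in> gcomp q" for p q x y z
    using adjoin_commute[OF graded_map_gcomp[OF f that(1)] graded_map_gcomp[OF f that(2)], of z] by simp
qed

lemma clinear_ufunct: "clinear (ufunct f)"
  and ufunct_unit: "ufunct f \<one> = \<one>"
  and ufunct_adjoin: "ufunct f (x \<odot> y) = f x \<odot> ufunct f y"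
  by (simp_all add: ufunct_def clinear_ulift ulift_unit ulift_adjoin gcommuting_ufunct)

lemma unital_coalgebra_map_ufunct: "unital_coalgebra_map (ufunct f)"
proof (rule unital_coalgebra_mapI[where \<delta> = "\<lambda>p x y. 0" and w = "\<lambda>p x. f x"])
  show "f x \<in> gcomp p" if "x \<in> gcomp p" for p x
    using graded_map_gcomp[OF f that] by simp
  then show "ufunct f (x \<odot> y) = uder p (\<lambda>y. 0) (f x) (ufunct f y)" if "x \<in> gcomp p" for p x y
    using that by (simp add: ufunct_adjoin uder_zero_derivation)
qed (auto intro: clinear_ufunct ufunct_unit graded_map_zero)

lemma fst_ufunct: "fst (ufunct f y) = fst y"
  using unital_coalgebra_map_ufunct unfolding unital_coalgebra_map_def by blast

lemma uproj_ufunct: "uproj (ufunct f y) = f (uproj y)"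
  by (induction y rule: unital_sym_induct)
    (simp_all add: ufunct_unit ufunct_adjoin fst_ufunct clinear_simps[OF clinear_ufunct] uproj_simps
      clinear_simps[OF graded_map_linear[OF f]])

text \<open>Naturality: a map that intertwines the data of two operators induces a map that intertwines
  the operators.\<close>

lemma ufunct_uder:
  assumes \<delta>: "graded_map k \<delta>" and \<delta>': "graded_map k \<delta>'" and "\<And>x. f (\<delta> x) = \<delta>' (f x)" and "w' = f w"
  shows "ufunct f (uder k \<delta> w y) = uder k \<delta>' w' (ufunct f y)"
  by (induction y rule: unital_sym_induct)
    (simp_all add: assms uder_unit[OF \<delta>] uder_unit[OF \<delta>'] uder_adjoin[OF \<delta>] uder_adjoin[OF \<delta>'] ufunct_unit
      ufunct_adjoin clinear_simps[OF clinear_ufunct] uder_simps[OF \<delta>] uder_simps[OF \<delta>'] graded_map_twist[OF f])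

lemma coalgebra_map_of_linear_part: "coalgebra_map_of (linear_part f) = reduce (ufunct f)"
proof (rule coalgebra_map_of_eqI)
  show "coalgebra_map (reduce (ufunct f))"
    by (rule coalgebra_map_reduce[OF unital_coalgebra_map_ufunct])
  show "sym_proj (reduce (ufunct f) (\<Odot> xs)) = linear_part f xs" if "xs \<noteq> []" for xs
  proof -
    have "(0, \<Odot> xs) = adjoin_list xs" using that by (simp add: adjoin_list_eq)
    then show ?thesis
      by (simp add: sym_proj_reduce uproj_ufunct uproj_adjoin_list linear_part_def
          clinear_0[OF graded_map_linear[OF f]])
  qed
qed

end

lemma coderivation_of_linear_part:
  assumes \<delta>: "graded_map 1 \<delta>"
  shows "coderivation_of (linear_part \<delta>) = reduce (uder 1 \<delta> 0)"
proof (rule coderivation_of_eqI)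
  show "coderivation (reduce (uder 1 \<delta> 0))" by (rule coderivation_reduce_uder[OF \<delta>])
  show "sym_proj (reduce (uder 1 \<delta> 0) (\<Odot> xs)) = linear_part \<delta> xs" if "xs \<noteq> []" for xs
  proof -
    have "(0, \<Odot> xs) = adjoin_list xs" using that by (simp add: adjoin_list_eq)
    then show ?thesis
      by (simp add: sym_proj_reduce uproj_uder[OF \<delta>] uproj_adjoin_list linear_part_def
          clinear_0[OF graded_map_linear[OF \<delta>]])
  qed
qed

section \<open>The cumulant map\<close>

definition graded_algebra :: "('a::graded_space \<Rightarrow> 'a \<Rightarrow> 'a) \<Rightarrow> bool" where
  "graded_algebra m \<longleftrightarrow> cbilinear m \<and>
    (\<forall>p q. \<forall>x\<in>gcomp p. \<forall>y\<in>gcomp q. m x y \<in> gcomp (p + q) \<and> m x y = parity_sign (p * q) *\<^sub>C m y x) \<and>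
    (\<forall>x y z. m (m x y) z = m x (m y z))"

text \<open>The operator \<open>y \<mapsto> x \<odot> y + \<Sum> \<plusminus> y\<^sub>1 \<odot> \<cdots> \<odot> x y\<^sub>i \<odot> \<cdots> \<odot> y\<^sub>n\<close>. Applied to the sum over the
  partitions of a word it extends every partition by the new element \<open>x\<close>, either as a block of
  its own or inside an existing block, and so produces the sum over the partitions of the word
  with \<open>x\<close> in front. The homogeneous part \<open>gpart p x\<close> stands in place of \<open>x\<close> because \<open>uder p\<close>
  is an operator with good properties only for data of degree \<open>p\<close>.\<close>

definition mult_action :: "('a \<Rightarrow> 'a \<Rightarrow> 'a) \<Rightarrow> 'a::graded_space \<Rightarrow> 'a unital_sym \<Rightarrow> 'a unital_sym" where
  "mult_action m x y = hext (\<lambda>p x. uder p (m (gpart p x)) (gpart p x) y) x"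

definition ucumulant :: "('a \<Rightarrow> 'a \<Rightarrow> 'a) \<Rightarrow> 'a::graded_space unital_sym \<Rightarrow> 'a unital_sym" where
  "ucumulant m = ulift (mult_action m) \<one>"

text \<open>The filtration by length, for which the cumulant map is unipotent.\<close>

definition words :: "nat \<Rightarrow> 'a::graded_space unital_sym set" where
  "words n = complex_space.span {adjoin_list xs |xs. length xs \<le> n}"

lemma words_mono: "n \<le> k \<Longrightarrow> words n \<subseteq> words k"
  unfolding words_def by (rule complex_space.span_mono) auto

lemma adjoin_list_words: "length xs \<le> n \<Longrightarrow> adjoin_list xs \<in> words n"
  unfolding words_def by (rule complex_space.span_base) auto

lemma words_add: "y \<in> words n \<Longrightarrow> z \<in> words n \<Longrightarrow> y + z \<in> words n"
  and words_scale: "y \<in> words n \<Longrightarrow> c *\<^sub>C y \<in> words n"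
  and words_0: "0 \<in> words n"
  unfolding words_def
  by (auto intro: complex_space.span_add complex_space.span_diff complex_space.span_scale complex_space.span_zero)

lemma words_induct [consumes 1, case_names word add scale]:
  assumes "y \<in> words n" "\<And>xs. length xs \<le> n \<Longrightarrow> P (adjoin_list xs)"
    "\<And>y z. P y \<Longrightarrow> P z \<Longrightarrow> P (y + z)" "\<And>c y. P y \<Longrightarrow> P (c *\<^sub>C y)"
  shows "P y"
  using assms(1) unfolding words_def
proof (induction rule: complex_space.span_induct_alt)
  case base
  show ?case using assms(4)[OF assms(2)[of "[]"], of 0] by simp
next
  case (step c x y)
  then obtain xs where "x = adjoin_list xs" "length xs \<le> n" by blast
  then show ?case by (auto intro!: assms(3)[OF assms(4)[OF assms(2)] step(2)])
qed

lemma adjoin_words: "y \<in> words n \<Longrightarrow> x \<odot> y \<in> words (Suc n)"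
proof (induction rule: words_induct)
  case (word xs)
  then show ?case using adjoin_list_words[of "x # xs"] by simp
qed (auto simp: adjoin_simps intro: words_add words_scale)

lemma in_words: "\<exists>n. y \<in> words n"
proof (induction y rule: unital_sym_induct_list)
  case (1 xs)
  show ?case using adjoin_list_words by blast
next
  case (2 y z)
  then obtain i j where "y \<in> words i" "z \<in> words j" by blast
  then have "y + z \<in> words (max i j)"
    using words_mono[of i "max i j"] words_mono[of j "max i j"] by (intro words_add) auto
  then show ?case ..
qed (blast intro: words_scale)

context
  fixes m :: "'a::graded_space \<Rightarrow> 'a \<Rightarrow> 'a"
  assumes m: "graded_algebra m"
begin

lemma cbilinear_mult: "cbilinear m"
  and mult_gcomp: "x \<in> gcomp p \<Longrightarrow> y \<in> gcomp q \<Longrightarrow> m x y \<in> gcomp (p + q)"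
  and mult_commute: "x \<in> gcomp p \<Longrightarrow> y \<in> gcomp q \<Longrightarrow> m x y = parity_sign (p * q) *\<^sub>C m y x"
  and mult_assoc: "m (m x y) z = m x (m y z)"
  using m unfolding graded_algebra_def by blast+

lemmas mult_simps = cbilinear_simps[OF cbilinear_mult]

lemma graded_map_mult: "x \<in> gcomp p \<Longrightarrow> graded_map p (m x)"
  by (rule graded_mapI[OF cbilinear_right[OF cbilinear_mult]])
    (metis mult_gcomp add.commute)

lemma cbilinear_uder_mult: "cbilinear (\<lambda>x. uder p (m (gpart p x)) (gpart p x))"
proof (rule cbilinearI)
  note D = graded_map_mult[OF gpart_in_gcomp]
  show "clinear (uder p (m (gpart p x)) (gpart p x))" for x
    by (rule clinear_uder[OF D])
  show "clinear (\<lambda>x. uder p (m (gpart p x)) (gpart p x) y)" for y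
    by (induction y rule: unital_sym_induct)
       (auto simp: uder_unit[OF D] uder_adjoin[OF D] uder_simps[OF D]
         intro!: clinear_intros clinear_gpart' clinear_bil_left[OF cbilinear_mult])
qed

lemma mult_action_homogeneous: "x \<in> gcomp p \<Longrightarrow> mult_action m x y = uder p (m x) x y"
  unfolding mult_action_def
  by (subst hext_homogeneous[OF cbilinear_left[OF cbilinear_uder_mult]]) (auto simp: gcomp_iff)

text \<open>Associativity and commutativity say that multiplication by \<open>x\<close> and by \<open>y\<close> commute up to sign,
  and that each sends the initial vector of the other to the same product.\<close>

lemma gcommuting_mult_action: "gcommuting (mult_action m)"
proof (rule gcommutingI)
  show "cbilinear (mult_action m)"
    unfolding mult_action_def by (rule cbilinear_hext[OF cbilinear_uder_mult])
  fix p q and x y :: 'a and z :: "'a unital_sym" assume x: "x \<in> gcomp p" and y: "y \<in> gcomp q"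
  have "m x (m y v) = 0 + parity_sign (p * q) *\<^sub>C m y (m x v)" for v
    using mult_commute[OF x y] by (simp add: mult_simps flip: mult_assoc)
  moreover have "m x y = 0 + parity_sign (p * q) *\<^sub>C m y x"
    using mult_commute[OF x y] by simp
  ultimately have "uder p (m x) x (uder q (m y) y z) =
      uder (p + q) (\<lambda>_. 0) 0 z + parity_sign (p * q) *\<^sub>C uder q (m y) y (uder p (m x) x z)"
    by (intro uder_bracket graded_map_mult graded_map_zero x y)
  then show "mult_action m x (mult_action m y z) = parity_sign (p * q) *\<^sub>C mult_action m y (mult_action m x z)"
    by (simp add: mult_action_homogeneous[OF x] mult_action_homogeneous[OF y]
        uder_zero_derivation[OF gcomp_0] adjoin_simps)
qed

lemma clinear_ucumulant: "clinear (ucumulant m)"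
  and ucumulant_unit: "ucumulant m \<one> = \<one>"
  and ucumulant_adjoin': "ucumulant m (x \<odot> y) = mult_action m x (ucumulant m y)"
  by (simp_all add: ucumulant_def clinear_ulift ulift_unit ulift_adjoin gcommuting_mult_action)

lemma ucumulant_adjoin: "x \<in> gcomp p \<Longrightarrow> ucumulant m (x \<odot> y) = uder p (m x) x (ucumulant m y)"
  by (simp add: ucumulant_adjoin' mult_action_homogeneous)

lemmas ucumulant_simps = clinear_simps[OF clinear_ucumulant]

lemma unital_coalgebra_map_ucumulant: "unital_coalgebra_map (ucumulant m)"
  by (rule unital_coalgebra_mapI[where \<delta> = "\<lambda>p x. m x" and w = "\<lambda>p x. x"])
    (auto intro: clinear_ucumulant ucumulant_unit graded_map_mult ucumulant_adjoin)

lemma fst_ucumulant: "fst (ucumulant m y) = fst y"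
  using unital_coalgebra_map_ucumulant unfolding unital_coalgebra_map_def by blast

lemma graded_map_ucumulant: "graded_map 0 (ucumulant m)"
  using unital_coalgebra_map_ucumulant unfolding unital_coalgebra_map_def by blast

lemma uproj_ucumulant_adjoin: "uproj (ucumulant m (x \<odot> y)) = m x (uproj (ucumulant m y)) + fst y *\<^sub>C x"
proof (rule graded_eqI[where x = x and f = "\<lambda>x. uproj (ucumulant m (x \<odot> y))"])
  show "uproj (ucumulant m (x \<odot> y)) = m x (uproj (ucumulant m y)) + fst y *\<^sub>C x" if "x \<in> gcomp p" for p and x :: 'a
    by (simp add: ucumulant_adjoin[OF that] uproj_uder[OF graded_map_mult[OF that]] fst_ucumulant)
qed (intro clinear_compose[OF clinear_uproj] clinear_compose[OF clinear_ucumulant] clinear_intros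
    clinear_bil_left[OF cbilinear_mult])+

lemma foldl_mult: "foldl m (m x y) zs = m x (foldl m y zs)"
  by (induction zs arbitrary: y) (simp_all add: mult_assoc)

lemma list_mult_Cons: "xs \<noteq> [] \<Longrightarrow> list_mult m (x # xs) = m x (list_mult m xs)"
  by (cases xs) (simp_all add: list_mult_def foldl_mult)

lemma uproj_ucumulant: "xs \<noteq> [] \<Longrightarrow> uproj (ucumulant m (adjoin_list xs)) = list_mult m xs"
proof (induction xs)
  case (Cons x xs)
  show ?case
  proof (cases "xs = []")
    case True
    then show ?thesis by (simp add: uproj_ucumulant_adjoin ucumulant_unit mult_simps list_mult_def)
  next
    case False
    then have "fst (adjoin_list xs) = 0" by (simp add: adjoin_list_eq)
    then show ?thesis using False Cons.IH by (simp add: uproj_ucumulant_adjoin list_mult_Cons)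
  qed
qed simp

lemma cumulant_map_eq: "cumulant_map m = reduce (ucumulant m)"
  unfolding cumulant_map_def
proof (rule coalgebra_map_of_eqI)
  show "coalgebra_map (reduce (ucumulant m))"
    by (rule coalgebra_map_reduce[OF unital_coalgebra_map_ucumulant])
  show "sym_proj (reduce (ucumulant m) (\<Odot> xs)) = list_mult m xs" if "xs \<noteq> []" for xs
    using that uproj_ucumulant[OF that] by (simp add: sym_proj_reduce adjoin_list_eq)
qed

text \<open>Multiplying a letter by \<open>x\<close> does not change the length, so the leading part of the operator
  is \<open>x \<odot> _\<close>.\<close>

lemma mult_action_words: "mult_action m x (adjoin_list ys) - x \<odot> adjoin_list ys \<in> words (length ys)"
proof (induction x rule: graded_induct)
  case (1 p x)
  note D = graded_map_mult[OF 1]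
  show ?case
  proof (induction ys)
    case Nil
    show ?case by (simp add: mult_action_homogeneous[OF 1] uder_unit[OF D] words_0)
  next
    case (Cons v ys)
    have "x \<odot> v \<odot> y = twist p v \<odot> x \<odot> y" for y
      by (rule graded_eqI[where x = v and f = "\<lambda>v. x \<odot> v \<odot> y"])
         (auto intro!: clinear_intros simp: twist_homogeneous adjoin_simps intro: adjoin_commute[OF 1])
    then have "mult_action m x (adjoin_list (v # ys)) - x \<odot> adjoin_list (v # ys) =
        adjoin_list (m x v # ys) + twist p v \<odot> (mult_action m x (adjoin_list ys) - x \<odot> adjoin_list ys)"
      by (simp add: mult_action_homogeneous[OF 1] uder_adjoin[OF D] adjoin_simps)
    also have "\<dots> \<in> words (length (v # ys))"
      using adjoin_words[OF Cons] by (intro words_add adjoin_list_words) auto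
    finally show ?case .
  qed
next
  case (2 x y)
  from words_add[OF this] show ?case
    using gcommuting_mult_action
    by (simp add: gcommuting_def cbilinear_simps adjoin_simps algebra_simps)
qed

lemma mult_action_in_words: "y \<in> words n \<Longrightarrow> mult_action m x y \<in> words (Suc n)"
proof (induction rule: words_induct)
  case (word xs)
  have "mult_action m x (adjoin_list xs) = (mult_action m x (adjoin_list xs) - x \<odot> adjoin_list xs) + adjoin_list (x # xs)"
    by simp
  also have "\<dots> \<in> words (Suc n)"
    using mult_action_words[of x xs] words_mono[of "length xs" "Suc n"] word
    by (intro words_add adjoin_list_words) auto
  finally show ?case .
qed (use gcommuting_mult_action in \<open>auto simp: gcommuting_def cbilinear_simps intro: words_add words_scale\<close>)

lemma ucumulant_unipotent_list:
  "ucumulant m (adjoin_list xs) - adjoin_list xs \<in> (if xs = [] then {0} else words (length xs - 1))"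
proof (induction xs)
  case Nil
  show ?case by (simp add: ucumulant_unit)
next
  case (Cons x xs)
  have lin: "clinear (mult_action m x)"
    using gcommuting_mult_action by (simp add: gcommuting_def cbilinear_right)
  let ?r = "ucumulant m (adjoin_list xs) - adjoin_list xs"
  have "mult_action m x ?r \<in> words (length xs)"
    using Cons mult_action_in_words[of ?r "length xs - 1"]
    by (cases "xs = []") (auto simp: clinear_0[OF lin] words_0)
  moreover have "ucumulant m (adjoin_list (x # xs)) - adjoin_list (x # xs) =
      (mult_action m x (adjoin_list xs) - x \<odot> adjoin_list xs) + mult_action m x ?r"
    by (simp add: ucumulant_adjoin' clinear_diff[OF lin])
  ultimately have "ucumulant m (adjoin_list (x # xs)) - adjoin_list (x # xs) \<in> words (length xs)"
    using mult_action_words[of x xs] words_add by metis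
  then show ?case by simp
qed

lemma ucumulant_unipotent:
  "y \<in> words (Suc n) \<Longrightarrow> ucumulant m y - y \<in> words n" "z \<in> words 0 \<Longrightarrow> ucumulant m z = z"
proof -
  show "y \<in> words (Suc n) \<Longrightarrow> ucumulant m y - y \<in> words n"
  proof (induction rule: words_induct)
    case (word xs)
    then have "length xs - 1 \<le> n" by simp
    from words_mono[OF this] show ?case using ucumulant_unipotent_list[of xs]
      by (auto split: if_splits simp: words_0)
  next
    case (add y z)
    from words_add[OF this] show ?case by (simp add: ucumulant_simps algebra_simps)
  next
    case (scale c y)
    from words_scale[OF this, of c] show ?case by (simp add: ucumulant_simps scaleC_diff_right)
  qed
  show "z \<in> words 0 \<Longrightarrow> ucumulant m z = z"
    by (induction rule: words_induct) (simp_all add: ucumulant_simps ucumulant_unit)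
qed

text \<open>The difference from the identity lowers the length, and on words of length zero there is no
  difference.\<close>

lemma bij_ucumulant: "bij (ucumulant m)"
proof (rule bijI)
  have "y \<in> words n \<Longrightarrow> ucumulant m y = 0 \<Longrightarrow> y = 0" for y n
  proof (induction n)
    case 0
    then show ?case using ucumulant_unipotent(2)[of y] by simp
  next
    case (Suc n)
    then have "- y \<in> words n" using ucumulant_unipotent(1)[OF Suc.prems(1)] by simp
    from words_scale[OF this, of "-1"] show ?case using Suc by (simp add: scaleC_minus_left)
  qed
  then have "ucumulant m y = 0 \<Longrightarrow> y = 0" for y using in_words[of y] by blast
  then show "inj (ucumulant m)"
    by (intro injI) (metis clinear_diff[OF clinear_ucumulant] eq_iff_diff_eq_0)
  have "y \<in> words n \<Longrightarrow> y \<in> range (ucumulant m)" for y n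
  proof (induction n arbitrary: y)
    case 0
    then show ?case by (metis ucumulant_unipotent(2) rangeI)
  next
    case (Suc n)
    then obtain z where "ucumulant m y - y = ucumulant m z" using ucumulant_unipotent(1) by blast
    then have "y = ucumulant m (y - z)" by (simp add: ucumulant_simps algebra_simps)
    then show ?case by blast
  qed
  then show "surj (ucumulant m)" using in_words by blast
qed

lemma bij_cumulant_map: "bij (cumulant_map m)"
  unfolding cumulant_map_eq
proof (rule bijI)
  have eq: "ucumulant m (0, y) = (0, reduce (ucumulant m) y)" for y
    by (simp add: reduce_eq fst_ucumulant)
  show "inj (reduce (ucumulant m))"
  proof (rule injI)
    fix y z assume "reduce (ucumulant m) y = reduce (ucumulant m) z"
    then have "ucumulant m (0, y) = ucumulant m (0, z)" by (simp add: eq)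
    then show "y = z" using bij_ucumulant by (auto simp: bij_def dest: injD)
  qed
  show "surj (reduce (ucumulant m))"
    unfolding surj_def
  proof
    fix z :: "'a sym"
    obtain a where a: "ucumulant m a = (0, z)" using bij_ucumulant by (metis bij_pointE)
    then have "fst a = 0" using fst_ucumulant[of a] by simp
    then have "a = (0, snd a)" by (simp add: prod_eq_iff)
    then have "reduce (ucumulant m) (snd a) = z" using a eq[of "snd a"] by (metis snd_conv)
    then show "\<exists>y. z = reduce (ucumulant m) y" by blast
  qed
qed

lemma coalgebra_map_cumulant_map: "coalgebra_map (cumulant_map m)"
  and sym_has_degree_cumulant_map: "sym_has_degree 0 (cumulant_map m)"
  unfolding cumulant_map_eq
  using coalgebra_map_reduce[OF unital_coalgebra_map_ucumulant] by simp_all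

end

lemma reduce_compose:
  assumes "\<And>y. fst (G (0, y)) = 0"
  shows "reduce F (reduce G y) = reduce (\<lambda>y. F (G y)) y"
proof -
  have "G (0, y) = (0, reduce G y)" using assms by (simp add: reduce_def prod_eq_iff)
  then show ?thesis by (simp add: reduce_def[of F] reduce_def[of "\<lambda>y. F (G y)"])
qed

text \<open>An algebra map intertwines the operators \<open>uder p (m x) x\<close> from which the cumulant maps are built.\<close>

lemma ufunct_ucumulant:
  fixes a :: "'a::graded_space \<Rightarrow> 'b::graded_space"
  assumes a: "graded_map 0 a" and m: "graded_algebra m" and m': "graded_algebra m'"
    and hom: "\<And>x y. a (m x y) = m' (a x) (a y)"
  shows "ufunct a (ucumulant m y) = ucumulant m' (ufunct a y)"
proof -
  have step: "ufunct a (ucumulant m (x \<odot> y)) = ucumulant m' (ufunct a (x \<odot> y))"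
    if x: "x \<in> gcomp p" and IH: "ufunct a (ucumulant m y) = ucumulant m' (ufunct a y)" for p x y
  proof -
    have ax: "a x \<in> gcomp p" using graded_map_gcomp[OF a x] by simp
    have "ufunct a (uder p (m x) x (ucumulant m y)) = uder p (m' (a x)) (a x) (ufunct a (ucumulant m y))"
      by (rule ufunct_uder[OF a graded_map_mult[OF m x] graded_map_mult[OF m' ax] _ refl]) (rule hom)
    then show ?thesis
      by (simp only: ucumulant_adjoin[OF m x] ufunct_adjoin[OF a] ucumulant_adjoin[OF m' ax] IH)
  qed
  have unit: "ufunct a (ucumulant m \<one>) = ucumulant m' (ufunct a \<one>)"
    by (simp only: ufunct_unit[OF a] ucumulant_unit[OF m] ucumulant_unit[OF m'])
  show ?thesis
    by (rule unital_sym_eqI[where f = "\<lambda>y. ufunct a (ucumulant m y)" and g = "\<lambda>y. ucumulant m' (ufunct a y)",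
          OF clinear_compose[OF clinear_ufunct[OF a] clinear_ucumulant[OF m]]
            clinear_compose[OF clinear_ucumulant[OF m'] clinear_ufunct[OF a]] unit step])
qed

section \<open>Existence of maps with given components\<close>

lemma
  assumes "unital_coalgebra_map F"
  shows unital_coalgebra_map_graded: "graded_map 0 F"
    and unital_coalgebra_map_unit: "F \<one> = \<one>"
    and unital_coalgebra_map_fst: "fst (F y) = fst y"
    and unital_coalgebra_map_ucoprod: "ucoprod (F y) = tensor_map F F (ucoprod y)"
  using assms unfolding unital_coalgebra_map_def by blast+

lemma unital_coalgebra_map_compose:
  assumes F: "unital_coalgebra_map F" and G: "unital_coalgebra_map G"
  shows "unital_coalgebra_map (\<lambda>y. F (G y))"
proof -
  note g = unital_coalgebra_map_graded[OF F] unital_coalgebra_map_graded[OF G]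
  note lin = graded_map_linear[OF g(1)] graded_map_linear[OF g(2)]
  have "graded_map 0 (\<lambda>y. F (G y))"
    using graded_map_gcomp[OF g(1) graded_map_gcomp[OF g(2)]]
    by (intro graded_mapI clinear_compose[OF lin]) simp
  then show ?thesis
    unfolding unital_coalgebra_map_def
    by (intro conjI allI)
       (simp_all only: unital_coalgebra_map_unit[OF F] unital_coalgebra_map_unit[OF G]
         unital_coalgebra_map_fst[OF F] unital_coalgebra_map_fst[OF G] unital_coalgebra_map_ucoprod[OF F]
         unital_coalgebra_map_ucoprod[OF G] tensor_map_compose[OF lin(1) lin(1) lin(2) lin(2)])
qed

lemma graded_algebra_umul: "graded_algebra umul"
  unfolding graded_algebra_def
  using has_degreeD[OF umul_degree] umul_commute
  by (auto simp: cbilinear_umul umul_assoc add.commute) blast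

text \<open>A coalgebra map \<open>SU \<rightarrow> SW\<close> with components \<open>f\<close>, without any sum over partitions: the cumulant
  map of the algebra \<open>A = \<complex> \<oplus> SU\<close>, restricted to words in \<open>U\<close>, is a coalgebra map \<open>SU \<rightarrow> SA\<close>
  whose components are the products of the letters in \<open>A\<close>, that is, the inclusion of \<open>SU\<close>.
  Composing with \<open>S(f)\<close> gives the components \<open>f\<close>.\<close>

definition cofree_lift :: "('u::graded_space sym \<Rightarrow> 'w::graded_space) \<Rightarrow> 'u unital_sym \<Rightarrow> 'w unital_sym" where
  "cofree_lift f = (\<lambda>y. ufunct (\<lambda>a. f (snd a)) (ucumulant umul (ufunct (\<lambda>x. x \<odot> \<one>) y)))"

lemma graded_map_singleton: "graded_map 0 (\<lambda>x. x \<odot> \<one>)"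
proof (rule graded_mapI)
  show "x \<odot> \<one> \<in> gcomp (p + 0)" if "x \<in> gcomp p" for p and x :: 'a
    using has_degreeD[OF has_degree_adjoin[OF that] unit_sym_gcomp] by simp
qed (intro clinear_intros)

context
  fixes f :: "'u::graded_space sym \<Rightarrow> 'w::graded_space"
  assumes f: "graded_map 0 f"
begin

lemma graded_map_cofree: "graded_map 0 (\<lambda>a :: 'u unital_sym. f (snd a))"
proof (rule graded_mapI)
  show "clinear (\<lambda>a :: 'u unital_sym. f (snd a))"
    by (rule clinear_compose[OF graded_map_linear[OF f] clinear_snd'])
  show "f (snd a) \<in> gcomp (p + 0)" if "a \<in> gcomp p" for p and a :: "'u unital_sym"
  proof -
    have "snd a \<in> gcomp p" using that by (simp add: gcomp_iff gpart_prod_def prod_eq_iff)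
    from graded_map_gcomp[OF f this] show ?thesis .
  qed
qed

lemma unital_coalgebra_map_cofree_lift: "unital_coalgebra_map (cofree_lift f)"
  unfolding cofree_lift_def
  by (rule unital_coalgebra_map_compose[OF unital_coalgebra_map_ufunct[OF graded_map_cofree]
        unital_coalgebra_map_compose[OF unital_coalgebra_map_ucumulant[OF graded_algebra_umul]
          unital_coalgebra_map_ufunct[OF graded_map_singleton]]])

lemma uproj_cofree_lift: "uproj (cofree_lift f y) = f (snd y)"
proof -
  note A = graded_algebra_umul and S = graded_map_singleton
  have "uproj (ucumulant umul (ufunct (\<lambda>x. x \<odot> \<one>) y)) = y - fst y *\<^sub>C \<one>" for y :: "'u unital_sym"
    by (induction y rule: unital_sym_induct)
       (simp_all add: ufunct_unit[OF S] ucumulant_unit[OF A] ufunct_adjoin[OF S] uproj_ucumulant_adjoin[OF A]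
         fst_ufunct[OF S] umul_adjoin clinear_simps[OF clinear_ufunct[OF S]] ucumulant_simps[OF A] uproj_simps
         adjoin_simps scaleC_add_left scaleC_diff_right scaleC_complex_def)
  then show ?thesis by (simp add: cofree_lift_def uproj_ufunct[OF graded_map_cofree])
qed

text \<open>If \<open>\<delta>\<close> kills the components, then \<open>f\<close> intertwines the zero derivation with \<open>\<delta>\<close>.\<close>

lemma uder_cofree_lift:
  assumes \<delta>: "graded_map k \<delta>" and "\<And>y. \<delta> (f y) = 0"
  shows "uder k \<delta> 0 (cofree_lift f y) = 0"
proof -
  have "ufunct (\<lambda>a. f (snd a)) (uder k (\<lambda>_. 0) 0 z) = uder k \<delta> 0 (ufunct (\<lambda>a. f (snd a)) z)" for z :: "'u unital_sym unital_sym"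
    by (rule ufunct_uder[OF graded_map_cofree graded_map_zero \<delta>])
       (simp_all add: assms(2) clinear_0[OF graded_map_linear[OF f]])
  then show ?thesis
    by (simp add: cofree_lift_def uder_zero_derivation[OF gcomp_0] adjoin_simps
        clinear_0[OF clinear_ufunct[OF graded_map_cofree]] flip: \<open>\<And>z. _ = uder k \<delta> 0 _\<close>)
qed

end

section \<open>Transport along coalgebra automorphisms\<close>

lemma clinear_inv: "clinear F \<Longrightarrow> bij F \<Longrightarrow> clinear (inv F)"
  by (rule clinearI) (metis bij_inv_eq_iff clinear_add, metis bij_inv_eq_iff clinear_scale)

lemma coalgebra_map_coprod: "coalgebra_map F \<Longrightarrow> coprod (F y) = tensor_map F F (coprod y)"
  unfolding coalgebra_map_def o_def by metis

lemma coderivation_linear: "coderivation D \<Longrightarrow> clinear D"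
  and coderivation_coprod: "coderivation D \<Longrightarrow> coprod (D y) = leibniz D (coprod y)"
  and coderivation_degree: "coderivation D \<Longrightarrow> has_degree 1 D"
  unfolding coderivation_def sym_has_degree_iff o_def by metis+

lemma coalgebra_map_inv:
  assumes F: "coalgebra_map F" "bij F"
  shows "coalgebra_map (inv F)"
proof -
  note lF = clinear_coalgebra_map[OF F(1)]
  note lG = clinear_inv[OF lF F(2)]
  have FG: "F (inv F y) = y" and GF: "inv F (F z) = z" for y z
    using F(2) by (simp_all add: bij_is_surj surj_f_inv_f bij_is_inj)
  have "coprod (inv F y) = tensor_map (inv F) (inv F) (coprod y)" for y
  proof -
    have "coprod y = tensor_map F F (coprod (inv F y))"
      using coalgebra_map_coprod[OF F(1), of "inv F y"] by (simp only: FG)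
    then show ?thesis
      by (simp only: tensor_map_compose[OF lG lG lF lF] GF tensor_map_id)
  qed
  then show ?thesis by (simp add: coalgebra_map_def lG fun_eq_iff)
qed

lemma coalgebra_map_compose:
  assumes F: "coalgebra_map F" and G: "coalgebra_map G"
  shows "coalgebra_map (F \<circ> G)"
proof -
  note lin = clinear_coalgebra_map[OF F] clinear_coalgebra_map[OF G]
  have "coprod (F (G y)) = tensor_map (\<lambda>y. F (G y)) (\<lambda>y. F (G y)) (coprod y)" for y
    by (simp only: coalgebra_map_coprod[OF F] coalgebra_map_coprod[OF G]
        tensor_map_compose[OF lin(1) lin(1) lin(2) lin(2)])
  then show ?thesis
    using clinear_compose[OF lin] by (simp add: coalgebra_map_def fun_eq_iff o_def)
qed

lemma has_degree_inv:
  assumes F: "clinear F" "has_degree 0 F" "bij F"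
  shows "has_degree 0 (inv F)"
proof (rule has_degreeI)
  fix p y
  have "F (gpart p (inv F y)) = gpart p y"
    using degree_gpart[OF F(1,2), of p "inv F y"] F(3) by (simp add: bij_is_surj surj_f_inv_f)
  then show "gpart (p + 0) (inv F y) = inv F (gpart p y)"
    using F(3) by (metis add_0_right bij_inv_eq_iff)
qed

lemma has_degree_compose: "has_degree k F \<Longrightarrow> has_degree l G \<Longrightarrow> has_degree (k + l) (F \<circ> G)"
  by (force simp: has_degree_def image_subset_iff algebra_simps)

lemma coderivation_conjugate:
  assumes F: "coalgebra_map F" "sym_has_degree 0 F" "bij F" and D: "coderivation D"
  shows "coderivation (inv F \<circ> D \<circ> F)"
proof -
  note lF = clinear_coalgebra_map[OF F(1)] and lD = coderivation_linear[OF D]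
  note lG = clinear_inv[OF lF F(3)]
  let ?E = "inv F \<circ> D \<circ> F"
  have lE: "clinear ?E"
    unfolding o_def by (intro clinear_compose[OF lG] clinear_compose[OF lD] lF)
  have hG: "has_degree 0 (inv F)" using F lF by (intro has_degree_inv) (auto simp: sym_has_degree_iff)
  have FG: "F (inv F y) = y" and GF: "inv F (F z) = z" for y z
    using F(3) by (simp_all add: bij_is_surj surj_f_inv_f bij_is_inj)
  have "tensor_map (inv F) (inv F) (leibniz D t) = leibniz ?E (tensor_map (inv F) (inv F) t)" for t
  proof (rule tensor_eqI[where t = t and f = "\<lambda>t. tensor_map (inv F) (inv F) (leibniz D t)"
        and g = "\<lambda>t. leibniz ?E (tensor_map (inv F) (inv F) t)"])
    show "tensor_map (inv F) (inv F) (leibniz D (x \<otimes> y)) = leibniz ?E (tensor_map (inv F) (inv F) (x \<otimes> y))" for x y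
      by (simp add: leibniz_tens[OF lD] leibniz_tens[OF lE] tensor_map_tens[OF lG lG]
          clinear_add[OF clinear_tensor_map[OF lG lG]] FG twist_map_0[OF lG hG])
  qed (rule clinear_compose[OF clinear_tensor_map[OF lG lG] clinear_leibniz[OF lD]]
      clinear_compose[OF clinear_leibniz[OF lE] clinear_tensor_map[OF lG lG]])+
  then have *: "tensor_map (inv F) (inv F) (leibniz D (tensor_map F F t)) = leibniz ?E t" for t
    by (simp only: tensor_map_compose[OF lG lG lF lF] GF tensor_map_id)
  have "coprod (?E y) = leibniz ?E (coprod y)" for y
    by (simp only: o_apply coalgebra_map_coprod[OF coalgebra_map_inv[OF F(1,3)]] coderivation_coprod[OF D]
        coalgebra_map_coprod[OF F(1)] *)
  moreover have "has_degree (0 + 1 + 0) ?E"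
    using F(2) coderivation_degree[OF D] hG by (intro has_degree_compose) (simp_all add: sym_has_degree_iff)
  ultimately show ?thesis
    using lE by (simp add: coderivation_def sym_has_degree_iff fun_eq_iff)
qed

section \<open>Polynomial differential forms\<close>

lemma forms_eq_iff: "x = y \<longleftrightarrow> (\<forall>i. coeff (fun_part x) i = coeff (fun_part y) i) \<and>
    (\<forall>i. coeff (dt_part x) i = coeff (dt_part y) i)"
  by (cases x; cases y) (simp add: poly_eq_iff)

lemma form_parts_simps [simp]:
  "fun_part (0 :: 'a::ab_group_add forms) = 0" "dt_part (0 :: 'a::ab_group_add forms) = 0"
  "fun_part (x + y :: 'a::ab_group_add forms) = fun_part x + fun_part y"
  "dt_part (x + y :: 'a::ab_group_add forms) = dt_part x + dt_part y"
  "fun_part (- x) = - fun_part x" "dt_part (- x) = - dt_part x"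
  by (simp_all add: zero_forms_def plus_forms_def uminus_forms_def)

lemma form_parts_graded [simp]:
  "coeff (fun_part (c *\<^sub>C x)) i = c *\<^sub>C coeff (fun_part (x :: 'a::graded_space forms)) i"
  "coeff (dt_part (c *\<^sub>C x)) i = c *\<^sub>C coeff (dt_part (x :: 'a::graded_space forms)) i"
  "coeff (fun_part (gpart p x)) i = gpart p (coeff (fun_part x) i)"
  "coeff (dt_part (gpart p x)) i = gpart (p - 1) (coeff (dt_part x) i)"
  "coeff (fun_part (form_tensor v \<omega>)) i = coeff (fun_part \<omega>) i *\<^sub>C (v :: 'a::graded_space)"
  "coeff (dt_part (form_tensor v \<omega>)) i = coeff (dt_part \<omega>) i *\<^sub>C v"
  by (simp_all add: scaleC_forms_def gpart_forms_def form_tensor_def coeff_map_poly)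

lemma form_parts_sum:
  "fun_part (\<Sum>i\<in>I. f i :: 'a::ab_group_add forms) = (\<Sum>i\<in>I. fun_part (f i))"
  "dt_part (\<Sum>i\<in>I. f i :: 'a::ab_group_add forms) = (\<Sum>i\<in>I. dt_part (f i))"
  by (induction I rule: infinite_finite_induct) simp_all

lemma cbilinear_form_tensor: "cbilinear form_tensor"
  by (intro cbilinearI clinearI) (simp_all add: forms_eq_iff scaleC_add_left scaleC_add_right scaleC_complex_def mult.commute)

lemmas form_tensor_simps = cbilinear_simps[OF cbilinear_form_tensor]

lemma clinear_form_tensor_left [clinear_intros]: "clinear f \<Longrightarrow> clinear (\<lambda>x. form_tensor (f x) \<omega>)"
  and clinear_form_tensor_right [clinear_intros]: "clinear g \<Longrightarrow> clinear (\<lambda>x. form_tensor v (g x))"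
  using cbilinear_form_tensor by (auto intro: clinear_bil_left clinear_bil_right)

definition poly_sum :: "(nat \<Rightarrow> 'a::zero \<Rightarrow> 'b::comm_monoid_add) \<Rightarrow> 'a poly \<Rightarrow> 'b" where
  "poly_sum g p = (\<Sum>i\<le>degree p. g i (coeff p i))"

lemma poly_sum_bound:
  assumes "\<And>i. g i 0 = 0" "degree p \<le> N"
  shows "poly_sum g p = (\<Sum>i\<le>N. g i (coeff p i))"
  unfolding poly_sum_def
  by (rule sum.mono_neutral_left) (use assms in \<open>auto simp: coeff_eq_0\<close>)

lemma poly_sum_add:
  assumes "\<And>i. clinear (g i)"
  shows "poly_sum g (p + q) = poly_sum g p + poly_sum g q"
proof -
  let ?N = "max (degree p) (degree q)"
  note b = poly_sum_bound[where g = g and N = ?N, OF clinear_0[OF assms]]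
  have "poly_sum g (p + q) = (\<Sum>i\<le>?N. g i (coeff (p + q) i))"
    by (rule b) (rule degree_add_le_max)
  also have "\<dots> = poly_sum g p + poly_sum g q"
    by (subst (1 2) b) (simp_all add: clinear_add[OF assms] sum.distrib)
  finally show ?thesis .
qed

lemma poly_sum_scale:
  assumes "\<And>i. clinear (g i)"
  shows "poly_sum g (map_poly (scaleC c) p) = c *\<^sub>C poly_sum g p"
proof -
  have "poly_sum g (map_poly (scaleC c) p) = (\<Sum>i\<le>degree p. g i (coeff (map_poly (scaleC c) p) i))"
    by (rule poly_sum_bound) (simp_all add: clinear_0[OF assms] map_poly_degree_leq)
  then show ?thesis
    by (simp add: coeff_map_poly clinear_scale[OF assms] poly_sum_def scaleC_sum_right)
qed

text \<open>The universal property of \<open>V \<otimes> \<complex>[t,dt]\<close>, in terms of the basis \<open>t\<^sup>i\<close>, \<open>t\<^sup>i dt\<close> of \<open>\<complex>[t,dt]\<close>.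
  It allows all further constructions to be specified on forms \<open>v \<otimes> \<omega>\<close>.\<close>

definition form_lift :: "('a::graded_space \<Rightarrow> complex forms \<Rightarrow> 'b::complex_space) \<Rightarrow> 'a forms \<Rightarrow> 'b" where
  "form_lift \<beta> x = poly_sum (\<lambda>i v. \<beta> v (Forms (monom 1 i) 0)) (fun_part x)
    + poly_sum (\<lambda>i v. \<beta> v (Forms 0 (monom 1 i))) (dt_part x)"

lemma clinear_form_lift:
  assumes "cbilinear \<beta>"
  shows "clinear (form_lift \<beta>)"
  by (rule clinearI)
    (simp_all add: form_lift_def poly_sum_add cbilinear_left[OF assms] scaleC_forms_def poly_sum_scale scaleC_add_right)

lemma complex_form_expand:
  "(\<omega> :: complex forms) = (\<Sum>i\<le>degree (fun_part \<omega>). coeff (fun_part \<omega>) i *\<^sub>C Forms (monom 1 i) 0)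
    + (\<Sum>i\<le>degree (dt_part \<omega>). coeff (dt_part \<omega>) i *\<^sub>C Forms 0 (monom 1 i))"
  by (simp add: forms_eq_iff form_parts_sum coeff_sum scaleC_complex_def if_distrib coeff_eq_0 not_le cong: if_cong)

lemma form_lift_tensor:
  assumes "cbilinear \<beta>"
  shows "form_lift \<beta> (form_tensor v \<omega>) = \<beta> v \<omega>"
proof -
  note l = cbilinear_simps[OF assms]
  have "form_lift \<beta> (form_tensor v \<omega>) =
      (\<Sum>i\<le>degree (fun_part \<omega>). \<beta> (coeff (fun_part \<omega>) i *\<^sub>C v) (Forms (monom 1 i) 0))
    + (\<Sum>i\<le>degree (dt_part \<omega>). \<beta> (coeff (dt_part \<omega>) i *\<^sub>C v) (Forms 0 (monom 1 i)))"
    unfolding form_lift_def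
    by (subst poly_sum_bound[where N = "degree (fun_part \<omega>)"], simp add: l,
        simp add: form_tensor_def map_poly_degree_leq,
        subst poly_sum_bound[where N = "degree (dt_part \<omega>)"], simp add: l,
        simp add: form_tensor_def map_poly_degree_leq) simp
  also have "\<dots> = \<beta> v ((\<Sum>i\<le>degree (fun_part \<omega>). coeff (fun_part \<omega>) i *\<^sub>C Forms (monom 1 i) 0)
    + (\<Sum>i\<le>degree (dt_part \<omega>). coeff (dt_part \<omega>) i *\<^sub>C Forms 0 (monom 1 i)))"
    by (simp add: l)
  also have "\<dots> = \<beta> v \<omega>" by (simp flip: complex_form_expand)
  finally show ?thesis .
qed

lemma form_gcomp_monom:
  "(Forms (monom 1 i) 0 :: complex forms) \<in> gcomp 0" "(Forms 0 (monom 1 i) :: complex forms) \<in> gcomp 1"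
  by (simp_all add: gcomp_iff forms_eq_iff gpart_complex_def)

lemma form_lift_form_tensor: "form_lift form_tensor x = x"
proof -
  have "(if a then 1 else 0 :: complex) *\<^sub>C v = (if a then v else 0)" for a and v :: 'a by simp
  then show ?thesis
    by (simp add: forms_eq_iff form_lift_def poly_sum_def form_parts_sum coeff_sum coeff_eq_0 not_le)
qed

text \<open>The forms \<open>v \<otimes> \<omega>\<close> with \<open>\<omega>\<close> homogeneous generate \<open>V \<otimes> \<complex>[t,dt]\<close>, so that linear identities can
  be checked on them.\<close>

lemma forms_induct [case_names tensor add]:
  assumes tensor: "\<And>v q \<omega>. \<omega> \<in> gcomp q \<Longrightarrow> P (form_tensor v \<omega>)" and add: "\<And>x y. P x \<Longrightarrow> P y \<Longrightarrow> P (x + y)"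
  shows "P x"
proof -
  have zero: "P 0" using tensor[OF gcomp_0, of 0] by (simp add: form_tensor_simps)
  have sum: "P (\<Sum>i\<in>I. f i)" if "finite I" "\<And>i. P (f i)"
    for I :: "nat set" and f :: "nat \<Rightarrow> 'a forms"
    using that(1) by (induction I rule: finite_induct) (auto intro: add zero that(2))
  have "P (form_lift form_tensor x)"
    unfolding form_lift_def poly_sum_def
    by (intro add sum finite_atMost tensor[OF form_gcomp_monom(1)] tensor[OF form_gcomp_monom(2)])
  then show ?thesis by (simp add: form_lift_form_tensor)
qed

lemma forms_eqI:
  assumes "clinear f" "clinear g" "\<And>v q \<omega>. \<omega> \<in> gcomp q \<Longrightarrow> f (form_tensor v \<omega>) = g (form_tensor v \<omega>)"
  shows "f x = g x"
  by (induction x rule: forms_induct) (simp_all add: assms(3) clinear_add[OF assms(1)] clinear_add[OF assms(2)])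

lemma gpart_form_tensor:
  assumes "\<omega> \<in> gcomp q"
  shows "gpart p (form_tensor v \<omega>) = form_tensor (gpart (p - q) v) \<omega>"
proof -
  have "coeff (fun_part (gpart q \<omega>)) i = coeff (fun_part \<omega>) i" "coeff (dt_part (gpart q \<omega>)) i = coeff (dt_part \<omega>) i" for i
    using assms by (simp_all add: gcomp_iff)
  then have "q \<noteq> 0 \<Longrightarrow> coeff (fun_part \<omega>) i = 0" "q \<noteq> 1 \<Longrightarrow> coeff (dt_part \<omega>) i = 0" for i
    by (auto simp: gpart_complex_def split: if_splits)
  then show ?thesis
    by (cases "q = 0"; cases "q = 1") (simp_all add: forms_eq_iff gpart_scaleC)
qed

lemma form_tensor_gcomp: "v \<in> gcomp p \<Longrightarrow> \<omega> \<in> gcomp q \<Longrightarrow> form_tensor v \<omega> \<in> gcomp (p + q)"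
  by (simp add: gcomp_iff[of "form_tensor v \<omega>"] gpart_form_tensor gpart_homogeneous)

lemma forms_gcomp_induct [consumes 1, case_names tensor add]:
  assumes "x \<in> gcomp p" and tensor: "\<And>v q \<omega>. v \<in> gcomp (p - q) \<Longrightarrow> \<omega> \<in> gcomp q \<Longrightarrow> P (form_tensor v \<omega>)"
    and add: "\<And>x y. P x \<Longrightarrow> P y \<Longrightarrow> P (x + y)"
  shows "P x"
proof -
  have "P (gpart p x)" for x
    by (induction x rule: forms_induct)
      (simp_all add: gpart_form_tensor gpart_add tensor[OF gpart_in_gcomp] add)
  from this[of x] show ?thesis using assms(1) by (simp add: gcomp_iff)
qed

lemma twist_form_tensor:
  assumes "\<omega> \<in> gcomp q"
  shows "twist k (form_tensor v \<omega>) = parity_sign (k * q) *\<^sub>C form_tensor (twist k v) \<omega>"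
proof (rule graded_eqI[where x = v and f = "\<lambda>v. twist k (form_tensor v \<omega>)"
      and g = "\<lambda>v. parity_sign (k * q) *\<^sub>C form_tensor (twist k v) \<omega>"])
  show "twist k (form_tensor v \<omega>) = parity_sign (k * q) *\<^sub>C form_tensor (twist k v) \<omega>" if "v \<in> gcomp p" for p v
    by (simp add: twist_homogeneous[OF form_tensor_gcomp[OF that assms]] twist_homogeneous[OF that]
        form_tensor_simps) (auto simp: parity_sign_if)
qed (intro clinear_intros)+

subsection \<open>The algebra of complex forms\<close>

lemma complex_form_gcomp:
  assumes "(\<omega> :: complex forms) \<in> gcomp q"
  obtains "q = 0" "dt_part \<omega> = 0" | "q = 1" "fun_part \<omega> = 0" | "\<omega> = 0"
proof -
  have "coeff (fun_part (gpart q \<omega>)) i = coeff (fun_part \<omega>) i" "coeff (dt_part (gpart q \<omega>)) i = coeff (dt_part \<omega>) i" for i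
    using assms by (simp_all add: gcomp_iff)
  then have "q \<noteq> 0 \<Longrightarrow> fun_part \<omega> = 0" "q \<noteq> 1 \<Longrightarrow> dt_part \<omega> = 0"
    by (auto simp: gpart_complex_def poly_eq_iff split: if_splits)
  then show ?thesis using that by (cases "q = 0"; cases "q = 1") (auto simp: forms.expand zero_forms_def)
qed

lemma form_gcompI: "dt_part \<omega> = 0 \<Longrightarrow> (\<omega> :: complex forms) \<in> gcomp 0" "fun_part \<omega> = 0 \<Longrightarrow> \<omega> \<in> gcomp 1"
  by (simp_all add: gcomp_iff forms_eq_iff gpart_complex_def)

lemma form_mult_parts [simp]:
  "fun_part (form_mult \<omega> \<eta>) = fun_part \<omega> * fun_part \<eta>"
  "dt_part (form_mult \<omega> \<eta>) = fun_part \<omega> * dt_part \<eta> + dt_part \<omega> * fun_part \<eta>"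
  by (simp_all add: form_mult_def)

lemma complex_form_scale: "fun_part (c *\<^sub>C \<omega>) = smult c (fun_part \<omega>)" "dt_part (c *\<^sub>C \<omega>) = smult c (dt_part \<omega>)"
  by (simp_all add: poly_eq_iff scaleC_complex_def)

lemma cbilinear_form_mult: "cbilinear form_mult"
  by (intro cbilinearI clinearI) (simp_all add: forms.expand complex_form_scale smult_add_right algebra_simps)

lemma form_mult_assoc: "form_mult (form_mult \<omega> \<eta>) \<zeta> = form_mult \<omega> (form_mult \<eta> \<zeta>)"
  by (simp add: forms.expand algebra_simps)

lemma form_mult_commute:
  assumes "\<omega> \<in> gcomp q" "\<eta> \<in> gcomp r"
  shows "form_mult \<omega> \<eta> = parity_sign (q * r) *\<^sub>C form_mult \<eta> \<omega>"
  by (rule complex_form_gcomp[OF assms(1)]; rule complex_form_gcomp[OF assms(2)])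
    (simp_all add: forms.expand complex_form_scale mult.commute)

lemma form_mult_gcomp:
  assumes "\<omega> \<in> gcomp q" "\<eta> \<in> gcomp r"
  shows "form_mult \<omega> \<eta> \<in> gcomp (q + r)"
proof -
  have 0: "\<omega> = 0 \<or> \<eta> = 0 \<or> (fun_part \<omega> = 0 \<and> fun_part \<eta> = 0) \<Longrightarrow> form_mult \<omega> \<eta> = 0"
    by (auto simp: forms.expand zero_forms_def form_mult_def)
  show ?thesis
    by (rule complex_form_gcomp[OF assms(1)]; rule complex_form_gcomp[OF assms(2)])
      (simp_all add: 0 gcomp_0 cbilinear_simps[OF cbilinear_form_mult], simp_all add: form_gcompI)
qed

definition form_one :: "complex forms" where
  "form_one = Forms 1 0"

lemma form_one_mult [simp]: "form_mult form_one \<omega> = \<omega>" "form_mult \<omega> form_one = \<omega>"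
  by (simp_all add: form_one_def forms.expand)

lemma form_one_gcomp: "form_one \<in> gcomp 0"
  by (rule form_gcompI) (simp add: form_one_def)

lemma clinear_de_rham: "clinear de_rham"
  by (rule clinearI) (simp_all add: de_rham_def forms.expand complex_form_scale pderiv_add pderiv_smult)

lemma de_rham_gcomp: "\<omega> \<in> gcomp q \<Longrightarrow> de_rham \<omega> \<in> gcomp (q + 1)"
  by (erule complex_form_gcomp) (auto intro!: form_gcompI simp: de_rham_def gcomp_0 simp flip: zero_forms_def)

lemma de_rham_mult:
  assumes "\<omega> \<in> gcomp q"
  shows "de_rham (form_mult \<omega> \<eta>) = form_mult (de_rham \<omega>) \<eta> + parity_sign q *\<^sub>C form_mult \<omega> (de_rham \<eta>)"
  by (rule complex_form_gcomp[OF assms])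
    (simp_all add: de_rham_def forms.expand complex_form_scale pderiv_mult algebra_simps)

lemma de_rham_de_rham: "de_rham (de_rham \<omega>) = 0"
  by (simp add: de_rham_def zero_forms_def)

subsection \<open>Extension of multilinear maps to forms\<close>

text \<open>\<open>(v \<otimes> \<omega>, w \<otimes> \<eta>) \<mapsto> \<plusminus> B(v, w) \<otimes> \<omega> \<eta>\<close>, with the sign of moving \<open>\<omega>\<close> past \<open>w\<close>.\<close>

definition form_bil :: "('a::graded_space \<Rightarrow> 'b::graded_space \<Rightarrow> 'c::graded_space) \<Rightarrow> 'a forms \<Rightarrow> 'b forms \<Rightarrow> 'c forms" where
  "form_bil B x y = form_lift (\<lambda>v \<omega>. form_lift (\<lambda>w \<eta>.
    hext (\<lambda>q \<omega>. form_tensor (B v (twist q w)) (form_mult \<omega> \<eta>)) \<omega>) y) x"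

definition forms_map :: "('a::graded_space \<Rightarrow> 'b::graded_space) \<Rightarrow> 'a forms \<Rightarrow> 'b forms" where
  "forms_map f = form_lift (\<lambda>v. form_tensor (f v))"

definition form_derham :: "'a::graded_space forms \<Rightarrow> 'a forms" where
  "form_derham = form_lift (\<lambda>v \<omega>. form_tensor (twist 1 v) (de_rham \<omega>))"

context
  fixes B :: "'a::graded_space \<Rightarrow> 'b::graded_space \<Rightarrow> 'c::graded_space"
  assumes B: "cbilinear B"
begin

lemma cbilinear_form_bil_inner: "cbilinear (\<lambda>w \<eta>. hext (\<lambda>q \<omega>. form_tensor (B v (twist q w)) (form_mult \<omega> \<eta>)) \<omega>)"
  unfolding hext_def
  by (intro cbilinearI clinear_sum_fun clinear_intros clinear_bil_right[OF B] cbilinear_right[OF cbilinear_form_mult])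

lemma cbilinear_form_bil_outer: "cbilinear (\<lambda>v \<omega>. form_lift (\<lambda>w \<eta>.
    hext (\<lambda>q \<omega>. form_tensor (B v (twist q w)) (form_mult \<omega> \<eta>)) \<omega>) y)"
proof -
  have 1: "clinear (\<lambda>v. hext (\<lambda>q \<omega>. form_tensor (B v (twist q w)) (form_mult \<omega> \<eta>)) \<omega>)" for w \<eta> \<omega>
    unfolding hext_def by (intro clinear_sum_fun clinear_intros cbilinear_left[OF B])
  have 2: "clinear (hext (\<lambda>q \<omega>. form_tensor (B v (twist q w)) (form_mult \<omega> \<eta>)))" for v w \<eta>
    by (intro clinear_hext clinear_intros cbilinear_left[OF cbilinear_form_mult])
  show ?thesis
    by (induction y rule: forms_induct)
       (auto intro!: cbilinearI clinear_plus 1 2 dest: cbilinear_left cbilinear_right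
         simp: form_lift_tensor[OF cbilinear_form_bil_inner] clinear_add[OF clinear_form_lift[OF cbilinear_form_bil_inner]])
qed

lemma cbilinear_form_bil: "cbilinear (form_bil B)"
proof (rule cbilinearI)
  show "clinear (\<lambda>x. form_bil B x y)" for y
    unfolding form_bil_def by (rule clinear_form_lift[OF cbilinear_form_bil_outer])
  show "clinear (form_bil B x)" for x
    by (induction x rule: forms_induct)
      (auto simp: form_bil_def form_lift_tensor[OF cbilinear_form_bil_outer] clinear_add[OF clinear_form_lift[OF cbilinear_form_bil_outer]]
        intro!: clinear_plus clinear_form_lift[OF cbilinear_form_bil_inner])
qed

lemma form_bil_tensor:
  assumes "\<omega> \<in> gcomp q"
  shows "form_bil B (form_tensor v \<omega>) (form_tensor w \<eta>) = form_tensor (B v (twist q w)) (form_mult \<omega> \<eta>)"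
  unfolding form_bil_def
  by (subst form_lift_tensor[OF cbilinear_form_bil_outer], subst form_lift_tensor[OF cbilinear_form_bil_inner],
      rule hext_homogeneous[OF _ assms]) (intro clinear_intros cbilinear_left[OF cbilinear_form_mult])

end

lemma cbilinear_forms_map: "clinear f \<Longrightarrow> cbilinear (\<lambda>v. form_tensor (f v))"
  by (intro cbilinearI clinear_intros cbilinear_right[OF cbilinear_form_tensor])

lemma clinear_forms_map: "clinear f \<Longrightarrow> clinear (forms_map f)"
  and forms_map_tensor: "clinear f \<Longrightarrow> forms_map f (form_tensor v \<omega>) = form_tensor (f v) \<omega>"
  unfolding forms_map_def by (simp_all add: clinear_form_lift form_lift_tensor cbilinear_forms_map)

lemma forms_map_compose:
  assumes "clinear f" "clinear g"
  shows "forms_map f (forms_map g x) = forms_map (\<lambda>x. f (g x)) x"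
  by (rule forms_eqI[where f = "\<lambda>x. forms_map f (forms_map g x)" and g = "forms_map (\<lambda>x. f (g x))"])
    (simp_all add: clinear_compose clinear_forms_map assms forms_map_tensor)

lemma graded_map_forms_map:
  assumes "graded_map k f"
  shows "graded_map k (forms_map f)"
proof (rule graded_mapI)
  show "forms_map f x \<in> gcomp (p + k)" if "x \<in> gcomp p" for p x
    using that
  proof (induction rule: forms_gcomp_induct)
    case (tensor v q \<omega>)
    then have "f v \<in> gcomp (p - q + k)" using graded_map_gcomp[OF assms] by blast
    from form_tensor_gcomp[OF this tensor(2)] show ?case
      by (simp add: forms_map_tensor graded_map_linear[OF assms] algebra_simps)
  qed (simp add: clinear_add[OF clinear_forms_map[OF graded_map_linear[OF assms]]] gcomp_add)
qed (rule clinear_forms_map[OF graded_map_linear[OF assms]])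

lemma cbilinear_form_derham: "cbilinear (\<lambda>v \<omega>. form_tensor (twist 1 v) (de_rham \<omega>))"
  by (intro cbilinearI clinear_intros clinear_de_rham)

lemma form_derham_tensor: "form_derham (form_tensor v \<omega>) = form_tensor (twist 1 v) (de_rham \<omega>)"
  unfolding form_derham_def by (rule form_lift_tensor[OF cbilinear_form_derham])

lemma clinear_form_derham: "clinear form_derham"
  unfolding form_derham_def by (rule clinear_form_lift[OF cbilinear_form_derham])

lemma graded_map_form_derham: "graded_map 1 form_derham"
proof (rule graded_mapI[OF clinear_form_derham])
  show "form_derham x \<in> gcomp (p + 1)" if "x \<in> gcomp p" for p x
    using that
  proof (induction rule: forms_gcomp_induct)
    case (tensor v q \<omega>)
    from form_tensor_gcomp[OF twist_in_gcomp[OF tensor(1)] de_rham_gcomp[OF tensor(2)]] show ?case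
      by (simp add: form_derham_tensor algebra_simps)
  qed (simp add: clinear_add[OF clinear_form_derham] gcomp_add)
qed

lemma eval_form_eq: "eval_form s x = poly_sum (\<lambda>i v. s ^ i *\<^sub>C v) (fun_part x)"
  by (simp add: eval_form_def poly_sum_def)

lemma clinear_eval_form: "clinear (eval_form s)"
  by (rule clinearI)
    (simp_all add: eval_form_eq scaleC_forms_def poly_sum_add poly_sum_scale clinear_intros)

lemma eval_form_tensor: "eval_form s (form_tensor v \<omega>) = poly (fun_part \<omega>) s *\<^sub>C v"
proof -
  have "eval_form s (form_tensor v \<omega>) = (\<Sum>i\<le>degree (fun_part \<omega>). s ^ i *\<^sub>C coeff (fun_part (form_tensor v \<omega>)) i)"
    unfolding eval_form_eq by (rule poly_sum_bound) (simp_all add: form_tensor_def map_poly_degree_leq)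
  then show ?thesis
    by (simp add: poly_altdef complex_space.scale_sum_left mult.commute)
qed

lemma graded_map_eval_form: "graded_map 0 (eval_form s)"
proof (rule graded_mapI[OF clinear_eval_form])
  show "eval_form s x \<in> gcomp (p + 0)" if "x \<in> gcomp p" for p and x :: "'a forms"
    using that
  proof (induction rule: forms_gcomp_induct)
    case (tensor v q \<omega>)
    show ?case
      by (rule complex_form_gcomp[OF tensor(2)]) (use tensor(1) in \<open>auto simp: eval_form_tensor gcomp_0 intro: gcomp_scale\<close>)
  qed (simp add: clinear_add[OF clinear_eval_form] gcomp_add)
qed

definition graded_bilinear :: "('a::graded_space \<Rightarrow> 'b::graded_space \<Rightarrow> 'c::graded_space) \<Rightarrow> bool" where
  "graded_bilinear B \<longleftrightarrow> cbilinear B \<and> (\<forall>p q. \<forall>x\<in>gcomp p. \<forall>y\<in>gcomp q. B x y \<in> gcomp (p + q))"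

lemma graded_bilinear_cbilinear: "graded_bilinear B \<Longrightarrow> cbilinear B"
  and graded_bilinear_gcomp: "graded_bilinear B \<Longrightarrow> x \<in> gcomp p \<Longrightarrow> y \<in> gcomp q \<Longrightarrow> B x y \<in> gcomp (p + q)"
  unfolding graded_bilinear_def by blast+

lemma twist_bilinear:
  assumes "graded_bilinear B"
  shows "twist k (B x y) = B (twist k x) (twist k y)"
proof -
  note B = graded_bilinear_cbilinear[OF assms]
  have hom: "twist k (B x y) = B (twist k x) (twist k y)" if "x \<in> gcomp p" "y \<in> gcomp q" for p q x y
    using that graded_bilinear_gcomp[OF assms that]
    by (simp add: twist_homogeneous cbilinear_simps[OF B]) (auto simp: parity_sign_if)
  have "twist k (B x y) = B (twist k x) (twist k y)" if "x \<in> gcomp p" for p x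
    by (induction y rule: graded_induct)
      (use hom that in \<open>auto simp: cbilinear_simps[OF B] twist_simps\<close>)
  then show ?thesis
    by (induction x rule: graded_induct) (auto simp: cbilinear_simps[OF B] twist_simps)
qed

lemma graded_bilinear_form_bil:
  assumes "graded_bilinear B"
  shows "graded_bilinear (form_bil B)"
proof -
  note B = graded_bilinear_cbilinear[OF assms]
  have "form_bil B x y \<in> gcomp (p + q)" if "x \<in> gcomp p" "y \<in> gcomp q" for p q x y
    using that(1)
  proof (induction rule: forms_gcomp_induct)
    case x: (tensor v r \<omega>)
    show ?case using that(2)
    proof (induction rule: forms_gcomp_induct)
      case (tensor w s \<eta>)
      have "B v (twist r w) \<in> gcomp (p - r + (q - s))"
        by (intro graded_bilinear_gcomp[OF assms] twist_in_gcomp x tensor)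
      from form_tensor_gcomp[OF this form_mult_gcomp[OF x(2) tensor(2)]] show ?case
        by (simp add: form_bil_tensor[OF B x(2)] algebra_simps)
    qed (simp add: cbilinear_simps[OF cbilinear_form_bil[OF B]] gcomp_add)
  qed (simp add: cbilinear_simps[OF cbilinear_form_bil[OF B]] gcomp_add)
  then show ?thesis by (simp add: graded_bilinear_def cbilinear_form_bil[OF B])
qed

lemma graded_bilinear_adjoin: "graded_bilinear (\<odot>)"
  by (simp add: graded_bilinear_def cbilinear_adjoin)
    (metis has_degreeD has_degree_adjoin add.commute)

lemma graded_bilinear_mult: "graded_algebra m \<Longrightarrow> graded_bilinear m"
  unfolding graded_algebra_def graded_bilinear_def by blast

lemma graded_bilinear_mult_action:
  assumes m: "graded_algebra m"
  shows "graded_bilinear (mult_action m)"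
proof -
  have "mult_action m x y \<in> gcomp (p + q)" if "x \<in> gcomp p" "y \<in> gcomp q" for p q x y
    using graded_map_gcomp[OF graded_map_uder[OF graded_map_mult[OF m that(1)] that(1)] that(2)]
    by (simp add: mult_action_homogeneous[OF m that(1)] add.commute)
  then show ?thesis
    using gcommuting_mult_action[OF m] by (simp add: graded_bilinear_def gcommuting_def)
qed

text \<open>Trilinear identities extend from \<open>V\<close> to \<open>V \<otimes> \<complex>[t,dt]\<close>: every term acquires the product of the
  three forms, and the Koszul signs match. The shape below covers the commutation of
  multiplications by vectors (with \<open>H = 0\<close>) and the recursion for \<open>mult_action\<close> (with \<open>H\<close> the
  product of the algebra).\<close>

lemma form_bil_commute:
  fixes B :: "'a::graded_space \<Rightarrow> 'e::graded_space \<Rightarrow> 'd::graded_space"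
    and C :: "'b::graded_space \<Rightarrow> 'c::graded_space \<Rightarrow> 'e"
    and B' :: "'a \<Rightarrow> 'c \<Rightarrow> 'f::graded_space" and C' :: "'b \<Rightarrow> 'f \<Rightarrow> 'd"
    and G :: "'g::graded_space \<Rightarrow> 'c \<Rightarrow> 'd" and H :: "'a \<Rightarrow> 'b \<Rightarrow> 'g"
  assumes B: "cbilinear B" and C: "graded_bilinear C" and B': "graded_bilinear B'" and C': "cbilinear C'"
    and G: "cbilinear G" and H: "graded_bilinear H"
    and comm: "\<And>p q x y z. x \<in> gcomp p \<Longrightarrow> y \<in> gcomp q \<Longrightarrow>
      B x (C y z) = G (H x y) z + parity_sign (p * q) *\<^sub>C C' y (B' x z)"
    and x: "x \<in> gcomp p" and y: "y \<in> gcomp q"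
  shows "form_bil B x (form_bil C y z) =
    form_bil G (form_bil H x y) z + parity_sign (p * q) *\<^sub>C form_bil C' y (form_bil B' x z)"
proof -
  note bC = graded_bilinear_cbilinear[OF C] and bB' = graded_bilinear_cbilinear[OF B']
    and bH = graded_bilinear_cbilinear[OF H]
  note lin = cbilinear_simps[OF cbilinear_form_bil[OF B]] cbilinear_simps[OF cbilinear_form_bil[OF C']]
    cbilinear_simps[OF cbilinear_form_bil[OF bC]] cbilinear_simps[OF cbilinear_form_bil[OF bB']]
    cbilinear_simps[OF cbilinear_form_bil[OF bH]] cbilinear_simps[OF cbilinear_form_bil[OF G]]
  show ?thesis using x
  proof (induction rule: forms_gcomp_induct)
    case x: (tensor v r \<omega>)
    show ?case using y
    proof (induction rule: forms_gcomp_induct)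
      case y: (tensor w s \<eta>)
      show ?case
      proof (induction z rule: forms_induct)
        case (tensor u t \<zeta>)
        have mult: "form_mult \<eta> (form_mult \<omega> \<zeta>) = parity_sign (s * r) *\<^sub>C form_mult (form_mult \<omega> \<eta>) \<zeta>"
          using form_mult_commute[OF y(2) x(2)]
          by (simp add: cbilinear_simps[OF cbilinear_form_mult] flip: form_mult_assoc)
        have "form_bil B (form_tensor v \<omega>) (form_bil C (form_tensor w \<eta>) (form_tensor u \<zeta>)) =
            parity_sign (r * (q - s)) *\<^sub>C form_tensor (B v (C w (twist (r + s) u))) (form_mult (form_mult \<omega> \<eta>) \<zeta>)"
          by (simp add: form_bil_tensor[OF B x(2)] form_bil_tensor[OF bC y(2)] twist_bilinear[OF C] twist_twist
              twist_homogeneous[OF y(1)] form_mult_assoc cbilinear_simps[OF bC] cbilinear_simps[OF B] form_tensor_simps)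
        moreover have "form_bil G (form_bil H (form_tensor v \<omega>) (form_tensor w \<eta>)) (form_tensor u \<zeta>) =
            parity_sign (r * (q - s)) *\<^sub>C form_tensor (G (H v w) (twist (r + s) u)) (form_mult (form_mult \<omega> \<eta>) \<zeta>)"
          by (simp add: form_bil_tensor[OF bH x(2)] form_bil_tensor[OF G form_mult_gcomp[OF x(2) y(2)]]
              twist_homogeneous[OF y(1)] cbilinear_simps[OF bH] cbilinear_simps[OF G] form_tensor_simps lin)
        moreover have "form_bil C' (form_tensor w \<eta>) (form_bil B' (form_tensor v \<omega>) (form_tensor u \<zeta>)) =
            (parity_sign (s * (p - r)) * parity_sign (s * r)) *\<^sub>C
              form_tensor (C' w (B' v (twist (r + s) u))) (form_mult (form_mult \<omega> \<eta>) \<zeta>)"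
          by (simp add: form_bil_tensor[OF C' y(2)] form_bil_tensor[OF bB' x(2)] twist_bilinear[OF B'] twist_twist
              twist_homogeneous[OF x(1)] mult cbilinear_simps[OF bB'] cbilinear_simps[OF C'] form_tensor_simps
              add.commute mult.commute)
        ultimately show ?case
          using comm[OF x(1) y(1), of "twist (r + s) u"]
          by (simp add: form_tensor_simps scaleC_add_right) (auto simp: parity_sign_if)
      qed (simp add: lin scaleC_add_right)
    qed (simp add: lin scaleC_add_right)
  qed (simp add: lin scaleC_add_right)
qed

lemma form_bil_zero:
  fixes x :: "'a::graded_space forms" and y :: "'b::graded_space forms"
  shows "form_bil (\<lambda>_ _. 0) x y = (0 :: 'c::graded_space forms)"
proof -
  have 0: "cbilinear (\<lambda>(x :: 'a) (y :: 'b). 0 :: 'c)" by (intro cbilinearI clinear_intros)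
  note lin = cbilinear_simps[OF cbilinear_form_bil[OF 0]]
  show ?thesis
  proof (induction x rule: forms_induct)
    case x: (tensor v q \<omega>)
    show ?case
      by (induction y rule: forms_induct) (simp_all add: form_bil_tensor[OF 0 x] form_tensor_simps lin)
  qed (simp add: lin)
qed

lemma graded_algebra_form_bil:
  assumes m: "graded_algebra m"
  shows "graded_algebra (form_bil m)"
proof -
  note gm = graded_bilinear_mult[OF m] and b = cbilinear_mult[OF m]
  note lin = cbilinear_simps[OF cbilinear_form_bil[OF b]]
  have "form_bil m x y = parity_sign (p * q) *\<^sub>C form_bil m y x" if x: "x \<in> gcomp p" and y: "y \<in> gcomp q" for p q x y
    using x
  proof (induction rule: forms_gcomp_induct)
    case x: (tensor v r \<omega>)
    show ?case using y
    proof (induction rule: forms_gcomp_induct)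
      case y: (tensor w s \<eta>)
      show ?case
        unfolding form_bil_tensor[OF b x(2)] form_bil_tensor[OF b y(2)] twist_homogeneous[OF x(1)]
          twist_homogeneous[OF y(1)] mult_simps[OF m] form_tensor_simps
        by (subst mult_commute[OF m x(1) y(1)], subst form_mult_commute[OF x(2) y(2)])
           (simp add: form_tensor_simps, auto simp: parity_sign_if)
    qed (simp add: lin scaleC_add_right)
  qed (simp add: lin scaleC_add_right)
  moreover have "form_bil m (form_bil m x y) z = form_bil m x (form_bil m y z)" for x y z
  proof (induction x rule: forms_induct)
    case x: (tensor v q \<omega>)
    show ?case
    proof (induction y rule: forms_induct)
      case y: (tensor w r \<eta>)
      show ?case
        by (induction z rule: forms_induct)
          (simp_all add: lin form_bil_tensor[OF b x] form_bil_tensor[OF b y] form_bil_tensor[OF b form_mult_gcomp[OF x y]]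
            twist_bilinear[OF gm] twist_twist mult_assoc[OF m] form_mult_assoc)
    qed (simp add: lin)
  qed (simp add: lin)
  ultimately show ?thesis
    using graded_bilinear_form_bil[OF gm] unfolding graded_algebra_def graded_bilinear_def by blast
qed

lemma forms_map_form_bil:
  assumes f: "graded_map 0 f" and B: "cbilinear B" and C: "cbilinear C" and "\<And>x y. f (B x y) = C x (f y)"
  shows "forms_map f (form_bil B x y) = form_bil C x (forms_map f y)"
proof -
  note lf = graded_map_linear[OF f]
  note lin = clinear_simps[OF clinear_forms_map[OF lf]] cbilinear_simps[OF cbilinear_form_bil[OF B]]
    cbilinear_simps[OF cbilinear_form_bil[OF C]]
  show ?thesis
  proof (induction x rule: forms_induct)
    case x: (tensor v q \<omega>)
    show ?case
      by (induction y rule: forms_induct)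
        (simp_all add: lin form_bil_tensor[OF B x] form_bil_tensor[OF C x] forms_map_tensor[OF lf] assms(4)
          graded_map_twist[OF f])
  qed (simp add: lin)
qed

lemma forms_map_uder:
  assumes d: "graded_map 1 d"
  shows "forms_map (uder 1 d 0) (form_bil (\<odot>) x y) =
    form_bil (\<odot>) (forms_map d x) y + form_bil (\<odot>) (twist 1 x) (forms_map (uder 1 d 0) y)"
proof -
  note ld = graded_map_linear[OF d] and lD = clinear_uder[OF d, of 0] and gD = graded_map_uder[OF d gcomp_0]
  note lin = clinear_simps[OF clinear_forms_map[OF ld]] clinear_simps[OF clinear_forms_map[OF lD]]
    cbilinear_simps[OF cbilinear_form_bil[OF cbilinear_adjoin]]
  show ?thesis
  proof (induction x rule: forms_induct)
    case x: (tensor v q \<omega>)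
    show ?case
    proof (induction y rule: forms_induct)
      case (tensor w r \<eta>)
      have "uder 1 d 0 (twist q w) = parity_sign q *\<^sub>C twist q (uder 1 d 0 w)"
        by (simp add: graded_map_twist[OF gD])
      then show ?case
        by (simp add: lin form_bil_tensor[OF cbilinear_adjoin x] forms_map_tensor ld lD uder_adjoin[OF d]
            twist_form_tensor[OF x] form_tensor_simps adjoin_simps)
    qed (simp add: lin)
  qed (simp add: lin twist_simps)
qed

section \<open>The \<open>L\<^sub>\<infinity>\<close> structure on forms with values in a transported structure\<close>

text \<open>\<open>S(V \<otimes> \<Omega>) \<rightarrow> SV \<otimes> \<Omega>\<close>, multiplying the forms together, intertwines every construction on \<open>V \<otimes>
  \<Omega>\<close> that is \<open>\<Omega>\<close>-multilinear with the corresponding construction on \<open>V\<close>.\<close>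

definition collect_forms :: "'a::graded_space forms unital_sym \<Rightarrow> 'a unital_sym forms" where
  "collect_forms = ulift (form_bil (\<odot>)) (form_tensor \<one> form_one)"

lemma gcommuting_form_bil_adjoin: "gcommuting (form_bil (\<odot>))"
proof (rule gcommutingI[OF cbilinear_form_bil[OF cbilinear_adjoin]])
  fix p q and x y :: "'a forms" and z :: "'a unital_sym forms"
  assume x: "x \<in> gcomp p" and y: "y \<in> gcomp q"
  have 0: "graded_bilinear (\<lambda>(x :: 'a) (y :: 'a). 0 :: 'a)"
    by (simp add: graded_bilinear_def gcomp_0 cbilinearI clinear_const_0)
  have "form_bil (\<odot>) x (form_bil (\<odot>) y z) =
      form_bil (\<odot>) (form_bil (\<lambda>_ _. 0 :: 'a) x y) z + parity_sign (p * q) *\<^sub>C form_bil (\<odot>) y (form_bil (\<odot>) x z)"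
  proof (rule form_bil_commute[OF cbilinear_adjoin graded_bilinear_adjoin graded_bilinear_adjoin cbilinear_adjoin
        cbilinear_adjoin 0 _ x y])
    show "v \<odot> w \<odot> u = 0 \<odot> u + parity_sign (p * q) *\<^sub>C (w \<odot> v \<odot> u)"
      if "v \<in> gcomp p" "w \<in> gcomp q" for p q and v w :: 'a and u
      using adjoin_commute[OF that, of u] by (simp add: adjoin_simps)
  qed
  then show "form_bil (\<odot>) x (form_bil (\<odot>) y z) = parity_sign (p * q) *\<^sub>C form_bil (\<odot>) y (form_bil (\<odot>) x z)"
    by (simp add: form_bil_zero cbilinear_simps[OF cbilinear_form_bil[OF cbilinear_adjoin]])
qed

lemma clinear_collect_forms: "clinear collect_forms"
  and collect_forms_unit: "collect_forms \<one> = form_tensor \<one> form_one"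
  and collect_forms_adjoin: "collect_forms (x \<odot> y) = form_bil (\<odot>) x (collect_forms y)"
  by (simp_all add: collect_forms_def clinear_ulift ulift_unit ulift_adjoin gcommuting_form_bil_adjoin)

lemmas collect_forms_simps = clinear_simps[OF clinear_collect_forms]

lemma collect_forms_uder:
  assumes d: "graded_map 1 d"
  shows "collect_forms (uder 1 (forms_map d) 0 y) = forms_map (uder 1 d 0) (collect_forms y)"
proof -
  note D = graded_map_forms_map[OF d] and lD = clinear_uder[OF d, of 0]
  show ?thesis
    by (induction y rule: unital_sym_induct)
      (simp_all add: uder_unit[OF D] uder_unit[OF d] uder_adjoin[OF D] uder_simps[OF D] collect_forms_unit
        collect_forms_adjoin collect_forms_simps adjoin_simps forms_map_tensor[OF lD] form_tensor_simps
        forms_map_uder[OF d] clinear_simps[OF clinear_forms_map[OF lD]])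
qed

lemma mult_action_unit:
  assumes m: "graded_algebra m"
  shows "mult_action m x \<one> = x \<odot> \<one>"
proof (induction x rule: graded_induct)
  case (1 p x)
  then show ?case by (simp add: mult_action_homogeneous[OF m 1] uder_unit[OF graded_map_mult[OF m 1]])
qed (use gcommuting_mult_action[OF m] in \<open>simp add: gcommuting_def cbilinear_simps adjoin_simps\<close>)

context
  fixes m :: "'a::graded_space \<Rightarrow> 'a \<Rightarrow> 'a"
  assumes m: "graded_algebra m"
begin

lemma cbilinear_mult_action: "cbilinear (mult_action m)"
  using graded_bilinear_mult_action[OF m] by (rule graded_bilinear_cbilinear)

text \<open>Both sides satisfy the recursion that determines \<open>mult_action\<close>.\<close>

lemma collect_forms_mult_action:
  assumes x: "x \<in> gcomp p"
  shows "collect_forms (mult_action (form_bil m) x y) = form_bil (mult_action m) x (collect_forms y)"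
proof -
  note mt = graded_algebra_form_bil[OF m]
  note D = graded_map_mult[OF mt x]
  note lin = cbilinear_simps[OF cbilinear_form_bil[OF cbilinear_mult_action]]
    cbilinear_simps[OF cbilinear_form_bil[OF cbilinear_adjoin]]
  have on_unit: "form_bil (\<odot>) x (form_tensor \<one> form_one) = form_bil (mult_action m) x (form_tensor \<one> form_one)" for x
    by (induction x rule: forms_induct)
      (simp_all add: lin form_bil_tensor[OF cbilinear_adjoin] form_bil_tensor[OF cbilinear_mult_action] mult_action_unit[OF m])
  have step: "form_bil (mult_action m) x (form_bil (\<odot>) u z) =
      form_bil (\<odot>) (form_bil m x u) z + parity_sign (p * q) *\<^sub>C form_bil (\<odot>) u (form_bil (mult_action m) x z)"
    if u: "u \<in> gcomp q" for q u z
  proof (rule form_bil_commute[OF cbilinear_mult_action graded_bilinear_adjoin graded_bilinear_mult_action[OF m]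
        cbilinear_adjoin cbilinear_adjoin graded_bilinear_mult[OF m] _ x u])
    show "mult_action m v (w \<odot> z) = m v w \<odot> z + parity_sign (p * q) *\<^sub>C (w \<odot> mult_action m v z)"
      if "v \<in> gcomp p" "w \<in> gcomp q" for p q v w z
      by (simp add: mult_action_homogeneous[OF m that(1)] uder_adjoin[OF graded_map_mult[OF m that(1)]]
          twist_homogeneous[OF that(2)] adjoin_simps)
  qed
  show ?thesis
  proof (induction y rule: unital_sym_induct)
    case unit
    show ?case by (simp add: mult_action_unit[OF mt] collect_forms_unit collect_forms_adjoin on_unit)
  next
    case (adjoin q u y)
    then show ?case
      by (simp add: mult_action_homogeneous[OF mt x] uder_adjoin[OF D] collect_forms_adjoin collect_forms_simps
          twist_homogeneous[OF adjoin(1)] lin step[OF adjoin(1)])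
  qed (simp_all add: mult_action_homogeneous[OF mt x] uder_simps[OF D] collect_forms_simps lin)
qed

lemma collect_forms_ucumulant:
  "collect_forms (ucumulant (form_bil m) y) = forms_map (ucumulant m) (collect_forms y)"
proof -
  note mt = graded_algebra_form_bil[OF m] and L = clinear_ucumulant[OF m]
  show ?thesis
  proof (induction y rule: unital_sym_induct)
    case (adjoin p x y)
    have "forms_map (ucumulant m) (form_bil (\<odot>) x z) = form_bil (mult_action m) x (forms_map (ucumulant m) z)" for z
      by (rule forms_map_form_bil[OF graded_map_ucumulant[OF m] cbilinear_adjoin cbilinear_mult_action])
        (rule ucumulant_adjoin'[OF m])
    then show ?case
      by (simp only: ucumulant_adjoin'[OF mt] collect_forms_mult_action[OF adjoin(1)] collect_forms_adjoin adjoin(2))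
  qed (simp_all add: ucumulant_unit[OF mt] ucumulant_unit[OF m] collect_forms_unit collect_forms_simps
      ucumulant_simps[OF mt] clinear_simps[OF clinear_forms_map[OF L]] forms_map_tensor[OF L])
qed

end

lemma forms_map_fst_collect_forms: "forms_map fst (collect_forms y) = fst y *\<^sub>C form_one"
proof -
  have lf: "clinear (fst :: 'a unital_sym \<Rightarrow> complex)" by (intro clinear_intros)
  note lin = clinear_simps[OF clinear_forms_map[OF lf]]
  have "forms_map fst (form_bil (\<odot>) x z) = 0" for x :: "'a forms" and z
  proof (induction x rule: forms_induct)
    case x: (tensor v q \<omega>)
    show ?case
      by (induction z rule: forms_induct)
        (simp_all add: lin form_bil_tensor[OF cbilinear_adjoin x] forms_map_tensor[OF lf] form_tensor_simps
          cbilinear_simps[OF cbilinear_form_bil[OF cbilinear_adjoin]])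
  qed (simp add: lin cbilinear_simps[OF cbilinear_form_bil[OF cbilinear_adjoin]])
  then show ?thesis
    by (induction y rule: unital_sym_induct)
      (simp_all add: collect_forms_adjoin collect_forms_unit collect_forms_simps lin forms_map_tensor[OF lf]
        scaleC_add_left scaleC_complex_def forms_eq_iff form_one_def)
qed

text \<open>The components of a map into \<open>S(V \<otimes> \<Omega>)\<close> can be computed after collecting the forms.\<close>

lemma forms_map_uproj_collect_forms: "forms_map uproj (collect_forms y) = uproj y"
proof -
  have lf: "clinear (fst :: 'a unital_sym \<Rightarrow> complex)" by (intro clinear_intros)
  note lu = clinear_uproj[where 'a = 'a]
  note lin = clinear_simps[OF clinear_forms_map[OF lf]] clinear_simps[OF clinear_forms_map[OF lu]]
  have S: "cbilinear (\<lambda>(v :: 'a) (c :: complex). c *\<^sub>C v)" by (intro cbilinearI clinear_intros)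
  have step: "forms_map uproj (form_bil (\<odot>) x z) = form_bil (\<lambda>v c. c *\<^sub>C v) x (forms_map fst z)" for x :: "'a forms" and z
  proof (induction x rule: forms_induct)
    case x: (tensor v q \<omega>)
    show ?case
      by (induction z rule: forms_induct)
        (simp_all add: lin form_bil_tensor[OF cbilinear_adjoin x] form_bil_tensor[OF S x] forms_map_tensor[OF lf]
          forms_map_tensor[OF lu] fst_twist cbilinear_simps[OF cbilinear_form_bil[OF cbilinear_adjoin]]
          cbilinear_simps[OF cbilinear_form_bil[OF S]])
  qed (simp add: lin cbilinear_simps[OF cbilinear_form_bil[OF cbilinear_adjoin]] cbilinear_simps[OF cbilinear_form_bil[OF S]])
  have one: "form_tensor 1 form_one = form_one" by (simp add: forms_eq_iff scaleC_complex_def)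
  have unit: "form_bil (\<lambda>v c. c *\<^sub>C v) x form_one = x" for x :: "'a forms"
  proof (induction x rule: forms_induct)
    case x: (tensor v q \<omega>)
    show ?case
      using form_bil_tensor[OF S x, of v 1 form_one] unfolding one by simp
  qed (simp add: cbilinear_simps[OF cbilinear_form_bil[OF S]])
  show ?thesis
    by (induction y rule: unital_sym_induct)
      (simp_all add: collect_forms_adjoin collect_forms_unit collect_forms_simps lin forms_map_tensor[OF lu]
        uproj_simps form_tensor_simps step forms_map_fst_collect_forms unit
        cbilinear_simps[OF cbilinear_form_bil[OF S]])
qed

text \<open>The operator of multiplication by \<open>w \<otimes> \<omega>\<close> moves \<open>\<omega>\<close> past all later letters, which yields the
  sign in the definition of the operations on forms.\<close>

lemma collect_forms_adjoin_list:
  assumes "homogeneous ps ws" "homogeneous qs \<omega>s" "length \<omega>s = length ws"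
  shows "collect_forms (adjoin_list (map2 form_tensor ws \<omega>s)) =
    (\<Prod>(i, j) | i < j \<and> j < length ws. parity_sign (qs ! i * ps ! j)) *\<^sub>C
      form_tensor (adjoin_list ws) (foldr form_mult \<omega>s form_one)"
  using assms
proof (induction ws arbitrary: ps qs \<omega>s)
  case Nil
  then show ?case by (simp add: collect_forms_unit)
next
  case (Cons w ws)
  obtain p ps' where ps: "ps = p # ps'" "w \<in> gcomp p" "homogeneous ps' ws"
    using Cons.prems(1) by (auto simp: homogeneous_Cons)
  obtain \<omega> \<omega>s' where \<omega>s: "\<omega>s = \<omega> # \<omega>s'" using Cons.prems(3) by (cases \<omega>s) auto
  obtain q qs' where qs: "qs = q # qs'" "\<omega> \<in> gcomp q" "homogeneous qs' \<omega>s'"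
    using Cons.prems(2) by (auto simp: homogeneous_Cons \<omega>s)
  let ?n = "length ws"
  have sign: "(\<Prod>(i, j) | i < j \<and> j < Suc ?n. parity_sign (qs ! i * ps ! j)) =
      (\<Prod>j<?n. parity_sign (q * ps' ! j)) * (\<Prod>(i, j) | i < j \<and> j < ?n. parity_sign (qs' ! i * ps' ! j))"
    unfolding prod_pairs_Suc by (simp add: qs(1) ps(1))
  have tw: "twist q (adjoin_list ws) = (\<Prod>j<?n. parity_sign (q * ps' ! j)) *\<^sub>C adjoin_list ws"
    using twist_adjoin_list_nths[OF ps(3), of q UNIV] homogeneous_length[OF ps(3)]
    by (simp add: nths_all)
  have IH: "collect_forms (adjoin_list (map2 form_tensor ws \<omega>s')) =
    (\<Prod>(i, j) | i < j \<and> j < ?n. parity_sign (qs' ! i * ps' ! j)) *\<^sub>C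
      form_tensor (adjoin_list ws) (foldr form_mult \<omega>s' form_one)"
    using Cons.prems(3) \<omega>s by (intro Cons.IH ps qs) auto
  show ?case
    unfolding length_Cons sign
    by (simp add: \<omega>s collect_forms_adjoin IH cbilinear_simps[OF cbilinear_form_bil[OF cbilinear_adjoin]]
        form_bil_tensor[OF cbilinear_adjoin qs(2)] tw adjoin_simps form_tensor_simps mult.commute)
qed

lemma list_mult_form_mult: "\<omega>s \<noteq> [] \<Longrightarrow> list_mult form_mult \<omega>s = foldr form_mult \<omega>s form_one"
proof (induction \<omega>s)
  case (Cons \<omega> \<omega>s)
  have "foldl form_mult (form_mult \<omega> \<eta>) \<zeta>s = form_mult \<omega> (foldl form_mult \<eta> \<zeta>s)" for \<eta> \<zeta>s
    by (induction \<zeta>s arbitrary: \<eta>) (simp_all add: form_mult_assoc)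
  then show ?case using Cons by (cases \<omega>s) (simp_all add: list_mult_def)
qed simp

lemma map2_form_tensor_generators:
  fixes ys :: "'a::graded_space forms list"
  assumes "list_all (\<lambda>y. \<exists>p v q \<omega>. v \<in> gcomp p \<and> \<omega> \<in> gcomp q \<and> y = form_tensor v \<omega>) ys"
  shows "\<exists>ps ws qs \<omega>s. length \<omega>s = length ws \<and> homogeneous ps ws \<and> homogeneous qs \<omega>s \<and> ys = map2 form_tensor ws \<omega>s"
  using assms
proof (induction ys)
  case Nil
  show ?case by (intro exI[of _ "[]"]) simp
next
  case (Cons y ys)
  then obtain ps ws qs \<omega>s p v q \<omega> where *: "length \<omega>s = length ws" "homogeneous ps ws" "homogeneous qs \<omega>s"
    "ys = map2 form_tensor ws \<omega>s" "v \<in> gcomp p" "\<omega> \<in> gcomp q" "y = form_tensor v \<omega>"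
    by auto
  show ?case
    by (intro exI[of _ "p # ps"] exI[of _ "v # ws"] exI[of _ "q # qs"] exI[of _ "\<omega> # \<omega>s"])
      (use * in \<open>auto simp: homogeneous_Cons\<close>)
qed

text \<open>Decomposable forms generate, so the components of a coderivation need only be known on them.\<close>

lemma coderivation_forms_unique:
  fixes R R' :: "'a::graded_space forms sym \<Rightarrow> 'a forms sym"
  assumes R: "coderivation R" and R': "coderivation R'"
    and eq: "\<And>ps ws qs \<omega>s. ws \<noteq> [] \<Longrightarrow> length \<omega>s = length ws \<Longrightarrow> homogeneous ps ws \<Longrightarrow> homogeneous qs \<omega>s \<Longrightarrow>
      sym_proj (R (\<Odot> (map2 form_tensor ws \<omega>s))) = sym_proj (R' (\<Odot> (map2 form_tensor ws \<omega>s)))"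
  shows "R = R'"
proof (rule coderivation_unique[OF R R'])
  note lin = clinear_simps[OF coderivation_linear[OF R]] clinear_simps[OF coderivation_linear[OF R']]
    clinear_simps[OF clinear_sym_proj]
  let ?G = "\<lambda>y :: 'a forms. \<exists>p v q \<omega>. v \<in> gcomp p \<and> \<omega> \<in> gcomp q \<and> y = form_tensor v \<omega>"
  let ?P = "\<lambda>y. sym_proj (R y) = sym_proj (R' y)"
  have generate: "Q x" if Q: "\<And>x. ?G x \<Longrightarrow> Q x" "\<And>x y. Q x \<Longrightarrow> Q y \<Longrightarrow> Q (x + y)" for Q x
  proof (induction x rule: graded_induct)
    case (1 p x)
    then show ?case by (induction rule: forms_gcomp_induct) (use Q in blast)+
  qed (rule Q(2))
  have "?P (\<Odot> xs)" for xs
  proof (rule sym_prod_generators_induct[of ?G xs ?P])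
    show "Q x" if "\<And>x. ?G x \<Longrightarrow> Q x" "\<And>x y. Q x \<Longrightarrow> Q y \<Longrightarrow> Q (x + y)" for Q x
      using that by (rule generate)
    fix ys assume "list_all ?G ys"
    from map2_form_tensor_generators[OF this] obtain ps ws qs \<omega>s where *: "length \<omega>s = length ws"
      "homogeneous ps ws" "homogeneous qs \<omega>s" "ys = map2 form_tensor ws \<omega>s" by blast
    then show "?P (\<Odot> ys)" using eq[of ws \<omega>s ps qs] by (cases "ws = []") (simp_all add: lin)
  qed (simp_all add: lin)
  then show "?P y" for y
    by (induction y rule: sym_induct) (simp_all add: lin)
qed

text \<open>The commutator of a derivation \<open>\<delta>\<close> with \<open>mult_action m x\<close> is \<open>mult_action m (\<delta> x)\<close>. Hence \<open>\<delta>\<close>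
  satisfies the same recursion before and after the cumulant map; this is why transport does
  not change the de Rham part.\<close>

lemma ucumulant_derivation:
  assumes m: "graded_algebra m" and \<delta>: "graded_map k \<delta>"
    and derivation: "\<And>p x y. x \<in> gcomp p \<Longrightarrow> \<delta> (m x y) = m (\<delta> x) y + parity_sign (k * p) *\<^sub>C m x (\<delta> y)"
  shows "ucumulant m (uder k \<delta> 0 y) = uder k \<delta> 0 (ucumulant m y)"
proof (induction y rule: unital_sym_induct)
  case unit
  show ?case by (simp add: uder_unit[OF \<delta>] ucumulant_unit[OF m] adjoin_simps ucumulant_simps[OF m])
next
  case (adjoin p x y)
  have dx: "\<delta> x \<in> gcomp (k + p)" using graded_map_gcomp[OF \<delta> adjoin(1)] by (simp add: add.commute)
  have "uder k \<delta> 0 (uder p (m x) x z) = uder (k + p) (m (\<delta> x)) (\<delta> x) z + parity_sign (k * p) *\<^sub>C uder p (m x) x (uder k \<delta> 0 z)" for z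
    by (rule uder_bracket[OF \<delta> graded_map_mult[OF m adjoin(1)] graded_map_mult[OF m dx] gcomp_0 adjoin(1)])
      (simp_all add: derivation[OF adjoin(1)] mult_simps[OF m])
  then show ?case
    by (simp add: uder_adjoin[OF \<delta>] ucumulant_simps[OF m] ucumulant_adjoin[OF m adjoin(1)] ucumulant_adjoin[OF m dx]
        twist_homogeneous[OF adjoin(1)] adjoin_simps adjoin(2))
qed (simp_all add: uder_simps[OF \<delta>] ucumulant_simps[OF m])

lemma form_derham_mult:
  assumes m: "graded_algebra m" and x: "x \<in> gcomp p"
  shows "form_derham (form_bil m x y) =
    form_bil m (form_derham x) y + parity_sign (1 * p) *\<^sub>C form_bil m x (form_derham y)"
proof -
  note gm = graded_bilinear_mult[OF m] and b = cbilinear_mult[OF m]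
  note lin = cbilinear_simps[OF cbilinear_form_bil[OF b]] clinear_simps[OF clinear_form_derham]
  show ?thesis using x
  proof (induction rule: forms_gcomp_induct)
    case x: (tensor v q \<omega>)
    show ?case
    proof (induction y rule: forms_induct)
      case y: (tensor w r \<eta>)
      show ?case
        by (simp add: form_bil_tensor[OF b x(2)] form_bil_tensor[OF b de_rham_gcomp[OF x(2)]] form_derham_tensor
            twist_bilinear[OF gm] twist_twist de_rham_mult[OF x(2)] form_tensor_simps twist_homogeneous[OF x(1)]
            mult_simps[OF m] lin scaleC_add_right add.commute)
          (auto simp: parity_sign_if scaleC_minus_left)
    qed (simp add: lin scaleC_add_right)
  qed (simp add: lin scaleC_add_right)
qed

definition total_differential :: "('a::graded_space \<Rightarrow> 'a) \<Rightarrow> 'a forms \<Rightarrow> 'a forms" where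
  "total_differential d x = forms_map d x + form_derham x"

lemma total_differential_tensor:
  "clinear d \<Longrightarrow> total_differential d (form_tensor v \<omega>) = form_tensor (d v) \<omega> + form_tensor (twist 1 v) (de_rham \<omega>)"
  by (simp add: total_differential_def forms_map_tensor form_derham_tensor)

lemma graded_map_total_differential:
  assumes "graded_map 1 d"
  shows "graded_map 1 (total_differential d)"
  unfolding total_differential_def
  using graded_map_forms_map[OF assms] graded_map_form_derham
  by (intro graded_mapI clinear_plus gcomp_add) (auto dest: graded_map_linear graded_map_gcomp)

lemma total_differential_square:
  assumes d: "graded_map 1 d" and dd: "\<And>v. d (d v) = 0"
  shows "total_differential d (total_differential d x) = 0"
proof -
  note lin = clinear_simps[OF graded_map_linear[OF graded_map_total_differential[OF d]]]
  show ?thesis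
    by (induction x rule: forms_induct)
      (simp_all add: lin total_differential_tensor[OF graded_map_linear[OF d]] dd de_rham_de_rham form_tensor_simps
        graded_map_twist[OF d] scaleC_minus_left)
qed

lemma inv_cumulant_map:
  assumes m: "graded_algebra m"
  shows "(0, inv (cumulant_map m) y) = inv (ucumulant m) (0, y)"
proof -
  have "ucumulant m (0, z) = (0, cumulant_map m z)" for z
    by (simp add: cumulant_map_eq[OF m] reduce_eq fst_ucumulant[OF m])
  from this[of "inv (cumulant_map m) y"] have "ucumulant m (0, inv (cumulant_map m) y) = (0, y)"
    using bij_cumulant_map[OF m] by (simp add: bij_is_surj surj_f_inv_f)
  then show ?thesis by (simp only: bij_inv_eq_iff[OF bij_ucumulant[OF m]])
qed

lemma conjugate_reduce_uder:
  assumes m: "graded_algebra m" and \<delta>: "graded_map 1 \<delta>"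
  shows "(0, inv (cumulant_map m) (reduce (uder 1 \<delta> 0) (cumulant_map m y))) =
    inv (ucumulant m) (uder 1 \<delta> 0 (ucumulant m (0, y)))"
proof -
  have "ucumulant m (0, y) = (0, cumulant_map m y)"
    by (simp add: cumulant_map_eq[OF m] reduce_eq fst_ucumulant[OF m])
  moreover have "uder 1 \<delta> 0 (0, z) = (0, reduce (uder 1 \<delta> 0) z)" for z
    by (simp add: reduce_eq fst_uder[OF \<delta>])
  ultimately show ?thesis by (simp add: inv_cumulant_map[OF m])
qed

lemma transported_structure_eq:
  assumes "graded_map 1 d"
  shows "transported_structure d m = inv (cumulant_map m) \<circ> reduce (uder 1 d 0) \<circ> cumulant_map m"
  by (simp add: transported_structure_def transport_def coderivation_of_linear_part[OF assms])

lemma collect_forms_inv_ucumulant: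
  assumes m: "graded_algebra m"
  shows "collect_forms (inv (ucumulant (form_bil m)) y) = forms_map (inv (ucumulant m)) (collect_forms y)"
proof -
  note mt = graded_algebra_form_bil[OF m]
  note l = clinear_ucumulant[OF m] and li = clinear_inv[OF clinear_ucumulant[OF m] bij_ucumulant[OF m]]
  let ?z = "inv (ucumulant (form_bil m)) y"
  have "collect_forms y = forms_map (ucumulant m) (collect_forms ?z)"
    using collect_forms_ucumulant[OF m, of ?z] bij_ucumulant[OF mt] by (simp add: bij_is_surj surj_f_inv_f)
  moreover have "forms_map (inv (ucumulant m)) (forms_map (ucumulant m) z) = z" for z
  proof -
    have "forms_map (inv (ucumulant m)) (forms_map (ucumulant m) z) = forms_map (\<lambda>x. x) z"
      using bij_ucumulant[OF m] by (simp add: forms_map_compose[OF li l] bij_is_inj)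
    also have "\<dots> = z" by (simp add: forms_map_def form_lift_form_tensor)
    finally show ?thesis .
  qed
  ultimately show ?thesis by simp
qed

text \<open>Transport along the cumulant map commutes with tensoring by \<open>\<complex>[t,dt]\<close>. The coderivation
  extending the total differential is the sum of the one for \<open>d\<close> and the one for the de Rham
  differential. After collecting forms the first becomes the structure on \<open>V\<close> applied to the
  \<open>V\<close>-factor, and the second commutes with the cumulant map, so it contributes only to the
  linear operation.\<close>

theorem forms_structure_transported:
  fixes m :: "'a::graded_space \<Rightarrow> 'a \<Rightarrow> 'a"
  assumes m: "graded_algebra m" and d: "graded_map 1 d"
  shows "forms_structure (transported_structure d m) = transported_structure (total_differential d) (form_bil m)"
    (is "_ = ?R")
proof -
  note mt = graded_algebra_form_bil[OF m] and D = graded_map_total_differential[OF d]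
    and d1 = graded_map_forms_map[OF d]
  let ?\<psi>t = "inv (ucumulant (form_bil m))" and ?\<phi>t = "ucumulant (form_bil m)"
    and ?\<psi> = "inv (ucumulant m)" and ?\<phi> = "ucumulant m"
  note l\<psi>t = clinear_inv[OF clinear_ucumulant[OF mt] bij_ucumulant[OF mt]]
    and l\<psi> = clinear_inv[OF clinear_ucumulant[OF m] bij_ucumulant[OF m]]
    and lD = clinear_uder[OF d, of 0] and l\<phi> = clinear_ucumulant[OF m]
  have \<psi>\<phi>: "?\<psi>t (?\<phi>t y) = y" for y using bij_ucumulant[OF mt] by (simp add: bij_is_inj)
  have R: "coderivation ?R"
    unfolding transported_structure_eq[OF D]
    by (intro coderivation_conjugate coalgebra_map_cumulant_map sym_has_degree_cumulant_map bij_cumulant_map mt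
        coderivation_reduce_uder D)
  have uproj_R: "sym_proj (?R y) = forms_map (\<lambda>z. uproj (?\<psi> (uder 1 d 0 (?\<phi> z)))) (collect_forms (0, y))
      + form_derham (sym_proj y)" for y
  proof -
    have "sym_proj (?R y) = uproj (0, ?R y)" by (simp add: uproj_def)
    also have "(0, ?R y) = ?\<psi>t (uder 1 (total_differential d) 0 (?\<phi>t (0, y)))"
      unfolding transported_structure_eq[OF D] o_apply by (rule conjugate_reduce_uder[OF mt D])
    also have "uder 1 (total_differential d) 0 z = uder 1 (forms_map d) 0 z + uder 1 form_derham 0 z" for z
      using uder_add[OF d1 graded_map_form_derham, of 0 0 z] by (simp add: total_differential_def[abs_def])
    also have "uder 1 form_derham 0 (?\<phi>t (0, y)) = ?\<phi>t (uder 1 form_derham 0 (0, y))"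
      by (rule ucumulant_derivation[OF mt graded_map_form_derham form_derham_mult[OF m], symmetric])
    also have "?\<psi>t (uder 1 (forms_map d) 0 (?\<phi>t (0, y)) + ?\<phi>t (uder 1 form_derham 0 (0, y))) =
        ?\<psi>t (uder 1 (forms_map d) 0 (?\<phi>t (0, y))) + uder 1 form_derham 0 (0, y)"
      by (simp add: clinear_add[OF l\<psi>t] \<psi>\<phi>)
    also have "uproj \<dots> = uproj (?\<psi>t (uder 1 (forms_map d) 0 (?\<phi>t (0, y)))) + form_derham (sym_proj y)"
      by (simp add: uproj_simps uproj_uder[OF graded_map_form_derham]) (simp add: uproj_def)
    also have "uproj (?\<psi>t (uder 1 (forms_map d) 0 (?\<phi>t (0, y)))) =
        forms_map uproj (forms_map ?\<psi> (forms_map (uder 1 d 0) (forms_map ?\<phi> (collect_forms (0, y)))))"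
      by (simp add: collect_forms_inv_ucumulant[OF m] collect_forms_uder[OF d] collect_forms_ucumulant[OF m]
          flip: forms_map_uproj_collect_forms)
    also have "\<dots> = forms_map (\<lambda>z. uproj (?\<psi> (uder 1 d 0 (?\<phi> z)))) (collect_forms (0, y))"
      by (simp only: forms_map_compose[OF lD l\<phi>] forms_map_compose[OF l\<psi> clinear_compose[OF lD l\<phi>]]
          forms_map_compose[OF clinear_uproj clinear_compose[OF l\<psi> clinear_compose[OF lD l\<phi>]]])
    finally show ?thesis .
  qed
  have lQ: "clinear (\<lambda>z. uproj (?\<psi> (uder 1 d 0 (?\<phi> z))))"
    by (intro clinear_compose[OF clinear_uproj] clinear_compose[OF l\<psi>] clinear_compose[OF clinear_uder[OF d]]
        clinear_ucumulant[OF m])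
  have Q: "uproj (?\<psi> (uder 1 d 0 (?\<phi> (adjoin_list ws)))) = sym_proj (transported_structure d m (\<Odot> ws))"
    if "ws \<noteq> []" for ws
    using conjugate_reduce_uder[OF m d, of "\<Odot> ws"] that
    unfolding transported_structure_eq[OF d] o_apply
    by (simp add: adjoin_list_eq uproj_def) (metis snd_conv)
  have comp: "sym_proj (?R (\<Odot> (map2 form_tensor ws \<omega>s))) =
      (\<Prod>(i, j) | i < j \<and> j < length ws. parity_sign (qs ! i * ps ! j))
        *\<^sub>C form_tensor (sym_proj (transported_structure d m (\<Odot> ws))) (list_mult form_mult \<omega>s)
      + (if length ws = 1 then parity_sign (hd ps) *\<^sub>C form_tensor (hd ws) (de_rham (hd \<omega>s)) else 0)"
    if ws: "ws \<noteq> []" "length \<omega>s = length ws" "homogeneous ps ws" "homogeneous qs \<omega>s" for ps ws qs \<omega>s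
  proof -
    have "\<omega>s \<noteq> []" "map2 form_tensor ws \<omega>s \<noteq> []" using ws by auto
    then have collect: "collect_forms (0, \<Odot> (map2 form_tensor ws \<omega>s)) =
        (\<Prod>(i, j) | i < j \<and> j < length ws. parity_sign (qs ! i * ps ! j)) *\<^sub>C
          form_tensor (adjoin_list ws) (list_mult form_mult \<omega>s)"
      using collect_forms_adjoin_list[OF ws(3,4,2)]
      by (simp add: list_mult_form_mult adjoin_list_eq[of "map2 form_tensor ws \<omega>s"])
    have derham: "form_derham (sym_proj (\<Odot> (map2 form_tensor ws \<omega>s))) =
        (if length ws = 1 then parity_sign (hd ps) *\<^sub>C form_tensor (hd ws) (de_rham (hd \<omega>s)) else 0)"
    proof (cases "length ws = 1")
      case True
      then obtain w where w: "ws = [w]" by (cases ws) auto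
      obtain \<omega> where \<omega>: "\<omega>s = [\<omega>]" using ws(2) w by (cases \<omega>s) auto
      obtain p where "ps = [p]" "w \<in> gcomp p" using ws(3) w by (auto simp: homogeneous_Cons)
      then show ?thesis by (simp add: w \<omega> sym_proj_prod form_derham_tensor twist_homogeneous form_tensor_simps)
    next
      case False
      then show ?thesis using ws(2) by (simp add: sym_proj_prod clinear_0[OF clinear_form_derham])
    qed
    show ?thesis
      unfolding uproj_R derham collect
      by (simp add: clinear_scale[OF clinear_forms_map[OF lQ]] forms_map_tensor[OF lQ] Q[OF ws(1)])
  qed
  show ?thesis
    unfolding forms_structure_def
  proof (rule the_equality)
    show "coderivation ?R \<and> (\<forall>ps ws qs \<omega>s. ws \<noteq> [] \<and> length \<omega>s = length ws \<and> homogeneous ps ws \<and> homogeneous qs \<omega>s \<longrightarrow>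
      sym_proj (?R (\<Odot> (map2 form_tensor ws \<omega>s))) =
        (\<Prod>(i, j) | i < j \<and> j < length ws. parity_sign (qs ! i * ps ! j))
          *\<^sub>C form_tensor (sym_proj (transported_structure d m (\<Odot> ws))) (list_mult form_mult \<omega>s)
        + (if length ws = 1 then parity_sign (hd ps) *\<^sub>C form_tensor (hd ws) (de_rham (hd \<omega>s)) else 0))"
      using R comp by blast
    fix R' :: "'a forms sym \<Rightarrow> 'a forms sym"
    assume R': "coderivation R' \<and> (\<forall>ps ws qs \<omega>s. ws \<noteq> [] \<and> length \<omega>s = length ws \<and> homogeneous ps ws \<and> homogeneous qs \<omega>s \<longrightarrow>
      sym_proj (R' (\<Odot> (map2 form_tensor ws \<omega>s))) =
        (\<Prod>(i, j) | i < j \<and> j < length ws. parity_sign (qs ! i * ps ! j))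
          *\<^sub>C form_tensor (sym_proj (transported_structure d m (\<Odot> ws))) (list_mult form_mult \<omega>s)
        + (if length ws = 1 then parity_sign (hd ps) *\<^sub>C form_tensor (hd ws) (de_rham (hd \<omega>s)) else 0))"
    show "R' = ?R"
    proof (rule coderivation_forms_unique[OF conjunct1[OF R'] R])
      fix ps qs :: "int list" and ws :: "'a list" and \<omega>s :: "complex forms list"
      assume ws: "ws \<noteq> []" "length \<omega>s = length ws" "homogeneous ps ws" "homogeneous qs \<omega>s"
      show "sym_proj (R' (\<Odot> (map2 form_tensor ws \<omega>s))) = sym_proj (?R (\<Odot> (map2 form_tensor ws \<omega>s)))"
        unfolding comp[OF ws] using R' ws by blast
    qed
  qed
qed

section \<open>Morphisms out of a vector space with zero structure\<close>

lemma graded_map_sym_proj: "graded_map 0 sym_proj"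
proof (rule graded_map_gpartI[OF clinear_sym_proj])
  show "gpart (p + 0) (sym_proj y) = sym_proj (gpart p y)" for p and y :: "'a sym"
  proof (induction y rule: sym_homogeneous_induct)
    case (prod ps xs)
    show ?case
    proof (cases "length xs = 1")
      case True
      then obtain x where x: "xs = [x]" by (cases xs) auto
      then obtain p' where "ps = [p']" "x \<in> gcomp p'" using prod by (auto simp: homogeneous_Cons)
      then show ?thesis
        using gpart_homogeneous[OF sym_prod_gcomp[OF prod], of p]
        by (auto simp: x sym_proj_prod gpart_homogeneous clinear_0[OF clinear_sym_proj])
    next
      case False
      then show ?thesis
        using gpart_homogeneous[OF sym_prod_gcomp[OF prod], of p]
        by (auto simp: sym_proj_prod clinear_0[OF clinear_sym_proj])
    qed
  qed (simp_all add: clinear_simps[OF clinear_sym_proj] gpart_add gpart_scaleC)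
qed

lemma sym_proj_uder: "graded_map 1 \<delta> \<Longrightarrow> sym_proj (reduce (uder 1 \<delta> 0) y) = \<delta> (sym_proj y)"
  by (simp add: sym_proj_reduce uproj_uder) (simp add: uproj_def)

lemma sym_proj_ufunct: "graded_map 0 a \<Longrightarrow> sym_proj (reduce (ufunct a) y) = a (sym_proj y)"
  by (simp add: sym_proj_reduce uproj_ufunct) (simp add: uproj_def)

lemma uder_uder:
  assumes \<delta>: "graded_map 1 \<delta>" and "\<And>x. \<delta> (\<delta> x) = 0"
  shows "uder 1 \<delta> 0 (uder 1 \<delta> 0 y) = 0"
proof -
  have "uder 1 \<delta> 0 (uder 1 \<delta> 0 y) = uder (1 + 1) (\<lambda>_. 0) 0 y + parity_sign (1 * 1) *\<^sub>C uder 1 \<delta> 0 (uder 1 \<delta> 0 y)"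
    by (rule uder_bracket[OF \<delta> \<delta> graded_map_zero gcomp_0 gcomp_0])
      (simp_all add: assms(2) clinear_0[OF graded_map_linear[OF \<delta>]])
  then have "2 *\<^sub>C uder 1 \<delta> 0 (uder 1 \<delta> 0 y) = 0"
    by (simp add: uder_zero_derivation[OF gcomp_0] adjoin_simps scaleC_2 scaleC_minus_left eq_neg_iff_add_eq_0)
  then show ?thesis by simp
qed

lemma linfty_structure_transported:
  assumes m: "graded_algebra m" and \<delta>: "graded_map 1 \<delta>" and "\<And>x. \<delta> (\<delta> x) = 0"
  shows "linfty_structure (transported_structure \<delta> m)"
proof -
  let ?\<phi> = "cumulant_map m" and ?D = "reduce (uder 1 \<delta> 0)"
  have "?\<phi> (inv ?\<phi> y) = y" for y using bij_cumulant_map[OF m] by (simp add: bij_is_surj surj_f_inv_f)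
  moreover have "?D (?D y) = 0" for y
    by (simp add: reduce_compose[OF fst_uder[OF \<delta>]]) (simp add: reduce_def uder_uder[OF \<delta> assms(3)])
  moreover have "clinear (inv ?\<phi>)"
    using clinear_inv[OF clinear_coalgebra_map[OF coalgebra_map_cumulant_map[OF m]] bij_cumulant_map[OF m]] .
  moreover have "coderivation (inv ?\<phi> \<circ> ?D \<circ> ?\<phi>)"
    by (intro coderivation_conjugate coalgebra_map_cumulant_map sym_has_degree_cumulant_map bij_cumulant_map m
        coderivation_reduce_uder \<delta>)
  ultimately show ?thesis
    by (simp add: linfty_structure_def transported_structure_eq[OF \<delta>] fun_eq_iff clinear_0)
qed

text \<open>The source has zero structure, so the transported structure kills the image of \<open>H\<close>. Applying
  the cumulant map, the coderivation extending \<open>\<delta>\<close> kills it, and the projection to \<open>V\<close> turns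
  this coderivation into \<open>\<delta>\<close>.\<close>

lemma zero_morphism_components:
  assumes m: "graded_algebra m" and \<delta>: "graded_map 1 \<delta>"
    and H: "linfty_morphism (\<lambda>_. 0) (transported_structure \<delta> m) H"
  shows "graded_map 0 (\<lambda>y. sym_proj (cumulant_map m (H y)))" "\<delta> (sym_proj (cumulant_map m (H y))) = 0"
proof -
  let ?\<phi> = "cumulant_map m" and ?D = "reduce (uder 1 \<delta> 0)"
  have H': "coalgebra_map H" "sym_has_degree 0 H" "H \<circ> (\<lambda>_. 0) = transported_structure \<delta> m \<circ> H"
    using H by (simp_all only: linfty_morphism_def)
  note lH = clinear_coalgebra_map[OF H'(1)] and l\<phi> = clinear_coalgebra_map[OF coalgebra_map_cumulant_map[OF m]]
  have gH: "graded_map 0 H" using lH H'(2) by (simp add: graded_map_def sym_has_degree_iff)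
  have g\<phi>: "graded_map 0 ?\<phi>" using l\<phi> sym_has_degree_cumulant_map[OF m] by (simp add: graded_map_def sym_has_degree_iff)
  show "graded_map 0 (\<lambda>y. sym_proj (?\<phi> (H y)))"
  proof (rule graded_mapI)
    show "sym_proj (?\<phi> (H y)) \<in> gcomp (p + 0)" if "y \<in> gcomp p" for p y
      using graded_map_gcomp[OF graded_map_sym_proj graded_map_gcomp[OF g\<phi> graded_map_gcomp[OF gH that]]] by simp
  qed (intro clinear_compose[OF clinear_sym_proj] clinear_compose[OF l\<phi>] lH)
  have "inv ?\<phi> (?D (?\<phi> (H y))) = 0"
    using fun_cong[OF H'(3), of y] by (simp add: clinear_0[OF lH] transported_structure_eq[OF \<delta>])
  then have "?\<phi> (inv ?\<phi> (?D (?\<phi> (H y)))) = 0" by (simp add: clinear_0[OF l\<phi>])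
  then have "?D (?\<phi> (H y)) = 0" using bij_cumulant_map[OF m] by (simp add: bij_is_surj surj_f_inv_f)
  then show "\<delta> (sym_proj (?\<phi> (H y))) = 0"
    using sym_proj_uder[OF \<delta>, of "?\<phi> (H y)"] by (simp add: clinear_0[OF clinear_sym_proj])
qed

text \<open>The converse: the cofree lift of \<open>f\<close> is killed by the linear coderivation, and the inverse
  of the cumulant map carries it back.\<close>

lemma zero_morphism_exists:
  assumes m: "graded_algebra m" and \<delta>: "graded_map 1 \<delta>" and \<delta>\<delta>: "\<And>x. \<delta> (\<delta> x) = 0"
    and f: "graded_map 0 f" "\<And>y. \<delta> (f y) = 0" and zero: "linfty_structure (\<lambda>_ :: 'u::graded_space sym. 0)"
  shows "\<exists>H. linfty_morphism (\<lambda>_ :: 'u sym. 0) (transported_structure \<delta> m) H \<and>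
    (\<forall>y. sym_proj (cumulant_map m (H y)) = f y)"
proof -
  let ?\<phi> = "cumulant_map m" and ?F = "reduce (cofree_lift f)" and ?D = "reduce (uder 1 \<delta> 0)"
  let ?H = "inv ?\<phi> \<circ> ?F"
  note c\<phi> = coalgebra_map_cumulant_map[OF m] and b\<phi> = bij_cumulant_map[OF m]
  note l\<phi> = clinear_coalgebra_map[OF c\<phi>] and F = coalgebra_map_reduce[OF unital_coalgebra_map_cofree_lift[OF f(1)]]
  note li = clinear_inv[OF l\<phi> b\<phi>]
  have \<phi>i: "?\<phi> (inv ?\<phi> y) = y" for y using b\<phi> by (simp add: bij_is_surj surj_f_inv_f)
  have fst: "fst (cofree_lift f (0, y)) = 0" for y
    by (simp add: unital_coalgebra_map_fst[OF unital_coalgebra_map_cofree_lift[OF f(1)]])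
  have "?D (?F y) = 0" for y
    unfolding reduce_compose[of "cofree_lift f", OF fst]
    by (simp add: reduce_def uder_cofree_lift[OF f(1) \<delta> f(2)])
  then have "?H \<circ> (\<lambda>_. 0) = transported_structure \<delta> m \<circ> ?H"
    by (simp add: fun_eq_iff transported_structure_eq[OF \<delta>] \<phi>i clinear_0[OF li] clinear_0[OF clinear_coalgebra_map[OF F(1)]])
  moreover have "has_degree (0 + 0) ?H"
    using F(2) has_degree_inv[OF l\<phi> _ b\<phi>] sym_has_degree_cumulant_map[OF m]
    by (intro has_degree_compose) (simp_all add: sym_has_degree_iff)
  ultimately have "linfty_morphism (\<lambda>_ :: 'u sym. 0) (transported_structure \<delta> m) ?H"
    using zero linfty_structure_transported[OF m \<delta> \<delta>\<delta>] coalgebra_map_compose[OF coalgebra_map_inv[OF c\<phi> b\<phi>] F(1)]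
    by (simp only: linfty_morphism_def sym_has_degree_iff simp_thms add_0_left)
  moreover have "sym_proj (?\<phi> (?H y)) = f y" for y
    by (simp add: \<phi>i sym_proj_reduce uproj_cofree_lift[OF f(1)])
  ultimately show ?thesis by blast
qed

lemma cumulant_map_ufunct:
  assumes "graded_map 0 a" "graded_algebra m" "graded_algebra m'" "\<And>x y. a (m x y) = m' (a x) (a y)"
  shows "reduce (ufunct a) (cumulant_map m y) = cumulant_map m' (reduce (ufunct a) y)"
proof -
  have "reduce (ufunct a) (reduce (ucumulant m) y) = reduce (\<lambda>y. ufunct a (ucumulant m y)) y"
    by (rule reduce_compose) (simp add: fst_ucumulant[OF assms(2)])
  moreover have "reduce (ucumulant m') (reduce (ufunct a) y) = reduce (\<lambda>y. ucumulant m' (ufunct a y)) y"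
    by (rule reduce_compose) (simp add: fst_ufunct[OF assms(1)])
  moreover have "ufunct a (ucumulant m z) = ucumulant m' (ufunct a z)" for z
    by (rule ufunct_ucumulant[OF assms(1-3)]) (rule assms(4))
  ultimately show ?thesis
    by (simp only: cumulant_map_eq[OF assms(2)] cumulant_map_eq[OF assms(3)])
qed

lemma coalgebra_maps_into_algebra_eqI:
  assumes m: "graded_algebra m" and X: "coalgebra_map X" and Y: "coalgebra_map Y"
    and eq: "\<And>y. sym_proj (cumulant_map m (X y)) = sym_proj (cumulant_map m (Y y))"
  shows "X = Y"
proof -
  have "cumulant_map m \<circ> X = cumulant_map m \<circ> Y"
    by (rule coalgebra_map_unique) (simp_all add: coalgebra_map_compose coalgebra_map_cumulant_map m X Y eq)
  then show ?thesis using bij_is_inj[OF bij_cumulant_map[OF m]] by (simp add: fun_eq_iff inj_eq)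
qed

section \<open>The complex numbers\<close>

lemma complex_gcomp: "(x :: complex) \<in> gcomp p \<longleftrightarrow> p = 0 \<or> x = 0"
  by (auto simp: gcomp_iff gpart_complex_def)

lemma graded_algebra_complex: "graded_algebra ((*) :: complex \<Rightarrow> complex \<Rightarrow> complex)"
  by (auto simp: graded_algebra_def complex_gcomp scaleC_complex_def algebra_simps intro!: cbilinearI clinearI)

lemma sym_degree_zero: "(y :: (complex ^ 'n) sym) \<in> gcomp 0"
proof (induction y rule: sym_induct)
  case (prod xs)
  have "homogeneous (replicate (length xs) 0) xs"
    by (induction xs) (simp_all add: homogeneous_Cons gcomp_iff gpart_vec_def gpart_complex_def vec_eq_iff)
  from sym_prod_gcomp[OF this] show ?case by (simp add: sum_list_replicate)
qed (auto intro: gcomp_add gcomp_scale)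

lemma graded_map_degree_zero_sym:
  fixes f :: "(complex ^ 'n) sym \<Rightarrow> 'a::graded_space"
  assumes f: "clinear f" "\<And>y. f y \<in> gcomp k"
  shows "graded_map k f"
proof (rule graded_mapI[OF f(1)])
  fix p and y :: "(complex ^ 'n) sym" assume y: "y \<in> gcomp p"
  show "f y \<in> gcomp (p + k)"
  proof (cases "p = 0")
    case False
    have "gpart p y = 0" using gpart_homogeneous[OF sym_degree_zero, of p y] False by simp
    then have "y = 0" using y by (simp add: gcomp_iff)
    then show ?thesis by (simp add: clinear_0[OF f(1)] gcomp_0)
  qed (use f(2) in simp)
qed

section \<open>Cocycles of polynomial forms\<close>

lemma eval_form_form_bil:
  assumes m: "cbilinear m"
  shows "eval_form s (form_bil m x y) = m (eval_form s x) (eval_form s y)"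
proof -
  note lin = clinear_simps[OF clinear_eval_form] cbilinear_simps[OF cbilinear_form_bil[OF m]] cbilinear_simps[OF m]
  show ?thesis
  proof (induction x rule: forms_induct)
    case x: (tensor v q \<omega>)
    show ?case
    proof (induction y rule: forms_induct)
      case (tensor w r \<eta>)
      show ?case
        by (rule complex_form_gcomp[OF x])
          (simp_all add: form_bil_tensor[OF m x] eval_form_tensor form_tensor_simps lin mult.commute)
    qed (simp add: lin)
  qed (simp add: lin)
qed

lemma eval_form_forms_map:
  assumes e: "clinear e"
  shows "eval_form s (forms_map e x) = e (eval_form s x)"
  by (induction x rule: forms_induct)
    (simp_all add: forms_map_tensor[OF e] eval_form_tensor clinear_simps[OF e] clinear_simps[OF clinear_eval_form]
      clinear_simps[OF clinear_forms_map[OF e]])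

text \<open>Since \<open>e\<close> is a chain map to \<open>(\<complex>, 0)\<close>, it sends closed forms with values in \<open>V\<close> to closed
  complex forms, and a polynomial with vanishing derivative is constant.\<close>

lemma closed_form_end_points:
  fixes e :: "'a::graded_space \<Rightarrow> complex"
  assumes d: "clinear d" and e: "graded_map 0 e" and ed: "\<And>x. e (d x) = 0"
    and closed: "total_differential d x = 0"
  shows "e (eval_form 0 x) = e (eval_form 1 x)"
proof -
  note le = graded_map_linear[OF e]
  note lin = clinear_simps[OF clinear_forms_map[OF le]] clinear_simps[OF clinear_de_rham]
  have l: "clinear (total_differential d)"
    unfolding total_differential_def by (intro clinear_plus clinear_forms_map[OF d] clinear_form_derham)
  have tensor: "form_tensor c \<omega> = c *\<^sub>C \<omega>" for c and \<omega> :: "complex forms"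
    by (simp add: forms_eq_iff scaleC_complex_def mult.commute)
  have "e (twist 1 v) = e v" for v using graded_map_twist[OF e, of 1 v] by simp
  then have "forms_map e (total_differential d x) = de_rham (forms_map e x)" for x
    by (induction x rule: forms_induct)
      (simp_all add: total_differential_tensor[OF d] lin forms_map_tensor[OF le] ed form_tensor_simps
        clinear_add[OF l] tensor)
  from this[of x] have "de_rham (forms_map e x) = 0" by (simp add: closed lin)
  then have "pderiv (fun_part (forms_map e x)) = 0" by (simp add: de_rham_def zero_forms_def)
  then obtain a where a: "fun_part (forms_map e x) = [:a:]"
    by (auto simp: pderiv_eq_0_iff elim: degree_eq_zeroE)
  have "eval_form s (forms_map e x) = a" for s
    by (simp add: eval_form_def a scaleC_complex_def)
  then show ?thesis using eval_form_forms_map[OF le] by metis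
qed

text \<open>The form \<open>a + (b - a) t - h dt\<close>: if \<open>d h = b - a\<close>, the term \<open>d h dt\<close> cancels the derivative
  of the middle term.\<close>

definition joining_form :: "'a::graded_space \<Rightarrow> 'a \<Rightarrow> 'a \<Rightarrow> 'a forms" where
  "joining_form a b h = form_tensor a form_one + form_tensor (b - a) (Forms [:0, 1:] 0) - form_tensor h (Forms 0 1)"

lemma joining_form_gcomp:
  assumes "a \<in> gcomp 0" "b \<in> gcomp 0" "h \<in> gcomp (-1)"
  shows "joining_form a b h \<in> gcomp 0"
  unfolding joining_form_def
  using form_tensor_gcomp[OF assms(1) form_one_gcomp] form_tensor_gcomp[OF gcomp_diff[OF assms(2,1)] form_gcompI(1)]
    form_tensor_gcomp[OF assms(3) form_gcompI(2)]
  by (intro gcomp_add gcomp_diff) simp_all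

lemma eval_joining_form: "eval_form 0 (joining_form a b h) = a" "eval_form 1 (joining_form a b h) = b"
  by (simp_all add: joining_form_def clinear_simps[OF clinear_eval_form] eval_form_tensor form_one_def)

lemma joining_form_closed:
  assumes d: "clinear d" and "d a = 0" "d b = 0" "d h = b - a" "a \<in> gcomp 0" "b \<in> gcomp 0"
  shows "total_differential d (joining_form a b h) = 0"
proof -
  have l: "clinear (total_differential d)"
    unfolding total_differential_def by (intro clinear_plus clinear_forms_map[OF d] clinear_form_derham)
  have "de_rham form_one = 0" "de_rham (Forms [:0, 1:] 0) = Forms 0 1" "de_rham (Forms 0 1) = 0"
    by (simp_all add: de_rham_def form_one_def zero_forms_def pderiv_pCons)
  then show ?thesis
    using twist_homogeneous[OF assms(5), of 1] twist_homogeneous[OF assms(6), of 1] assms(2-4)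
    by (simp add: joining_form_def clinear_simps[OF l] total_differential_tensor[OF d] form_tensor_simps clinear_simps[OF d])
qed

section \<open>Contractible probability spaces\<close>

lemma homotopy_probability_spaceD:
  assumes "homotopy_probability_space d m \<upsilon> e"
  shows "graded_algebra m" "graded_map 1 d" "d (d x) = 0" "graded_map 0 e" "e (d x) = 0"
proof -
  note defs = homotopy_probability_space_def chain_complex_def chain_map_def
  show "graded_algebra m"
    using assms unfolding defs graded_algebra_def cbilinear_def by blast
  show "graded_map 1 d" "graded_map 0 e"
    using assms unfolding defs graded_map_def by blast+
  have "d \<circ> d = (\<lambda>_. 0)" "e \<circ> d = (\<lambda>_. 0) \<circ> e"
    using assms unfolding defs by blast+
  then show "d (d x) = 0" "e (d x) = 0" by (simp_all add: fun_eq_iff)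
qed

text \<open>All elements of a cohomology class have the same expectation, so the injectivity of the map
  induced by \<open>e\<close> in degree zero applies to the classes of \<open>a\<close> and \<open>b\<close>.\<close>

lemma contractible_cohomologous:
  assumes d: "clinear d" and e: "contractible_space d e" and a: "a \<in> cocycles d 0" and b: "b \<in> cocycles d 0" and eq: "e a = e b"
  shows "b - a \<in> d ` gcomp (-1)"
proof -
  let ?c = "\<lambda>x. cohomologous d 0 `` {x}"
  have chain: "clinear e" "e \<circ> d = (\<lambda>_. 0) \<circ> e"
    and bij: "bij_betw (\<lambda>c. cohomologous (\<lambda>_. 0) 0 `` (e ` c)) (cohomology d 0) (cohomology (\<lambda>_. 0) 0)"
    using e unfolding contractible_space_def quasi_isomorphism_def chain_map_def by blast+
  have ed: "e (d x) = 0" for x using chain(2) by (simp add: fun_eq_iff)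
  have refl: "x \<in> ?c x" if "x \<in> cocycles d 0" for x
    using that image_eqI[of 0 d 0 "gcomp (-1)"] by (simp add: cohomologous_def gcomp_0 clinear_0[OF d])
  have "e ` ?c x = {e x}" if "x \<in> cocycles d 0" for x
  proof -
    have const: "e z = e x" if "z \<in> ?c x" for z
    proof -
      have "x - z \<in> d ` gcomp (-1)" using that by (simp add: cohomologous_def)
      then obtain h where "x - z = d h" by blast
      then have "e x - e z = 0" using ed[of h] by (simp flip: clinear_diff[OF chain(1)])
      then show ?thesis by simp
    qed
    show ?thesis
    proof
      show "e ` ?c x \<subseteq> {e x}" by (rule image_subsetI) (simp only: const singleton_iff)
      show "{e x} \<subseteq> e ` ?c x" using imageI[OF refl[OF that], of e] by simp
    qed
  qed
  then have im: "e ` ?c a = e ` ?c b" using a b eq by simp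
  have "?c a \<in> cohomology d 0" "?c b \<in> cohomology d 0"
    unfolding cohomology_def using a b by (auto intro: quotientI)
  with im have "?c a = ?c b"
    by (intro inj_onD[OF bij_betw_imp_inj_on[OF bij]]) (simp_all only:)
  then have "a \<in> ?c b" using refl[OF a] by (simp only:)
  then show ?thesis by (simp add: cohomologous_def)
qed

text \<open>The inverse of the cumulant map of \<open>\<complex>\<close> at the end of the total cumulant is injective and can
  be dropped; what remains are coalgebra maps, which are compared by their components.\<close>

lemma joint_cumulant_eq_iff:
  fixes X Y :: "(complex ^ 'n) sym \<Rightarrow> 'v::graded_space sym"
  assumes m: "graded_algebra m" and e: "graded_map 0 e" and X: "coalgebra_map X" and Y: "coalgebra_map Y"
  shows "joint_cumulant m e X = joint_cumulant m e Y \<longleftrightarrow>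
    (\<forall>y. e (sym_proj (cumulant_map m (X y))) = e (sym_proj (cumulant_map m (Y y))))"
proof -
  let ?C = "\<lambda>X. reduce (ufunct e) \<circ> cumulant_map m \<circ> X"
  have inj: "inj (inv (cumulant_map ((*) :: complex \<Rightarrow> _)))"
    by (intro bij_is_inj bij_imp_bij_inv bij_cumulant_map graded_algebra_complex)
  have coalg: "coalgebra_map (?C X)" if "coalgebra_map X" for X :: "(complex ^ 'n) sym \<Rightarrow> 'v sym"
    by (intro coalgebra_map_compose coalgebra_map_reduce unital_coalgebra_map_ufunct e coalgebra_map_cumulant_map m that)
  have "joint_cumulant m e X = joint_cumulant m e Y \<longleftrightarrow> ?C X = ?C Y"
    by (simp add: joint_cumulant_def total_cumulant_def transport_def coalgebra_map_of_linear_part[OF e] fun_eq_iff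
        inj_eq[OF inj])
  also have "\<dots> \<longleftrightarrow> (\<forall>y. sym_proj (?C X y) = sym_proj (?C Y y))"
    using coalgebra_map_unique[OF coalg[OF X] coalg[OF Y]] by metis
  finally show ?thesis by (simp add: sym_proj_ufunct[OF e])
qed

text \<open>Primitives have to be chosen linearly, because they become components of a coalgebra map.\<close>

lemma clinear_section:
  fixes d :: "'a::graded_space \<Rightarrow> 'b::graded_space"
  assumes d: "clinear d"
  shows "\<exists>h. clinear h \<and> (\<forall>v. h v \<in> gcomp p) \<and> (\<forall>v \<in> d ` gcomp p. d (h v) = v)"
proof -
  interpret vector_space_pair "scaleC :: complex \<Rightarrow> 'a \<Rightarrow> 'a" "scaleC :: complex \<Rightarrow> 'b \<Rightarrow> 'b"
    by unfold_locales
  have "complex_space.subspace (gcomp p :: 'a set)"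
    by (simp add: complex_space.subspace_def gcomp_0 gcomp_add gcomp_scale)
  from linear_exists_right_inverse_on[OF d this] show ?thesis by blast
qed

theorem proposition3p2:
  fixes d :: "'v::graded_space \<Rightarrow> 'v"
    and m :: "'v \<Rightarrow> 'v \<Rightarrow> 'v"
    and \<upsilon> :: "complex \<Rightarrow> 'v"
    and e :: "'v \<Rightarrow> complex"
    and X Y :: "(complex ^ 'n) sym \<Rightarrow> 'v sym"
  assumes "homotopy_probability_space d m \<upsilon> e"
    and "contractible_space d e"
    and "homotopy_random_variables d m X"
    and "homotopy_random_variables d m Y"
  shows "linfty_homotopic (\<lambda>_. 0) (transported_structure d m) X Y
    \<longleftrightarrow> joint_cumulant m e X = joint_cumulant m e Y"
proof -
  note m = homotopy_probability_spaceD(1)[OF assms(1)] and d = homotopy_probability_spaceD(2)[OF assms(1)]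
    and dd = homotopy_probability_spaceD(3)[OF assms(1)] and e = homotopy_probability_spaceD(4)[OF assms(1)]
    and ed = homotopy_probability_spaceD(5)[OF assms(1)]
  note ld = graded_map_linear[OF d]
  note mt = graded_algebra_form_bil[OF m] and D = graded_map_total_differential[OF d]
  have X: "linfty_morphism (\<lambda>_. 0) (transported_structure d m) X"
    and Y: "linfty_morphism (\<lambda>_. 0) (transported_structure d m) Y"
    using assms(3,4) by (simp_all add: homotopy_random_variables_def)
  have cX: "coalgebra_map X" and cY: "coalgebra_map Y" and zero: "linfty_structure (\<lambda>_ :: (complex ^ 'n) sym. 0)"
    using X Y unfolding linfty_morphism_def by blast+
  define f g where "f y = sym_proj (cumulant_map m (X y))" and "g y = sym_proj (cumulant_map m (Y y))" for y
  have f: "graded_map 0 f" "d (f y) = 0" and g: "graded_map 0 g" "d (g y) = 0" for y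
    using zero_morphism_components[OF m d X] zero_morphism_components[OF m d Y] by (simp_all add: f_def[abs_def] g_def[abs_def])
  have f0: "f y \<in> gcomp 0" and g0: "g y \<in> gcomp 0" for y
    using graded_map_gcomp[OF f(1) sym_degree_zero] graded_map_gcomp[OF g(1) sym_degree_zero] by simp_all
  let ?ev = "\<lambda>s. reduce (ufunct (eval_form s))"
  have ev: "coalgebra_map (?ev s)" for s
    by (intro coalgebra_map_reduce unital_coalgebra_map_ufunct graded_map_eval_form)
  have ev_proj: "sym_proj (cumulant_map m (?ev s z)) = eval_form s (sym_proj (cumulant_map (form_bil m) z))"
    for s and z :: "'v forms sym"
  proof -
    have "?ev s (cumulant_map (form_bil m) z) = cumulant_map m (?ev s z)"
      by (rule cumulant_map_ufunct[OF graded_map_eval_form mt m]) (rule eval_form_form_bil[OF cbilinear_mult[OF m]])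
    then show ?thesis
      by (simp only: sym_proj_ufunct[OF graded_map_eval_form] flip: \<open>?ev s _ = _\<close>)
  qed
  \<comment> \<open>Homotopies, too, are morphisms into a transported structure, so their components describe them.\<close>
  have homotopic: "linfty_homotopic (\<lambda>_. 0) (transported_structure d m) X Y \<longleftrightarrow>
      (\<exists>H. linfty_morphism (\<lambda>_. 0) (transported_structure (total_differential d) (form_bil m)) H \<and>
        ?ev 0 \<circ> H = X \<and> ?ev 1 \<circ> H = Y)"
    unfolding linfty_homotopic_def forms_structure_transported[OF m d]
      coalgebra_map_of_linear_part[OF graded_map_eval_form] ..
  show ?thesis
    unfolding homotopic joint_cumulant_eq_iff[OF m e cX cY] f_def[symmetric] g_def[symmetric]
  proof
    assume "\<exists>H. linfty_morphism (\<lambda>_. 0) (transported_structure (total_differential d) (form_bil m)) H \<and>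
        ?ev 0 \<circ> H = X \<and> ?ev 1 \<circ> H = Y"
    then obtain H where H: "linfty_morphism (\<lambda>_. 0) (transported_structure (total_differential d) (form_bil m)) H"
      "?ev 0 \<circ> H = X" "?ev 1 \<circ> H = Y" by blast
    show "\<forall>y. e (f y) = e (g y)"
    proof
      fix y
      have "f y = eval_form 0 (sym_proj (cumulant_map (form_bil m) (H y)))"
        "g y = eval_form 1 (sym_proj (cumulant_map (form_bil m) (H y)))"
        unfolding f_def g_def H(2,3)[symmetric] by (simp_all add: ev_proj)
      then show "e (f y) = e (g y)"
        using closed_form_end_points[OF ld e ed zero_morphism_components(2)[OF mt D H(1)]] by simp
    qed
  next
    assume eq: "\<forall>y. e (f y) = e (g y)"
    obtain s where s: "clinear s" "\<And>v. s v \<in> gcomp (-1)" "\<And>v. v \<in> d ` gcomp (-1) \<Longrightarrow> d (s v) = v"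
      using clinear_section[OF ld, of "-1"] by blast
    have dh: "d (s (g y - f y)) = g y - f y" for y
      by (intro s(3) contractible_cohomologous[OF ld assms(2)])
        (use f0 g0 f(2) g(2) eq in \<open>simp_all add: cocycles_def\<close>)
    \<comment> \<open>the components of a homotopy, after composition with the cumulant map\<close>
    define k where "k y = joining_form (f y) (g y) (s (g y - f y))" for y
    have "clinear k"
      unfolding k_def joining_form_def
      by (intro clinear_intros clinear_compose[OF s(1)] graded_map_linear[OF f(1)] graded_map_linear[OF g(1)])
    then have k: "graded_map 0 k"
      by (rule graded_map_degree_zero_sym) (simp add: k_def joining_form_gcomp f0 g0 s(2))
    have "total_differential d (k y) = 0" for y
      unfolding k_def by (rule joining_form_closed[OF ld f(2) g(2) dh f0 g0])
    from zero_morphism_exists[OF mt D total_differential_square[OF d dd] k this zero]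
    obtain H where H: "linfty_morphism (\<lambda>_. 0) (transported_structure (total_differential d) (form_bil m)) H"
      "\<And>y. sym_proj (cumulant_map (form_bil m) (H y)) = k y" by blast
    have cH: "coalgebra_map H" using H(1) unfolding linfty_morphism_def by blast
    have "?ev 0 \<circ> H = X" "?ev 1 \<circ> H = Y"
      by (rule coalgebra_maps_into_algebra_eqI[OF m coalgebra_map_compose[OF ev cH] cX]
          coalgebra_maps_into_algebra_eqI[OF m coalgebra_map_compose[OF ev cH] cY];
        simp add: ev_proj H(2) k_def eval_joining_form flip: f_def g_def)+
    with H(1) show "\<exists>H. linfty_morphism (\<lambda>_. 0) (transported_structure (total_differential d) (form_bil m)) H \<and>
        ?ev 0 \<circ> H = X \<and> ?ev 1 \<circ> H = Y" by blast
  qed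
qed

end
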